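(* Let $X\subset Z$ be an $A$-invariant compact submanifold. For any $x\in X$, the set $\mu_{\mathfrak a}(A\cdot x)$ is an open convex subset of the affine subspace $\mu_{\mathfrak a}(x)+\mathfrak{a}_x^\perp$ of $\mathfrak{a}$; its closure coincides with $\mu_{\mathfrak a}(\overline{A\cdot x})$, is a polytope, and is the convex hull of $\mu_{\mathfrak a}(X^A\cap\overline{A\cdot x})$.
   Context: $U$ is a compact connected Lie group with Lie algebra $\mathfrak{u}$ and complexification $U^{\mathbb{C}}$. $(Z,\omega)$ is a Kähler manifold on which $U^{\mathbb{C}}$ acts holomorphically, and $U$ acts in a Hamiltonian fashion with momentum map $\mu:Z\to\mathfrak{u}^*$: $\omega$ is $U$-invariant, $\mu$ is $U$-equivariant and $d\mu^\beta=i_{\beta_Z}\omega$ for all $\beta\in\mathfrak{u}$, where $\mu^\beta=\langle\mu,\beta\rangle$ and $\beta_Z$ is the fundamental vector field on $Z$ induced by $\beta$. (The Kähler metric is $\omega(\cdot,J\cdot)$, with $J$ the complex structure.) Fix a $U$-invariant scalar product $\langle\,,\,\rangle$ on $\mathfrak{u}$, identify $\mathfrak{u}\cong\mathfrak{u}^*$, and denote also by $\langle\,,\,\rangle$ the scalar product on $i\mathfrak{u}$ such that multiplication by $i$ is an isometry $\mathfrak{u}\to i\mathfrak{u}$. $G\subset U^{\mathbb{C}}$ is a closed connected compatible subgroup, i.e. $G=K\exp(\mathfrak{p})$ with $K=U\cap G$ and $\mathfrak{p}=\mathfrak{g}\cap i\mathfrak{u}$. $\mathfrak{a}\subset\mathfrak{p}$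 is an abelian subalgebra and $A=\exp(\mathfrak{a})$. The gradient map $\mu_{\mathfrak a}:Z\to\mathfrak{a}$ is defined by $\langle\mu_{\mathfrak a}(z),\beta\rangle=-\langle\mu(z),i\beta\rangle$ for all $\beta\in\mathfrak{a}$. $X^A$ is the set of $A$-fixed points in $X$; $\mathfrak{a}_x$ is the Lie algebra of the stabilizer $A_x$ of $x$ in $A$; $\perp$ denotes the orthogonal complement in $\mathfrak{a}$. *)

theory Defs
  imports "HOL-Analysis.Analysis" "HOL-Algebra.Group_Action"
begin

section \<open>Smooth and holomorphic maps between finite-dimensional vector spaces\<close>

text \<open>All sets on which smoothness is considered are open.\<close>

primrec Ck_on :: "nat \<Rightarrow> 'a::euclidean_space set \<Rightarrow> ('a \<Rightarrow> 'b::real_normed_vector) \<Rightarrow> bool" where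
  "Ck_on 0 S f = continuous_on S f"
| "Ck_on (Suc k) S f =
     (\<exists>f'. (\<forall>x\<in>S. (f has_derivative f' x) (at x)) \<and> (\<forall>v. Ck_on k S (\<lambda>x. f' x v)))"

definition smooth_on :: "'a::euclidean_space set \<Rightarrow> ('a \<Rightarrow> 'b::real_normed_vector) \<Rightarrow> bool" where
  "smooth_on S f \<longleftrightarrow> (\<forall>k. Ck_on k S f)"

text \<open>A finite-dimensional complex vector space is given as a Euclidean space (its underlying
  real vector space) with the operator \<open>J\<close> of multiplication by the imaginary unit,
  e.g. \<open>complex ^ 'n\<close> with \<open>J v = \<i> *s v\<close>.\<close>

definition complex_structure :: "('e::euclidean_space \<Rightarrow> 'e) \<Rightarrow> bool" where
  "complex_structure J \<longleftrightarrow> linear J \<and> (\<forall>v. J (J v) = - v)"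

definition holo_on ::
  "('a::euclidean_space \<Rightarrow> 'a) \<Rightarrow> ('b::euclidean_space \<Rightarrow> 'b) \<Rightarrow> 'a set \<Rightarrow> ('a \<Rightarrow> 'b) \<Rightarrow> bool" where
  "holo_on J J' S f \<longleftrightarrow> smooth_on S f \<and>
     (\<forall>x\<in>S. \<forall>v. frechet_derivative f (at x) (J v) = J' (frechet_derivative f (at x) v))"

section \<open>Complex manifolds and submanifolds\<close>

text \<open>A manifold is the universe of a Hausdorff, second countable type with an atlas of charts
  into a Euclidean space.\<close>

datatype ('m, 'e) chart = Chart (cdom: "'m set") (coord: "'m \<Rightarrow> 'e")

definition cinv :: "('m, 'e) chart \<Rightarrow> 'e \<Rightarrow> 'm" where
  "cinv c = inv_into (cdom c) (coord c)"

definition is_chart :: "('m::topological_space, 'e::euclidean_space) chart \<Rightarrow> bool" where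
  "is_chart c \<longleftrightarrow> open (cdom c) \<and> open (coord c ` cdom c) \<and>
     homeomorphism (cdom c) (coord c ` cdom c) (coord c) (cinv c)"

definition complex_manifold ::
  "('m::{t2_space,second_countable_topology}, 'e::euclidean_space) chart set \<Rightarrow> ('e \<Rightarrow> 'e) \<Rightarrow> bool" where
  "complex_manifold \<A> J \<longleftrightarrow> complex_structure J \<and>
     (\<forall>c\<in>\<A>. is_chart c) \<and> (\<Union>c\<in>\<A>. cdom c) = UNIV \<and>
     (\<forall>c\<in>\<A>. \<forall>d\<in>\<A>. holo_on J J (coord c ` (cdom c \<inter> cdom d)) (coord d \<circ> cinv c))"

definition prod_atlas ::
  "('m, 'e) chart set \<Rightarrow> ('n, 'f) chart set \<Rightarrow> ('m \<times> 'n, 'e \<times> 'f) chart set" where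
  "prod_atlas \<A> \<B> =
     (\<lambda>(c, d). Chart (cdom c \<times> cdom d) (map_prod (coord c) (coord d))) ` (\<A> \<times> \<B>)"

definition holo_map ::
  "('m::topological_space, 'e::euclidean_space) chart set \<Rightarrow> ('e \<Rightarrow> 'e) \<Rightarrow>
   ('n::topological_space, 'f::euclidean_space) chart set \<Rightarrow> ('f \<Rightarrow> 'f) \<Rightarrow> ('m \<Rightarrow> 'n) \<Rightarrow> bool" where
  "holo_map \<A> J \<B> J' f \<longleftrightarrow> continuous_on UNIV f \<and>
     (\<forall>c\<in>\<A>. \<forall>d\<in>\<B>. holo_on J J' (coord c ` (cdom c \<inter> f -` cdom d)) (coord d \<circ> f \<circ> cinv c))"

definition smooth_chart ::
  "('m::topological_space, 'e::euclidean_space) chart set \<Rightarrow> ('m, 'e) chart \<Rightarrow> bool" where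
  "smooth_chart \<A> c \<longleftrightarrow> is_chart c \<and>
     (\<forall>d\<in>\<A>. smooth_on (coord c ` (cdom c \<inter> cdom d)) (coord d \<circ> cinv c) \<and>
            smooth_on (coord d ` (cdom c \<inter> cdom d)) (coord c \<circ> cinv d))"

text \<open>Embedded real submanifolds, via smooth (not necessarily holomorphic) slice charts.\<close>

definition submanifold ::
  "('m::topological_space, 'e::euclidean_space) chart set \<Rightarrow> 'm set \<Rightarrow> bool" where
  "submanifold \<A> X \<longleftrightarrow> (\<forall>x\<in>X. \<exists>c S. smooth_chart \<A> c \<and> x \<in> cdom c \<and> subspace S \<and>
     coord c ` (cdom c \<inter> X) = coord c ` cdom c \<inter> S)"

section \<open>Complex Lie groups\<close>

definition complex_Lie_group ::
  "('h::{t2_space,second_countable_topology}) monoid \<Rightarrow> ('h, 'e::euclidean_space) chart set \<Rightarrow>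
   ('e \<Rightarrow> 'e) \<Rightarrow> bool" where
  "complex_Lie_group H \<A> J \<longleftrightarrow> group H \<and> carrier H = UNIV \<and> complex_manifold \<A> J \<and>
     holo_map (prod_atlas \<A> \<A>) (map_prod J J) \<A> J (\<lambda>(g, h). g \<otimes>\<^bsub>H\<^esub> h) \<and>
     holo_map \<A> J \<A> J (\<lambda>g. inv\<^bsub>H\<^esub> g)"

text \<open>The Lie algebra of \<open>H\<close>, i.e. the tangent space at the identity, is identified with the model
  space \<open>'e\<close> by the differential of a holomorphic chart \<open>\<kappa>\<close> around the identity; multiplication
  by the imaginary unit is then \<open>J\<close>.\<close>

definition one_parameter_subgroup ::
  "('h::topological_space) monoid \<Rightarrow> (real \<Rightarrow> 'h) \<Rightarrow> bool" where
  "one_parameter_subgroup H \<gamma> \<longleftrightarrow>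
     continuous_on UNIV \<gamma> \<and> (\<forall>s t. \<gamma> (s + t) = \<gamma> s \<otimes>\<^bsub>H\<^esub> \<gamma> t)"

definition Lie_exp ::
  "('h::topological_space) monoid \<Rightarrow> ('h, 'e::euclidean_space) chart \<Rightarrow> 'e \<Rightarrow> 'h" where
  "Lie_exp H \<kappa> v = (THE \<gamma>. one_parameter_subgroup H \<gamma> \<and>
     ((\<lambda>t. coord \<kappa> (\<gamma> t)) has_vector_derivative v) (at 0)) 1"

definition Ad ::
  "('h::topological_space) monoid \<Rightarrow> ('h, 'e::euclidean_space) chart \<Rightarrow> 'h \<Rightarrow> 'e \<Rightarrow> 'e" where
  "Ad H \<kappa> g v =
     vector_derivative (\<lambda>t. coord \<kappa> (g \<otimes>\<^bsub>H\<^esub> Lie_exp H \<kappa> (t *\<^sub>R v) \<otimes>\<^bsub>H\<^esub> inv\<^bsub>H\<^esub> g)) (at 0)"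

definition Lie_bracket ::
  "('h::topological_space) monoid \<Rightarrow> ('h, 'e::euclidean_space) chart \<Rightarrow> 'e \<Rightarrow> 'e \<Rightarrow> 'e" where
  "Lie_bracket H \<kappa> v w = vector_derivative (\<lambda>s. Ad H \<kappa> (Lie_exp H \<kappa> (s *\<^sub>R v)) w) (at 0)"

text \<open>The Lie algebra of a closed subgroup.\<close>

definition Lie_alg ::
  "('h::topological_space) monoid \<Rightarrow> ('h, 'e::euclidean_space) chart \<Rightarrow> 'h set \<Rightarrow> 'e set" where
  "Lie_alg H \<kappa> S = {v. \<forall>t. Lie_exp H \<kappa> (t *\<^sub>R v) \<in> S}"

definition abelian_subalgebra ::
  "('h::topological_space) monoid \<Rightarrow> ('h, 'e::euclidean_space) chart \<Rightarrow> 'e set \<Rightarrow> bool" where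
  "abelian_subalgebra H \<kappa> \<aa> \<longleftrightarrow>
     subspace \<aa> \<and> (\<forall>v\<in>\<aa>. \<forall>w\<in>\<aa>. Lie_bracket H \<kappa> v w = 0)"

text \<open>The complex Lie group \<open>H\<close> is the complexification of its compact subgroup \<open>U\<close>: the Lie algebra
  of \<open>H\<close> is the complexification of that of \<open>U\<close>, and the polar (Cartan) decomposition
  \<open>H = U exp(i\<uu>)\<close> holds. Up to isomorphism this determines \<open>H\<close> from \<open>U\<close>; it is used in place of
  the universal property, which quantifies over all complex Lie groups.\<close>

definition complexification_of ::
  "('h::topological_space) monoid \<Rightarrow> ('h, 'e::euclidean_space) chart \<Rightarrow> ('e \<Rightarrow> 'e) \<Rightarrow> 'h set \<Rightarrow> bool" where
  "complexification_of H \<kappa> J U \<longleftrightarrow>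
     (let \<uu> = Lie_alg H \<kappa> U in
       \<uu> \<inter> J ` \<uu> = {0} \<and> {v + J w | v w. v \<in> \<uu> \<and> w \<in> \<uu>} = UNIV \<and>
       (\<exists>p. homeomorphism (U \<times> \<uu>) UNIV (\<lambda>(k, v). k \<otimes>\<^bsub>H\<^esub> Lie_exp H \<kappa> (J v)) p))"

text \<open>The subspace \<open>\<pp> = \<gg> \<inter> i\<uu>\<close> and compatibility, \<open>G = (U \<inter> G) exp \<pp>\<close>.\<close>

definition p_part ::
  "('h::topological_space) monoid \<Rightarrow> ('h, 'e::euclidean_space) chart \<Rightarrow> ('e \<Rightarrow> 'e) \<Rightarrow>
   'h set \<Rightarrow> 'h set \<Rightarrow> 'e set" where
  "p_part H \<kappa> J U G = Lie_alg H \<kappa> G \<inter> J ` Lie_alg H \<kappa> U"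

definition compatible_subgroup ::
  "('h::topological_space) monoid \<Rightarrow> ('h, 'e::euclidean_space) chart \<Rightarrow> ('e \<Rightarrow> 'e) \<Rightarrow>
   'h set \<Rightarrow> 'h set \<Rightarrow> bool" where
  "compatible_subgroup H \<kappa> J U G \<longleftrightarrow> subgroup G H \<and>
     G = {k \<otimes>\<^bsub>H\<^esub> Lie_exp H \<kappa> v | k v. k \<in> U \<inter> G \<and> v \<in> p_part H \<kappa> J U G}"

text \<open>\<open>ip\<close> is an invariant scalar product on the Lie algebra of \<open>U\<close>; its values elsewhere are
  irrelevant.\<close>

definition invariant_scalar_product ::
  "('h::topological_space) monoid \<Rightarrow> ('h, 'e::euclidean_space) chart \<Rightarrow> 'h set \<Rightarrow>
   ('e \<Rightarrow> 'e \<Rightarrow> real) \<Rightarrow> bool" where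
  "invariant_scalar_product H \<kappa> U ip \<longleftrightarrow>
     (let \<uu> = Lie_alg H \<kappa> U in
       (\<forall>u\<in>\<uu>. \<forall>v\<in>\<uu>. \<forall>w\<in>\<uu>. ip (u + v) w = ip u w + ip v w) \<and>
       (\<forall>r. \<forall>v\<in>\<uu>. \<forall>w\<in>\<uu>. ip (r *\<^sub>R v) w = r * ip v w) \<and>
       (\<forall>v\<in>\<uu>. \<forall>w\<in>\<uu>. ip v w = ip w v) \<and>
       (\<forall>v\<in>\<uu>. v \<noteq> 0 \<longrightarrow> ip v v > 0) \<and>
       (\<forall>k\<in>U. \<forall>v\<in>\<uu>. \<forall>w\<in>\<uu>. ip (Ad H \<kappa> k v) (Ad H \<kappa> k w) = ip v w))"

text \<open>The scalar product on \<open>i\<uu>\<close> for which multiplication by the imaginary unit is an isometry: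
  a vector \<open>v\<close> of \<open>i\<uu>\<close> is \<open>J (- J v)\<close>.\<close>

definition scalar_product_i :: "('e::real_vector \<Rightarrow> 'e) \<Rightarrow> ('e \<Rightarrow> 'e \<Rightarrow> real) \<Rightarrow> 'e \<Rightarrow> 'e \<Rightarrow> real" where
  "scalar_product_i J ip v w = ip (- J v) (- J w)"

section \<open>Kaehler manifolds and Hamiltonian actions\<close>

text \<open>A two-form is given by its expressions in the charts of the atlas: \<open>\<omega> c z v w\<close> is its value
  at the point \<open>z\<close> on the tangent vectors whose coordinates in the chart \<open>c\<close> are \<open>v\<close> and \<open>w\<close>.\<close>

type_synonym ('m, 'e) two_form = "('m, 'e) chart \<Rightarrow> 'm \<Rightarrow> 'e \<Rightarrow> 'e \<Rightarrow> real"

definition is_two_form ::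
  "('m, 'e::euclidean_space) chart set \<Rightarrow> ('m, 'e) two_form \<Rightarrow> bool" where
  "is_two_form \<B> \<omega> \<longleftrightarrow>
     (\<forall>c\<in>\<B>. \<forall>z\<in>cdom c. bilinear (\<omega> c z) \<and> (\<forall>v. \<omega> c z v v = 0)) \<and>
     (\<forall>c\<in>\<B>. \<forall>v w. smooth_on (coord c ` cdom c) (\<lambda>y. \<omega> c (cinv c y) v w)) \<and>
     (\<forall>c\<in>\<B>. \<forall>d\<in>\<B>. \<forall>z\<in>cdom c \<inter> cdom d. \<forall>v w.
        (let D = frechet_derivative (coord d \<circ> cinv c) (at (coord c z))
         in \<omega> c z v w = \<omega> d z (D v) (D w)))"

definition closed_two_form ::
  "('m, 'e::euclidean_space) chart set \<Rightarrow> ('m, 'e) two_form \<Rightarrow> bool" where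
  "closed_two_form \<B> \<omega> \<longleftrightarrow>
     (\<forall>c\<in>\<B>. \<forall>y\<in>coord c ` cdom c. \<forall>u v w.
        frechet_derivative (\<lambda>y. \<omega> c (cinv c y) v w) (at y) u
      - frechet_derivative (\<lambda>y. \<omega> c (cinv c y) u w) (at y) v
      + frechet_derivative (\<lambda>y. \<omega> c (cinv c y) u v) (at y) w = 0)"

text \<open>The Kaehler metric is \<open>\<omega>(\<cdot>, J\<cdot>)\<close>.\<close>

definition Kaehler_manifold ::
  "('m::{t2_space,second_countable_topology}, 'e::euclidean_space) chart set \<Rightarrow> ('e \<Rightarrow> 'e) \<Rightarrow>
   ('m, 'e) two_form \<Rightarrow> bool" where
  "Kaehler_manifold \<B> J \<omega> \<longleftrightarrow> complex_manifold \<B> J \<and> is_two_form \<B> \<omega> \<and> closed_two_form \<B> \<omega> \<and>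
     (\<forall>c\<in>\<B>. \<forall>z\<in>cdom c. \<forall>v w. \<omega> c z (J v) (J w) = \<omega> c z v w) \<and>
     (\<forall>c\<in>\<B>. \<forall>z\<in>cdom c. \<forall>v. v \<noteq> 0 \<longrightarrow> \<omega> c z v (J v) > 0)"

definition holomorphic_action ::
  "('h::topological_space) monoid \<Rightarrow> ('h, 'e::euclidean_space) chart set \<Rightarrow> ('e \<Rightarrow> 'e) \<Rightarrow>
   ('z::topological_space, 'f::euclidean_space) chart set \<Rightarrow> ('f \<Rightarrow> 'f) \<Rightarrow> ('h \<Rightarrow> 'z \<Rightarrow> 'z) \<Rightarrow> bool" where
  "holomorphic_action H \<A> JH \<B> JZ act \<longleftrightarrow> group_action H UNIV act \<and>
     holo_map (prod_atlas \<A> \<B>) (map_prod JH JZ) \<B> JZ (\<lambda>(h, z). act h z)"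

text \<open>Coordinates, in the chart \<open>c\<close>, of the fundamental vector field of \<open>\<beta>\<close> at \<open>z\<close>.\<close>

definition fundamental_field ::
  "('h::topological_space) monoid \<Rightarrow> ('h, 'e::euclidean_space) chart \<Rightarrow> ('h \<Rightarrow> 'z \<Rightarrow> 'z) \<Rightarrow>
   'e \<Rightarrow> ('z, 'f::euclidean_space) chart \<Rightarrow> 'z \<Rightarrow> 'f" where
  "fundamental_field H \<kappa> act \<beta> c z =
     vector_derivative (\<lambda>t. coord c (act (Lie_exp H \<kappa> (t *\<^sub>R \<beta>)) z)) (at 0)"

definition invariant_two_form ::
  "('z, 'f::euclidean_space) chart set \<Rightarrow> ('z, 'f) two_form \<Rightarrow> ('h \<Rightarrow> 'z \<Rightarrow> 'z) \<Rightarrow> 'h set \<Rightarrow> bool" where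
  "invariant_two_form \<B> \<omega> act U \<longleftrightarrow>
     (\<forall>k\<in>U. \<forall>c\<in>\<B>. \<forall>d\<in>\<B>. \<forall>z. z \<in> cdom c \<and> act k z \<in> cdom d \<longrightarrow>
        (let D = frechet_derivative (coord d \<circ> act k \<circ> cinv c) (at (coord c z))
         in \<forall>v w. \<omega> d (act k z) (D v) (D w) = \<omega> c z v w))"

text \<open>A momentum map with values in the dual of the Lie algebra \<open>\<uu>\<close> of \<open>U\<close>: \<open>\<mu> z \<beta>\<close> is
  the value of the linear form \<open>\<mu> z\<close> on \<open>\<beta> \<in> \<uu>\<close>; values outside \<open>\<uu>\<close> are irrelevant.
  The equivariance is with respect to the coadjoint action. The last condition is
  \<open>d\<mu>\<^sup>\<beta> = \<omega>(\<beta>\<^sub>Z, \<cdot>)\<close>.\<close>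

definition momentum_map ::
  "('h::topological_space) monoid \<Rightarrow> ('h, 'e::euclidean_space) chart \<Rightarrow> 'h set \<Rightarrow>
   ('z, 'f::euclidean_space) chart set \<Rightarrow> ('z, 'f) two_form \<Rightarrow> ('h \<Rightarrow> 'z \<Rightarrow> 'z) \<Rightarrow>
   ('z \<Rightarrow> 'e \<Rightarrow> real) \<Rightarrow> bool" where
  "momentum_map H \<kappa> U \<B> \<omega> act \<mu> \<longleftrightarrow>
     (let \<uu> = Lie_alg H \<kappa> U in
       (\<forall>z. \<forall>v\<in>\<uu>. \<forall>w\<in>\<uu>. \<mu> z (v + w) = \<mu> z v + \<mu> z w) \<and>
       (\<forall>z r. \<forall>v\<in>\<uu>. \<mu> z (r *\<^sub>R v) = r * \<mu> z v) \<and>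
       (\<forall>c\<in>\<B>. \<forall>\<beta>\<in>\<uu>. smooth_on (coord c ` cdom c) (\<lambda>y. \<mu> (cinv c y) \<beta>)) \<and>
       (\<forall>k\<in>U. \<forall>z. \<forall>\<beta>\<in>\<uu>. \<mu> (act k z) (Ad H \<kappa> k \<beta>) = \<mu> z \<beta>) \<and>
       (\<forall>c\<in>\<B>. \<forall>z\<in>cdom c. \<forall>\<beta>\<in>\<uu>.
          ((\<lambda>y. \<mu> (cinv c y) \<beta>) has_derivative \<omega> c z (fundamental_field H \<kappa> act \<beta> c z))
            (at (coord c z))))"

definition gradient_map ::
  "('e::real_vector \<Rightarrow> 'e) \<Rightarrow> ('e \<Rightarrow> 'e \<Rightarrow> real) \<Rightarrow> ('z \<Rightarrow> 'e \<Rightarrow> real) \<Rightarrow> 'e set \<Rightarrow> 'z \<Rightarrow> 'e" where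
  "gradient_map J ip \<mu> \<aa> z =
     (THE v. v \<in> \<aa> \<and> (\<forall>\<beta>\<in>\<aa>. scalar_product_i J ip v \<beta> = - \<mu> z (J \<beta>)))"

definition action_orbit :: "('h \<Rightarrow> 'z \<Rightarrow> 'z) \<Rightarrow> 'h set \<Rightarrow> 'z \<Rightarrow> 'z set" where
  "action_orbit act A x = (\<lambda>h. act h x) ` A"

definition fixed_points :: "('h \<Rightarrow> 'z \<Rightarrow> 'z) \<Rightarrow> 'h set \<Rightarrow> 'z set \<Rightarrow> 'z set" where
  "fixed_points act A X = {x \<in> X. \<forall>h\<in>A. act h x = x}"

text \<open>The stabilizer of \<open>x\<close> in the subgroup \<open>A\<close>.\<close>

definition stabilizer_in :: "('h \<Rightarrow> 'z \<Rightarrow> 'z) \<Rightarrow> 'h set \<Rightarrow> 'z \<Rightarrow> 'h set" where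
  "stabilizer_in act A x = {h \<in> A. act h x = x}"

text \<open>The orthogonal complement in \<open>V\<close> of \<open>S\<close> for the scalar product \<open>q\<close>.\<close>

definition orth_compl_in :: "('e \<Rightarrow> 'e \<Rightarrow> real) \<Rightarrow> 'e set \<Rightarrow> 'e set \<Rightarrow> 'e set" where
  "orth_compl_in q V S = {v \<in> V. \<forall>w\<in>S. q v w = 0}"

end

theory Submission
  imports Defs
begin

text \<open>Write \<open>f\<^sub>\<beta> = \<langle>\<mu>\<^sub>\<aa>, \<beta>\<rangle>\<close>. Since \<open>df\<^sub>\<beta> = -\<omega>(J \<beta>\<^sub>Z, \<cdot>)\<close>, the field \<open>\<beta>\<^sub>Z\<close> is the gradient of \<open>f\<^sub>\<beta>\<close>, so
  \<open>f\<^sub>\<beta>\<close> is strictly increasing along \<open>t \<mapsto> exp(t\<beta>) z\<close> unless this curve is constant. Hence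
  \<open>\<xi> \<mapsto> \<mu>\<^sub>\<aa>(exp(\<xi>) x)\<close> is a bounded, continuous and strictly monotone map on \<open>\<aa>\<^sub>x\<^sup>\<bottom>\<close>. A value \<open>p\<close> is attained by
  such a map \<open>F\<close> iff \<open>F - p\<close> is coercive (Brouwer), and this condition on \<open>p\<close> is convex and open.

  An extreme point of the closure is \<open>\<mu>\<^sub>\<aa>(y)\<close> for some \<open>y\<close> in the orbit closure, and
  \<open>\<mu>\<^sub>\<aa>(A y)\<close> is open in \<open>\<mu>\<^sub>\<aa>(y) + \<aa>\<^sub>y\<^sup>\<bottom>\<close>, so \<open>\<aa>\<^sub>y = \<aa>\<close> and \<open>y\<close> is fixed; the Krein-Milman theorem
  gives the convex hull.

  The hull is a polytope because \<open>\<mu>\<^sub>\<aa>\<close> is locally constant on the fixed points of \<open>A\<close>: if the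
  Hamiltonian flow of \<open>f\<close> stays in a compact group and fixes two nearby points \<open>a\<close> and \<open>b\<close>, then the surface
  swept out by a segment from \<open>a\<close> to \<open>b\<close> up to time \<open>t\<close> has symplectic area \<open>t (f b - f a)\<close>. By Stokes'
  theorem this area is bounded independently of \<open>t\<close>.\<close>

section \<open>Strictly monotone maps\<close>

lemma subspace_basis:
  assumes "subspace V"
  obtains B where "B \<subseteq> V" "independent B" "span B = V"
  using maximal_independent_subset[of V] span_minimal[OF _ assms] by (metis subset_antisym)

lemma linear_projection:
  fixes V :: "'a::euclidean_space set"
  assumes "subspace V"
  obtains \<pi> :: "'a \<Rightarrow> 'a" where "linear \<pi>" "\<And>v. \<pi> v \<in> V" "\<And>v. v \<in> V \<Longrightarrow> \<pi> v = v"
proof -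
  obtain B where B: "B \<subseteq> V" "independent B" "span B = V"
    by (rule subspace_basis[OF assms])
  obtain \<pi> where \<pi>: "linear \<pi>" "\<And>x. x \<in> B \<Longrightarrow> \<pi> x = x" "range \<pi> = span B"
    using linear_independent_extend_subspace[OF B(2), of "\<lambda>x. x"] by auto
  show ?thesis
  proof (rule that[OF \<pi>(1)])
    show "\<pi> v \<in> V" for v using \<pi>(3) B(3) by blast
    show "\<pi> v = v" if "v \<in> V" for v
      using linear_eq_on[OF \<pi>(1) linear_id, of v B] \<pi>(2) B(3) that by simp
  qed
qed

locale subspace_inner =
  fixes V :: "'e::euclidean_space set" and Q :: "'e \<Rightarrow> 'e \<Rightarrow> real"
  assumes subspace_V: "subspace V"
    and bilinear_Q: "bilinear Q"
    and Q_sym: "\<lbrakk>v \<in> V; w \<in> V\<rbrakk> \<Longrightarrow> Q v w = Q w v"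
    and Q_pos: "\<lbrakk>v \<in> V; v \<noteq> 0\<rbrakk> \<Longrightarrow> Q v v > 0"
begin

lemma linear_Q_right: "linear (Q v)"
  using bilinear_Q by (auto simp: bilinear_def)

sublocale Q: bounded_bilinear Q
  using bilinear_Q bilinear_conv_bounded_bilinear by blast

lemma Q_nonneg: "v \<in> V \<Longrightarrow> Q v v \<ge> 0"
  using Q_pos[of v] by (cases "v = 0") (auto simp: Q.zero_left)

lemma Q_riesz:
  assumes N: "subspace N" "N \<subseteq> V" and l: "linear l"
  shows "\<exists>\<theta>\<in>N. \<forall>n\<in>N. Q \<theta> n = l n"
proof -
  obtain B where B: "B \<subseteq> N" "independent B" "card B = dim N" "span B = N"
    using orthonormal_basis_subspace[OF N(1)] by metis
  have finB: "finite B" using B(2) by (rule independent_imp_finite)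
  define T where "T = (\<lambda>\<theta>. \<Sum>b\<in>B. Q \<theta> b *\<^sub>R b)"
  have linT: "linear T"
    unfolding T_def
    by (intro linearI) (simp_all add: Q.add_left Q.scaleR_left scaleR_left_distrib sum.distrib scaleR_sum_right)
  have coeff: "\<forall>b\<in>B. u b = w b" if "(\<Sum>b\<in>B. u b *\<^sub>R b) = (\<Sum>b\<in>B. w b *\<^sub>R b)" for u w :: "'e \<Rightarrow> real"
  proof -
    have "(\<Sum>b\<in>B. (u b - w b) *\<^sub>R b) = 0"
      using that by (simp add: scaleR_left_diff_distrib sum_subtractf)
    then have "u b - w b = 0" if "b \<in> B" for b
      using independentD[OF B(2) finB subset_refl, of "\<lambda>b. u b - w b"] that by blast
    then show ?thesis by simp
  qed
  have sub: "T ` N \<subseteq> N"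
    using B(1) N(1) unfolding T_def by (auto intro!: subspace_sum subspace_scale)
  have inj: "inj_on T (span N)"
  proof -
    have "\<theta> = 0" if "\<theta> \<in> N" "T \<theta> = 0" for \<theta>
    proof -
      have "\<forall>b\<in>B. Q \<theta> b = 0" using coeff[of "Q \<theta>" "\<lambda>_. 0"] that by (simp add: T_def)
      then have "Q \<theta> \<theta> = 0"
        using linear_eq_on[OF linear_Q_right linear_zero, of \<theta> B \<theta>] that B(4) by auto
      then show ?thesis using Q_pos N(2) that by force
    qed
    then show ?thesis
      using linear_inj_on_iff_eq_0[OF linT N(1)] N(1) by (simp add: span_eq_iff[THEN iffD2])
  qed
  have "T ` N = N"
    by (rule subspace_dim_equal)
      (use linT N(1) sub dim_image_eq[OF linT inj] in \<open>auto intro: linear_subspace_image\<close>)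
  moreover have "(\<Sum>b\<in>B. l b *\<^sub>R b) \<in> N"
    using B(1) N(1) by (auto intro!: subspace_sum subspace_scale)
  ultimately have "(\<Sum>b\<in>B. l b *\<^sub>R b) \<in> T ` N" by simp
  then obtain \<theta> where \<theta>: "\<theta> \<in> N" "T \<theta> = (\<Sum>b\<in>B. l b *\<^sub>R b)" by auto
  have "\<forall>b\<in>B. Q \<theta> b = l b" using coeff \<theta>(2) by (simp add: T_def)
  then have "\<forall>n\<in>N. Q \<theta> n = l n"
    using linear_eq_on[OF linear_Q_right l, of _ B \<theta>] B(4) by auto
  with \<theta>(1) show ?thesis by blast
qed

lemma subspace_orth_compl: "N \<subseteq> V \<Longrightarrow> subspace (orth_compl_in Q V N)"
  using subspace_V
  by (auto simp: subspace_def orth_compl_in_def Q.zero_left Q.add_left Q.scaleR_left)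

lemma Q_decomp:
  assumes "subspace N" "N \<subseteq> V" "v \<in> V"
  obtains \<theta> where "\<theta> \<in> N" "v - \<theta> \<in> orth_compl_in Q V N"
proof -
  obtain \<theta> where \<theta>: "\<theta> \<in> N" "\<forall>n\<in>N. Q \<theta> n = Q v n"
    using Q_riesz[OF assms(1,2) linear_Q_right] by blast
  then have "v - \<theta> \<in> orth_compl_in Q V N"
    using assms subspace_V by (auto simp: orth_compl_in_def Q.diff_left subspace_diff)
  with \<theta>(1) show ?thesis by (rule that)
qed

lemma brouwer_zero:
  assumes M: "subspace M" "M \<subseteq> V" and G: "G \<in> M \<rightarrow> M" "continuous_on M G"
    and R: "R > 0" and pos: "\<And>\<xi>. \<lbrakk>\<xi> \<in> M; Q \<xi> \<xi> = R\<^sup>2\<rbrakk> \<Longrightarrow> Q (G \<xi>) \<xi> > 0"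
  shows "\<exists>\<xi>\<in>M. G \<xi> = 0"
proof (rule ccontr)
  assume "\<not> ?thesis"
  then have ne: "\<And>\<xi>. \<xi> \<in> M \<Longrightarrow> G \<xi> \<noteq> 0" by blast
  have GM: "\<And>\<xi>. \<xi> \<in> M \<Longrightarrow> G \<xi> \<in> M" using G(1) by blast
  have Gpos: "\<And>\<xi>. \<xi> \<in> M \<Longrightarrow> Q (G \<xi>) (G \<xi>) > 0" using Q_pos ne GM M(2) by blast
  define S where "S = {\<xi> \<in> M. Q \<xi> \<xi> \<le> R\<^sup>2}"
  define n where "n = (\<lambda>\<xi>. sqrt (Q \<xi> \<xi>))"
  have closedM: "closed M" using M(1) by (rule closed_subspace)
  have "\<exists>m>0. \<forall>\<xi>\<in>M. m * (norm \<xi>)\<^sup>2 \<le> Q \<xi> \<xi>"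
  proof (cases "M \<inter> sphere 0 1 = {}")
    case True
    have "\<xi> = 0" if "\<xi> \<in> M" for \<xi>
    proof (rule ccontr)
      assume "\<xi> \<noteq> 0"
      then have "inverse (norm \<xi>) *\<^sub>R \<xi> \<in> M \<inter> sphere 0 1"
        using that M(1) by (simp add: subspace_scale)
      with True show False by blast
    qed
    then have "1 * (norm \<xi>)\<^sup>2 \<le> Q \<xi> \<xi>" if "\<xi> \<in> M" for \<xi>
      using that by (metis Q.zero_left norm_zero mult_1 order_refl power_zero_numeral)
    then show ?thesis using zero_less_one by blast
  next
    case False
    have "compact (M \<inter> sphere 0 1)" using closedM by (intro closed_Int_compact) auto
    then obtain a where a: "a \<in> M \<inter> sphere 0 1" "\<And>\<xi>. \<xi> \<in> M \<inter> sphere 0 1 \<Longrightarrow> Q a a \<le> Q \<xi> \<xi>"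
      using continuous_attains_inf[of "M \<inter> sphere 0 1" "\<lambda>\<xi>. Q \<xi> \<xi>"] False
      using Q.continuous_on[OF continuous_on_id continuous_on_id, of "M \<inter> sphere 0 1"] by blast
    have "Q a a * (norm \<xi>)\<^sup>2 \<le> Q \<xi> \<xi>" if "\<xi> \<in> M" for \<xi>
    proof (cases "\<xi> = 0")
      case False
      have "Q a a \<le> Q (inverse (norm \<xi>) *\<^sub>R \<xi>) (inverse (norm \<xi>) *\<^sub>R \<xi>)"
        by (rule a(2)) (use that False M(1) in \<open>simp add: subspace_scale\<close>)
      then show ?thesis
        using False by (simp add: Q.scaleR_left Q.scaleR_right field_simps power2_eq_square)
    qed (simp add: Q.zero_left)
    moreover have "Q a a > 0" using a(1) M(2) by (intro Q_pos) auto
    ultimately show ?thesis by blast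
  qed
  then obtain m where m: "m > 0" "\<And>\<xi>. \<xi> \<in> M \<Longrightarrow> m * (norm \<xi>)\<^sup>2 \<le> Q \<xi> \<xi>" by blast
  have "bounded S"
    unfolding bounded_iff
  proof (intro exI ballI)
    fix \<xi> assume "\<xi> \<in> S"
    then have "m * (norm \<xi>)\<^sup>2 \<le> R\<^sup>2" using m(2) by (force simp: S_def)
    then have "(norm \<xi>)\<^sup>2 \<le> R\<^sup>2 / m" using m(1) by (simp add: field_simps)
    then show "norm \<xi> \<le> sqrt (R\<^sup>2 / m)" by (simp add: real_le_rsqrt)
  qed
  moreover have "closed S"
  proof -
    have "S = M \<inter> {\<xi>. Q \<xi> \<xi> \<le> R\<^sup>2}" by (auto simp: S_def)
    moreover have "closed {\<xi>. Q \<xi> \<xi> \<le> R\<^sup>2}"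
      by (intro closed_Collect_le Q.continuous_on continuous_on_id continuous_on_const)
    ultimately show ?thesis using closedM by auto
  qed
  ultimately have compS: "compact S" by (simp add: compact_eq_bounded_closed)
  have convS: "convex S"
  proof (rule convexI)
    fix a b and u v :: real
    assume a: "a \<in> S" and b: "b \<in> S" and uv: "0 \<le> u" "0 \<le> v" "u + v = 1"
    have inM: "u *\<^sub>R a + v *\<^sub>R b \<in> M" using a b M(1) by (simp add: S_def subspace_add subspace_scale)
    have aV: "a \<in> V" "b \<in> V" using a b M(2) by (auto simp: S_def)
    have "0 \<le> Q (a - b) (a - b)" using aV subspace_V by (intro Q_nonneg subspace_diff)
    then have ab: "2 * Q a b \<le> Q a a + Q b b"
      using Q_sym[OF aV] by (simp add: Q.diff_left Q.diff_right)
    have "Q (u *\<^sub>R a + v *\<^sub>R b) (u *\<^sub>R a + v *\<^sub>R b) = u\<^sup>2 * Q a a + u * v * (2 * Q a b) + v\<^sup>2 * Q b b"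
      using Q_sym[OF aV]
      by (simp add: Q.add_left Q.add_right Q.scaleR_left Q.scaleR_right power2_eq_square algebra_simps)
    also have "\<dots> \<le> u\<^sup>2 * Q a a + u * v * (Q a a + Q b b) + v\<^sup>2 * Q b b"
      using ab uv by (simp add: mult_left_mono)
    also have "\<dots> = (u + v) * (u * Q a a + v * Q b b)"
      by (simp add: power2_eq_square algebra_simps)
    also have "\<dots> \<le> u * R\<^sup>2 + v * R\<^sup>2"
      using a b uv by (simp add: S_def add_mono mult_left_mono)
    also have "\<dots> = R\<^sup>2" using uv(3) by (metis distrib_right mult_1)
    finally show "u *\<^sub>R a + v *\<^sub>R b \<in> S" using inM by (simp add: S_def)
  qed
  define f where "f = (\<lambda>\<xi>. (- R / sqrt (Q (G \<xi>) (G \<xi>))) *\<^sub>R G \<xi>)"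
  have SM: "S \<subseteq> M" by (auto simp: S_def)
  have contG: "continuous_on S G" using G(2) SM by (rule continuous_on_subset)
  have "continuous_on S f"
    unfolding f_def
    by (intro continuous_intros contG Q.continuous_on) (use Gpos SM in force)
  moreover have fS: "f \<xi> \<in> M" "Q (f \<xi>) (f \<xi>) = R\<^sup>2" if "\<xi> \<in> S" for \<xi>
  proof -
    have "\<xi> \<in> M" using that SM by blast
    then show "f \<xi> \<in> M" "Q (f \<xi>) (f \<xi>) = R\<^sup>2"
      using GM[of \<xi>] Gpos[of \<xi>] M(1)
      by (auto simp: f_def subspace_scale subspace_neg Q.scaleR_left Q.scaleR_right Q.minus_left Q.minus_right field_simps power2_eq_square)
  qed
  moreover have "S \<noteq> {}" using M(1) by (auto simp: S_def Q.zero_left subspace_0 intro!: exI[of _ 0])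
  ultimately obtain \<xi> where \<xi>: "\<xi> \<in> S" "f \<xi> = \<xi>"
    using brouwer[OF compS convS, of f] by (force simp: S_def)
  have \<xi>M: "\<xi> \<in> M" using \<xi>(1) SM by blast
  have "Q \<xi> \<xi> = R\<^sup>2" using fS(2)[OF \<xi>(1)] \<xi>(2) by simp
  then have "Q (G \<xi>) \<xi> > 0" using pos \<xi>M by blast
  moreover have "Q (G \<xi>) (f \<xi>) = - R * sqrt (Q (G \<xi>) (G \<xi>))"
    using Gpos[OF \<xi>M] by (simp add: f_def Q.scaleR_right Q.minus_right real_div_sqrt field_simps)
  ultimately show False using R Gpos[OF \<xi>M] \<xi>(2) by (simp add: mult_less_0_iff zero_less_mult_iff)
qed


lemma Q_bounded_left:
  assumes "bounded S" obtains K where "K \<ge> 0" "\<And>v w. v \<in> S \<Longrightarrow> \<bar>Q v w\<bar> \<le> K * norm w"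
proof -
  obtain k where k: "\<And>a b. norm (Q a b) \<le> norm a * norm b * k" "k \<ge> 0"
    using Q.nonneg_bounded by blast
  obtain B where B: "\<And>v. v \<in> S \<Longrightarrow> norm v \<le> B" "B > 0" using assms bounded_pos by blast
  have "\<bar>Q v w\<bar> \<le> (B * k) * norm w" if "v \<in> S" for v w
  proof -
    have "\<bar>Q v w\<bar> \<le> norm v * norm w * k" using k(1)[of v w] by simp
    also have "\<dots> \<le> B * norm w * k" using B(1)[OF that] k(2) by (intro mult_right_mono) auto
    finally show ?thesis by (simp add: mult_ac)
  qed
  moreover have "B * k \<ge> 0" using B(2) k(2) by simp
  ultimately show ?thesis using that by blast
qed

text \<open>A value \<open>p\<close> is attained exactly when \<open>G - p\<close> is coercive. Coercivity of \<open>G - p\<close> is a convex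
  and open condition on \<open>p\<close>.\<close>

lemma mem_range_iff_coercive:
  assumes M: "subspace M" "M \<subseteq> V" and G: "G \<in> M \<rightarrow> M" "continuous_on M G" "bounded (G ` M)"
    and mono: "\<And>\<xi> \<theta> t. \<lbrakk>\<xi> \<in> M; \<theta> \<in> M; \<theta> \<noteq> 0; 0 < t\<rbrakk> \<Longrightarrow> Q (G \<xi>) \<theta> < Q (G (\<xi> + t *\<^sub>R \<theta>)) \<theta>"
    and p: "p \<in> M"
  shows "p \<in> G ` M \<longleftrightarrow> (\<exists>\<delta>>0. \<exists>C. \<forall>\<xi>\<in>M. \<delta> * norm \<xi> - C \<le> Q (G \<xi> - p) \<xi>)" (is "?L \<longleftrightarrow> ?R")
proof
  assume ?R
  then obtain \<delta> C where \<delta>: "\<delta> > 0" and C: "\<And>\<xi>. \<xi> \<in> M \<Longrightarrow> \<delta> * norm \<xi> - C \<le> Q (G \<xi> - p) \<xi>" by blast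
  obtain k where k: "\<And>a b. norm (Q a b) \<le> norm a * norm b * k" "k > 0"
    using Q.pos_bounded by blast
  define R where "R = (\<bar>C\<bar> + 1) / \<delta> * sqrt k"
  have R: "R > 0" using \<delta> k(2) by (simp add: R_def add_nonneg_pos)
  have "\<exists>\<xi>\<in>M. G \<xi> - p = 0"
  proof (rule brouwer_zero[OF M _ _ R])
    show "(\<lambda>\<xi>. G \<xi> - p) \<in> M \<rightarrow> M" using G(1) p M(1) by (auto intro: subspace_diff)
    show "continuous_on M (\<lambda>\<xi>. G \<xi> - p)" by (intro continuous_intros G)
    fix \<xi> assume \<xi>: "\<xi> \<in> M" "Q \<xi> \<xi> = R\<^sup>2"
    have "((\<bar>C\<bar> + 1) / \<delta>)\<^sup>2 * k = R\<^sup>2"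
      unfolding R_def power_mult_distrib using k(2) by simp
    also have "\<dots> \<le> (norm \<xi>)\<^sup>2 * k" using k(1)[of \<xi> \<xi>] \<xi>(2) by (simp add: power2_eq_square)
    finally have "((\<bar>C\<bar> + 1) / \<delta>)\<^sup>2 \<le> (norm \<xi>)\<^sup>2" using k(2) by simp
    then have "(\<bar>C\<bar> + 1) / \<delta> \<le> norm \<xi>" using power2_le_imp_le norm_ge_zero by blast
    then have "\<bar>C\<bar> + 1 \<le> \<delta> * norm \<xi>" using \<delta> by (simp add: field_simps)
    then show "0 < Q (G \<xi> - p) \<xi>" using C[OF \<xi>(1)] by linarith
  qed
  then show ?L by force
next
  assume ?L
  then obtain \<xi>0 where \<xi>0: "\<xi>0 \<in> M" "p = G \<xi>0" by blast
  define g where "g = (\<lambda>\<theta>. Q (G (\<xi>0 + \<theta>) - p) \<theta>)"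
  have gpos: "g \<theta> > 0" if "\<theta> \<in> M" "\<theta> \<noteq> 0" for \<theta>
    using mono[OF \<xi>0(1) that, of 1] by (simp add: g_def \<xi>0(2) Q.diff_left)
  have contg: "continuous_on (M \<inter> sphere 0 1) g"
    unfolding g_def
    by (intro Q.continuous_on continuous_intros continuous_on_compose2[OF G(2)])
      (use \<xi>0(1) M(1) in \<open>auto intro: subspace_add\<close>)
  have comp: "compact (M \<inter> sphere 0 1)"
    using closed_subspace[OF M(1)] by (intro closed_Int_compact) auto
  obtain \<delta> where \<delta>: "\<delta> > 0" "\<And>\<theta>. \<theta> \<in> M \<Longrightarrow> norm \<theta> = 1 \<Longrightarrow> \<delta> \<le> g \<theta>"
  proof (cases "M \<inter> sphere 0 1 = {}")
    case True
    then show ?thesis by (intro that[of 1]) (auto simp: disjoint_iff)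
  next
    case False
    then obtain a where "a \<in> M \<inter> sphere 0 1" "\<forall>\<theta>\<in>M \<inter> sphere 0 1. g a \<le> g \<theta>"
      using continuous_attains_inf[OF comp _ contg] by blast
    then show ?thesis by (intro that[of "g a"]) (auto intro!: gpos)
  qed
  have step: "\<delta> * norm \<eta> - \<delta> \<le> Q (G (\<xi>0 + \<eta>) - p) \<eta>" if \<eta>: "\<eta> \<in> M" for \<eta>
  proof (cases "norm \<eta> < 1")
    case True
    have "0 \<le> g \<eta>" using gpos[OF \<eta>] by (cases "\<eta> = 0") (auto simp: g_def Q.zero_right)
    moreover have "\<delta> * norm \<eta> \<le> \<delta>" using True \<delta>(1) by simp
    ultimately show ?thesis by (simp add: g_def)
  next
    case False
    define \<theta> where "\<theta> = inverse (norm \<eta>) *\<^sub>R \<eta>"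
    have ne: "\<eta> \<noteq> 0" using False by auto
    have \<theta>: "\<theta> \<in> M" "norm \<theta> = 1" "\<eta> = norm \<eta> *\<^sub>R \<theta>" "\<theta> \<noteq> 0"
      using \<eta> ne M(1) by (auto simp: \<theta>_def subspace_scale)
    have "g \<theta> \<le> Q (G (\<xi>0 + \<eta>) - p) \<theta>"
    proof (cases "norm \<eta> = 1")
      case True
      then show ?thesis by (simp add: g_def \<theta>_def)
    next
      case False
      have "Q (G (\<xi>0 + \<theta>)) \<theta> < Q (G (\<xi>0 + \<theta> + (norm \<eta> - 1) *\<^sub>R \<theta>)) \<theta>"
        using mono[of "\<xi>0 + \<theta>" \<theta> "norm \<eta> - 1"] \<theta> \<xi>0(1) M(1) False \<open>\<not> norm \<eta> < 1\<close>
        by (auto intro: subspace_add)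
      also have "\<xi>0 + \<theta> + (norm \<eta> - 1) *\<^sub>R \<theta> = \<xi>0 + \<eta>"
        using \<theta>(3) by (simp add: scaleR_left_diff_distrib)
      finally show ?thesis by (simp add: g_def Q.diff_left)
    qed
    then have "norm \<eta> * \<delta> \<le> norm \<eta> * Q (G (\<xi>0 + \<eta>) - p) \<theta>"
      using \<delta>(2)[OF \<theta>(1,2)] by (intro mult_left_mono) auto
    also have "\<dots> = Q (G (\<xi>0 + \<eta>) - p) \<eta>"
      using \<theta>(3) by (metis Q.scaleR_right real_scaleR_def)
    finally show ?thesis using \<delta>(1) by (simp add: mult_ac)
  qed
  have "bounded ((\<lambda>v. v - p) ` (G ` M))" using G(3) bounded_minus_comp bounded_translation_minus by blast
  then obtain K where K: "K \<ge> 0" "\<And>v w. v \<in> (\<lambda>v. v - p) ` (G ` M) \<Longrightarrow> \<bar>Q v w\<bar> \<le> K * norm w"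
    using Q_bounded_left by blast
  have "\<delta> * norm \<xi> - (\<delta> * norm \<xi>0 + \<delta> + K * norm \<xi>0) \<le> Q (G \<xi> - p) \<xi>" if \<xi>: "\<xi> \<in> M" for \<xi>
  proof -
    have "\<delta> * norm (\<xi> - \<xi>0) - \<delta> \<le> Q (G \<xi> - p) (\<xi> - \<xi>0)"
      using step[of "\<xi> - \<xi>0"] \<xi> \<xi>0(1) M(1) by (simp add: subspace_diff)
    moreover have "\<bar>Q (G \<xi> - p) \<xi>0\<bar> \<le> K * norm \<xi>0" using \<xi> by (intro K(2)) auto
    moreover have "\<delta> * norm \<xi> \<le> \<delta> * norm (\<xi> - \<xi>0) + \<delta> * norm \<xi>0"
      using \<delta>(1) norm_triangle_sub[of \<xi> \<xi>0] by (simp flip: distrib_left add: add.commute)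
    ultimately show ?thesis by (simp add: Q.diff_right)
  qed
  with \<delta>(1) show ?R by blast
qed

lemma strictly_monotone_range:
  assumes M: "subspace M" "M \<subseteq> V" and G: "G \<in> M \<rightarrow> M" "continuous_on M G" "bounded (G ` M)"
    and mono: "\<And>\<xi> \<theta> t. \<lbrakk>\<xi> \<in> M; \<theta> \<in> M; \<theta> \<noteq> 0; 0 < t\<rbrakk> \<Longrightarrow> Q (G \<xi>) \<theta> < Q (G (\<xi> + t *\<^sub>R \<theta>)) \<theta>"
  shows "convex (G ` M)" "openin (top_of_set M) (G ` M)"
proof -
  have coercive: "p \<in> G ` M \<longleftrightarrow> (\<exists>\<delta>>0. \<exists>C. \<forall>\<xi>\<in>M. \<delta> * norm \<xi> - C \<le> Q (G \<xi> - p) \<xi>)" if "p \<in> M" for p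
    by (rule mem_range_iff_coercive[OF M G _ that]) (rule mono)
  have GM: "G ` M \<subseteq> M" using G(1) by blast
  show "convex (G ` M)"
  proof (rule convexI)
    fix p p' and u v :: real
    assume p: "p \<in> G ` M" and p': "p' \<in> G ` M" and uv: "0 \<le> u" "0 \<le> v" "u + v = 1"
    have inM: "p \<in> M" "p' \<in> M" using p p' GM by auto
    obtain \<delta> C where d: "\<delta> > 0" "\<And>\<xi>. \<xi> \<in> M \<Longrightarrow> \<delta> * norm \<xi> - C \<le> Q (G \<xi> - p) \<xi>"
      using p coercive[OF inM(1)] by blast
    obtain \<delta>' C' where d': "\<delta>' > 0" "\<And>\<xi>. \<xi> \<in> M \<Longrightarrow> \<delta>' * norm \<xi> - C' \<le> Q (G \<xi> - p') \<xi>"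
      using p' coercive[OF inM(2)] by blast
    have "(u * \<delta> + v * \<delta>') * norm \<xi> - (u * C + v * C') \<le> Q (G \<xi> - (u *\<^sub>R p + v *\<^sub>R p')) \<xi>"
      if \<xi>: "\<xi> \<in> M" for \<xi>
    proof -
      have "(u * \<delta> + v * \<delta>') * norm \<xi> - (u * C + v * C')
          = u * (\<delta> * norm \<xi> - C) + v * (\<delta>' * norm \<xi> - C')"
        by (simp add: algebra_simps)
      also have "\<dots> \<le> u * Q (G \<xi> - p) \<xi> + v * Q (G \<xi> - p') \<xi>"
        using d(2)[OF \<xi>] d'(2)[OF \<xi>] uv by (intro add_mono mult_left_mono)
      also have "\<dots> = (u + v) * Q (G \<xi>) \<xi> - (u * Q p \<xi> + v * Q p' \<xi>)"
        by (simp add: Q.diff_left algebra_simps)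
      also have "\<dots> = Q (G \<xi> - (u *\<^sub>R p + v *\<^sub>R p')) \<xi>"
        using uv(3) by (simp add: Q.diff_left Q.add_left Q.scaleR_left)
      finally show ?thesis .
    qed
    moreover have "u * \<delta> + v * \<delta>' > 0"
      using uv d(1) d'(1) by (cases "u = 0") (auto simp: add_pos_nonneg)
    moreover have "u *\<^sub>R p + v *\<^sub>R p' \<in> M" using inM M(1) by (simp add: subspace_add subspace_scale)
    ultimately show "u *\<^sub>R p + v *\<^sub>R p' \<in> G ` M" using coercive by blast
  qed
  have "\<exists>e>0. \<forall>p'\<in>M. dist p' p < e \<longrightarrow> p' \<in> G ` M" if p: "p \<in> G ` M" for p
  proof -
    have pM: "p \<in> M" using p GM by auto
    obtain \<delta> C where d: "\<delta> > 0" "\<And>\<xi>. \<xi> \<in> M \<Longrightarrow> \<delta> * norm \<xi> - C \<le> Q (G \<xi> - p) \<xi>"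
      using p coercive[OF pM] by blast
    obtain k where k: "\<And>a b. norm (Q a b) \<le> norm a * norm b * k" "k > 0"
      using Q.pos_bounded by blast
    have "p' \<in> G ` M" if p': "p' \<in> M" "dist p' p < \<delta> / (2 * k)" for p'
    proof -
      have "\<delta> / 2 * norm \<xi> - C \<le> Q (G \<xi> - p') \<xi>" if \<xi>: "\<xi> \<in> M" for \<xi>
      proof -
        have "norm (p' - p) * k \<le> \<delta> / 2" using p'(2) k(2) by (simp add: dist_norm field_simps)
        then have "norm (p' - p) * k * norm \<xi> \<le> \<delta> / 2 * norm \<xi>" by (rule mult_right_mono) simp
        then have "\<bar>Q (p' - p) \<xi>\<bar> \<le> \<delta> / 2 * norm \<xi>" using k(1)[of "p' - p" \<xi>] by (simp add: mult_ac)
        moreover have "Q (G \<xi> - p') \<xi> = Q (G \<xi> - p) \<xi> - Q (p' - p) \<xi>" by (simp add: Q.diff_left)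
        ultimately show ?thesis using d(2)[OF \<xi>] by simp
      qed
      then show ?thesis using coercive[OF p'(1)] d(1) half_gt_zero by blast
    qed
    then show ?thesis using d(1) k(2) by (intro exI[of _ "\<delta> / (2 * k)"]) auto
  qed
  with GM show "openin (top_of_set M) (G ` M)"
    unfolding openin_euclidean_subtopology_iff by blast
qed

lemma monotone_image_convex_open:
  assumes N: "subspace N" "N \<subseteq> V" and F: "F \<in> V \<rightarrow> V" "continuous_on V F" "bounded (F ` V)"
    and inv: "\<And>\<xi> \<theta>. \<lbrakk>\<xi> \<in> V; \<theta> \<in> N\<rbrakk> \<Longrightarrow> F (\<xi> + \<theta>) = F \<xi>"
    and orth: "\<And>\<xi> \<theta>. \<lbrakk>\<xi> \<in> V; \<theta> \<in> N\<rbrakk> \<Longrightarrow> Q (F \<xi>) \<theta> = Q (F 0) \<theta>"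
    and mono: "\<And>\<xi> \<theta> t. \<lbrakk>\<xi> \<in> V; \<theta> \<in> V; \<theta> \<notin> N; 0 < t\<rbrakk> \<Longrightarrow> Q (F \<xi>) \<theta> < Q (F (\<xi> + t *\<^sub>R \<theta>)) \<theta>"
  shows "convex (F ` V)"
    and "openin (top_of_set ((+) (F 0) ` orth_compl_in Q V N)) (F ` V)"
proof -
  define M where "M = orth_compl_in Q V N"
  define G where "G = (\<lambda>\<xi>. F \<xi> - F 0)"
  have M: "subspace M" "M \<subseteq> V" using subspace_orth_compl[OF N(2)] by (auto simp: M_def orth_compl_in_def)
  have zeroV: "0 \<in> V" using subspace_V by (rule subspace_0)
  have 1: "G \<in> M \<rightarrow> M"
  proof
    fix \<xi> assume "\<xi> \<in> M"
    then have "\<xi> \<in> V" using M(2) by blast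
    moreover from this have "G \<xi> \<in> V"
      unfolding G_def using F(1) zeroV by (intro subspace_diff[OF subspace_V]) auto
    ultimately show "G \<xi> \<in> M"
      using orth[of \<xi>] by (simp add: M_def orth_compl_in_def G_def Q.diff_left)
  qed
  have 2: "continuous_on M G"
    unfolding G_def by (intro continuous_intros continuous_on_subset[OF F(2)] M)
  have "bounded ((\<lambda>v. v - F 0) ` (F ` V))" using F(3) by (rule bounded_translation_minus)
  then have 3: "bounded (G ` M)" by (rule bounded_subset) (use M(2) in \<open>auto simp: G_def\<close>)
  have 4: "Q (G \<xi>) \<theta> < Q (G (\<xi> + t *\<^sub>R \<theta>)) \<theta>"
    if "\<xi> \<in> M" "\<theta> \<in> M" "\<theta> \<noteq> 0" "0 < t" for \<xi> \<theta> t
  proof -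
    have "\<theta> \<notin> N" using that(2,3) Q_pos[of \<theta>] by (auto simp: M_def orth_compl_in_def)
    then show ?thesis using mono[of \<xi> \<theta> t] that M(2) by (auto simp: G_def Q.diff_left)
  qed
  have img: "F ` V = (+) (F 0) ` (G ` M)"
  proof -
    have "F \<xi> \<in> F ` M" if "\<xi> \<in> V" for \<xi>
    proof -
      obtain \<theta> where "\<theta> \<in> N" "\<xi> - \<theta> \<in> M" using Q_decomp[OF N \<open>\<xi> \<in> V\<close>] by (auto simp: M_def)
      then show ?thesis using inv[of "\<xi> - \<theta>" \<theta>] M(2) by force
    qed
    then show ?thesis using M(2) by (auto simp: G_def image_image)
  qed
  have range: "convex (G ` M)" "openin (top_of_set M) (G ` M)"
    using strictly_monotone_range[OF M 1 2 3] 4 by simp_all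
  show "convex (F ` V)" unfolding img by (intro convex_translation range)
  show "openin (top_of_set ((+) (F 0) ` orth_compl_in Q V N)) (F ` V)"
    unfolding img M_def[symmetric]
    by (rule homeomorphism_imp_open_map[OF homeomorphism_symD[OF homeomorphism_translation] range(2)])
qed

end

section \<open>Smooth maps and mixed partial derivatives\<close>

lemma Ck_on_cong:
  assumes "open S" "\<And>x. x \<in> S \<Longrightarrow> f x = g x" "Ck_on k S f"
  shows "Ck_on k S g"
proof (cases k)
  case 0
  then show ?thesis using assms by (simp cong: continuous_on_cong)
next
  case (Suc n)
  then obtain f' where "\<forall>x\<in>S. (f has_derivative f' x) (at x)" "\<forall>v. Ck_on n S (\<lambda>x. f' x v)"
    using assms(3) by auto
  moreover from this have "\<forall>x\<in>S. (g has_derivative f' x) (at x)"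
    by (auto intro!: has_derivative_transform_within_open[of f _ _ UNIV S g] assms(1,2))
  ultimately show ?thesis using Suc by auto
qed

lemma Ck_on_subset: "Ck_on k S f \<Longrightarrow> T \<subseteq> S \<Longrightarrow> Ck_on k T f"
  by (induction k arbitrary: f) (auto intro: continuous_on_subset, blast)

lemma smooth_on_subset: "smooth_on S f \<Longrightarrow> T \<subseteq> S \<Longrightarrow> smooth_on T f"
  by (auto simp: smooth_on_def intro: Ck_on_subset)

lemma smooth_on_imp_continuous_on: "smooth_on S f \<Longrightarrow> continuous_on S f"
  unfolding smooth_on_def by (metis Ck_on.simps(1))

lemma smooth_on_has_derivative:
  assumes "smooth_on S f" "x \<in> S"
  shows "(f has_derivative frechet_derivative f (at x)) (at x)"
proof -
  have "Ck_on (Suc 0) S f" using assms(1) by (simp only: smooth_on_def)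
  then show ?thesis using assms(2) by (auto simp: frechet_derivative_works[symmetric] differentiable_def)
qed

lemma smooth_on_frechet_derivative:
  assumes "smooth_on S f" "open S"
  shows "smooth_on S (\<lambda>x. frechet_derivative f (at x) v)"
  unfolding smooth_on_def
proof
  fix k
  have "Ck_on (Suc k) S f" using assms(1) by (simp only: smooth_on_def)
  then obtain f' where f': "\<forall>x\<in>S. (f has_derivative f' x) (at x)" "\<forall>v. Ck_on k S (\<lambda>x. f' x v)"
    by auto
  show "Ck_on k S (\<lambda>x. frechet_derivative f (at x) v)"
  proof (rule Ck_on_cong[OF assms(2)])
    show "Ck_on k S (\<lambda>x. f' x v)" using f'(2) by blast
    show "f' x v = frechet_derivative f (at x) v" if "x \<in> S" for x
      using frechet_derivative_at f'(1) that by metis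
  qed
qed

lemma linear_frechet: "smooth_on S f \<Longrightarrow> x \<in> S \<Longrightarrow> linear (frechet_derivative f (at x))"
  using smooth_on_has_derivative has_derivative_linear by blast

lemma linear_expand:
  fixes D :: "'b::euclidean_space \<Rightarrow> 'c::real_normed_vector"
  assumes "linear D" shows "D v = (\<Sum>b\<in>Basis. (v \<bullet> b) *\<^sub>R D b)"
proof -
  have "D v = D (\<Sum>b\<in>Basis. (v \<bullet> b) *\<^sub>R b)" by (simp add: euclidean_representation)
  also have "\<dots> = (\<Sum>b\<in>Basis. (v \<bullet> b) *\<^sub>R D b)"
    using assms by (simp add: linear_sum linear_cmul)
  finally show ?thesis .
qed

lemma continuous_on_linear_family:
  fixes D :: "'a::topological_space \<Rightarrow> 'b::euclidean_space \<Rightarrow> 'c::real_normed_vector"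
  assumes lin: "\<And>x. x \<in> S \<Longrightarrow> linear (D x)" and cont: "\<And>b. continuous_on S (\<lambda>x. D x b)"
    and f: "continuous_on T f" "f ` T \<subseteq> S" and g: "continuous_on T g"
  shows "continuous_on T (\<lambda>t. D (f t) (g t))"
proof -
  have "continuous_on T (\<lambda>t. \<Sum>b\<in>Basis. (g t \<bullet> b) *\<^sub>R D (f t) b)"
    by (intro continuous_intros g continuous_on_compose2[OF cont f])
  then show ?thesis
    by (rule continuous_on_eq) (simp add: linear_expand[OF lin, symmetric] f(2)[THEN subsetD])
qed

lemma derivative_linear_family:
  fixes D :: "'a::real_normed_vector \<Rightarrow> 'b::euclidean_space \<Rightarrow> 'c::real_normed_vector"
  assumes S: "open S" "x \<in> S" and lin: "\<And>x. x \<in> S \<Longrightarrow> linear (D x)"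
    and der: "\<And>v. ((\<lambda>x. D x v) has_derivative E v) (at x)"
  shows "linear (\<lambda>v. E v u)"
proof (rule linearI)
  fix v w
  have "((\<lambda>x. D x v + D x w) has_derivative (\<lambda>u. E v u + E w u)) (at x)"
    by (intro derivative_intros der)
  then have "((\<lambda>x. D x (v + w)) has_derivative (\<lambda>u. E v u + E w u)) (at x)"
    by (rule has_derivative_transform_within_open[OF _ S]) (simp add: lin linear_add)
  then show "E (v + w) u = E v u + E w u" using der has_derivative_unique by metis
next
  fix r v
  have "((\<lambda>x. r *\<^sub>R D x v) has_derivative (\<lambda>u. r *\<^sub>R E v u)) (at x)"
    by (intro derivative_intros der)
  then have "((\<lambda>x. D x (r *\<^sub>R v)) has_derivative (\<lambda>u. r *\<^sub>R E v u)) (at x)"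
    by (rule has_derivative_transform_within_open[OF _ S]) (simp add: lin linear_cmul)
  then show "E (r *\<^sub>R v) u = r *\<^sub>R E v u" using der has_derivative_unique by metis
qed

lemma has_derivative_linear_family:
  fixes D :: "'a::real_normed_vector \<Rightarrow> 'b::euclidean_space \<Rightarrow> 'c::real_normed_vector"
  assumes S: "open S" "\<gamma> y \<in> S" and lin: "\<And>x. x \<in> S \<Longrightarrow> linear (D x)"
    and der: "\<And>v. ((\<lambda>x. D x v) has_derivative E v) (at (\<gamma> y))"
    and \<gamma>: "(\<gamma> has_derivative \<gamma>') (at y)" and \<delta>: "(\<delta> has_derivative \<delta>') (at y)"
  shows "((\<lambda>y. D (\<gamma> y) (\<delta> y)) has_derivative (\<lambda>u. E (\<delta> y) (\<gamma>' u) + D (\<gamma> y) (\<delta>' u))) (at y)"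
proof -
  have "((\<lambda>y. D (\<gamma> y) b) has_derivative (\<lambda>u. E b (\<gamma>' u))) (at y)" for b
    using diff_chain_at[OF \<gamma> der[of b]] by (simp add: o_def)
  then have "((\<lambda>y. \<Sum>b\<in>Basis. (\<delta> y \<bullet> b) *\<^sub>R D (\<gamma> y) b) has_derivative
      (\<lambda>u. \<Sum>b\<in>Basis. (\<delta> y \<bullet> b) *\<^sub>R E b (\<gamma>' u) + (\<delta>' u \<bullet> b) *\<^sub>R D (\<gamma> y) b)) (at y)"
    by (intro derivative_intros \<delta>)
  also have "(\<lambda>u. \<Sum>b\<in>Basis. (\<delta> y \<bullet> b) *\<^sub>R E b (\<gamma>' u) + (\<delta>' u \<bullet> b) *\<^sub>R D (\<gamma> y) b)
      = (\<lambda>u. E (\<delta> y) (\<gamma>' u) + D (\<gamma> y) (\<delta>' u))"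
    unfolding sum.distrib
    by (rule ext) (simp only: linear_expand[OF derivative_linear_family[OF S lin der], of "\<delta> y"]
        linear_expand[OF lin[OF S(2)], of "\<delta>' _"])
  finally show ?thesis
  proof (rule has_derivative_transform_eventually)
    have "isCont \<gamma> y" using \<gamma> has_derivative_continuous by blast
    then have "\<forall>\<^sub>F y' in at y. \<gamma> y' \<in> S" using S by (simp add: isCont_def topological_tendstoD)
    then show "\<forall>\<^sub>F y' in at y. (\<Sum>b\<in>Basis. (\<delta> y' \<bullet> b) *\<^sub>R D (\<gamma> y') b) = D (\<gamma> y') (\<delta> y')"
      by eventually_elim (use linear_expand lin in metis)
    show "(\<Sum>b\<in>Basis. (\<delta> y \<bullet> b) *\<^sub>R D (\<gamma> y) b) = D (\<gamma> y) (\<delta> y)"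
      using linear_expand lin S(2) by metis
  qed auto
qed

lemma has_vector_derivative_linear_family:
  fixes D :: "'a::real_normed_vector \<Rightarrow> 'b::euclidean_space \<Rightarrow> 'c::real_normed_vector"
  assumes S: "open S" "\<gamma> t \<in> S" and lin: "\<And>x. x \<in> S \<Longrightarrow> linear (D x)"
    and der: "\<And>v. ((\<lambda>x. D x v) has_derivative E v) (at (\<gamma> t))"
    and \<gamma>: "(\<gamma> has_vector_derivative \<gamma>') (at t)" and \<delta>: "(\<delta> has_vector_derivative \<delta>') (at t)"
  shows "((\<lambda>t. D (\<gamma> t) (\<delta> t)) has_vector_derivative (E (\<delta> t) \<gamma>' + D (\<gamma> t) \<delta>')) (at t)"
proof -
  have "linear (E (\<delta> t))" using der has_derivative_linear by blast
  then show ?thesis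
    unfolding has_vector_derivative_def
    using has_derivative_linear_family[where S=S and D=D and E=E and \<gamma>=\<gamma> and \<delta>=\<delta> and y=t, OF S lin der
        \<gamma>[unfolded has_vector_derivative_def] \<delta>[unfolded has_vector_derivative_def]]
      lin[OF S(2)]
    by (simp add: linear_cmul scaleR_right_distrib)
qed

lemma continuous_on_uncurried:
  assumes "continuous_on (A \<times> B) (\<lambda>(x, y). f x y)" "continuous_on T g" "continuous_on T h"
    and "\<And>t. t \<in> T \<Longrightarrow> g t \<in> A" "\<And>t. t \<in> T \<Longrightarrow> h t \<in> B"
  shows "continuous_on T (\<lambda>t. f (g t) (h t))"
proof -
  have "continuous_on T (\<lambda>t. case (g t, h t) of (x, y) \<Rightarrow> f x y)"
    by (rule continuous_on_compose2[OF assms(1)]) (use assms in \<open>auto intro: continuous_on_Pair\<close>)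
  then show ?thesis by simp
qed

text \<open>The partial derivative in \<open>t\<close> of \<open>c t s - c a s = \<integral> p\<close> may be taken under the integral in \<open>s\<close>.\<close>

lemma mixed_partial_derivatives:
  fixes c :: "real \<Rightarrow> real \<Rightarrow> 'f::euclidean_space"
  assumes I: "open I" "convex I" "s \<in> I"
    and ct: "\<And>t s. s \<in> I \<Longrightarrow> ((\<lambda>t. c t s) has_vector_derivative p t s) (at t)"
    and cs: "\<And>t s. s \<in> I \<Longrightarrow> (c t has_vector_derivative q t s) (at s)"
    and ps: "\<And>t s. s \<in> I \<Longrightarrow> (p t has_vector_derivative m t s) (at s)"
    and p: "continuous_on (UNIV \<times> I) (\<lambda>(t, s). p t s)"
    and m: "continuous_on (UNIV \<times> I) (\<lambda>(t, s). m t s)"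
  shows "((\<lambda>t. q t s) has_vector_derivative m t s) (at t)"
proof -
  define a where "a = t - 1"
  have mswap: "continuous_on (I \<times> cbox a b) (\<lambda>(s, t). m t s)" for b
    unfolding split_beta
    by (rule continuous_on_uncurried[OF m]) (auto intro!: continuous_intros)
  have pcont: "continuous_on X (\<lambda>t. p t s)" if "s \<in> I" for s X
    by (rule continuous_on_uncurried[OF p]) (use that in \<open>auto intro!: continuous_intros\<close>)
  have mcont: "continuous_on X (\<lambda>t. m t s)" for X
    by (rule continuous_on_uncurried[OF m]) (use I(3) in \<open>auto intro!: continuous_intros\<close>)
  have q: "q b s = q a s + integral {a..b} (\<lambda>t. m t s)" if "a \<le> b" for b
  proof -
    have "((\<lambda>s. integral (cbox a b) (\<lambda>t. p t s)) has_vector_derivative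
        integral (cbox a b) (\<lambda>t. m t s)) (at s within I)"
      by (rule leibniz_rule_vector_derivative[OF _ _ mswap I(3,2)])
        (auto intro!: has_vector_derivative_at_within[OF ps] pcont integrable_continuous_interval)
    then have *: "((\<lambda>s. integral {a..b} (\<lambda>t. p t s)) has_vector_derivative
        integral {a..b} (\<lambda>t. m t s)) (at s)"
      by (simp add: at_within_open[OF I(3,1)])
    have "integral {a..b} (\<lambda>t. p t s) = c b s - c a s" if "s \<in> I" for s
      by (rule integral_unique, rule fundamental_theorem_of_calculus[OF \<open>a \<le> b\<close>
            has_vector_derivative_at_within[OF ct[OF that]]])
    then have "((\<lambda>s. c b s - c a s) has_vector_derivative integral {a..b} (\<lambda>t. m t s)) (at s)"
      by (rule has_vector_derivative_transform_within_open[OF * I(1,3)])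
    moreover have "((\<lambda>s. c b s - c a s) has_vector_derivative q b s - q a s) (at s)"
      by (intro derivative_intros cs I)
    ultimately show ?thesis using vector_derivative_unique_at by fastforce
  qed
  have "((\<lambda>b. integral {a..b} (\<lambda>t. m t s)) has_vector_derivative m t s) (at t within {a..t + 1})"
    by (rule integral_has_vector_derivative, rule mcont) (simp add: a_def)
  then have "((\<lambda>b. integral {a..b} (\<lambda>t. m t s)) has_vector_derivative m t s) (at t)"
    by (subst (asm) at_within_interior) (auto simp: a_def interior_atLeastAtMost_real)
  then have "((\<lambda>b. q a s + integral {a..b} (\<lambda>t. m t s)) has_vector_derivative m t s) (at t)"
    by (auto intro!: derivative_eq_intros)
  then show ?thesis
  proof (rule has_vector_derivative_transform_within_open[where S="{a<..}"])
    show "q a s + integral {a..b} (\<lambda>t. m t s) = q b s" if "b \<in> {a<..}" for b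
      using q[of b] that by simp
  qed (simp_all add: a_def)
qed

section \<open>Hamiltonian functions at fixed points of their flow\<close>

lemma Poincare_two_form:
  fixes \<Omega> :: "'f::euclidean_space \<Rightarrow> 'f \<Rightarrow> 'f \<Rightarrow> real" and y0 :: 'f and r :: real
  defines "B \<equiv> ball y0 r"
  assumes bil: "\<And>y. y \<in> B \<Longrightarrow> bilinear (\<Omega> y)"
    and alt: "\<And>y v. y \<in> B \<Longrightarrow> \<Omega> y v v = 0"
    and smooth: "\<And>v w. smooth_on B (\<lambda>y. \<Omega> y v w)"
    and closed: "\<And>y u v w. y \<in> B \<Longrightarrow>
        frechet_derivative (\<lambda>y. \<Omega> y v w) (at y) u
      - frechet_derivative (\<lambda>y. \<Omega> y u w) (at y) v
      + frechet_derivative (\<lambda>y. \<Omega> y u v) (at y) w = 0"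
  obtains \<theta> \<Theta> where
    "\<And>y. y \<in> B \<Longrightarrow> linear (\<theta> y)"
    "\<And>y v. y \<in> B \<Longrightarrow> ((\<lambda>y. \<theta> y v) has_derivative \<Theta> y v) (at y)"
    "\<And>u v. continuous_on B (\<lambda>y. \<Theta> y v u)"
    "\<And>y u v. y \<in> B \<Longrightarrow> \<Theta> y v u - \<Theta> y u v = \<Omega> y u v"
proof -
  define D where "D = (\<lambda>y v w u. frechet_derivative (\<lambda>y. \<Omega> y v w) (at y) u)"
  define g where "g = (\<lambda>t y. y0 + t *\<^sub>R (y - y0))"
  have openB: "open B" and convB: "convex B" by (auto simp: B_def)
  have lin1: "linear (\<lambda>v. \<Omega> y v w)" and lin2: "linear (\<Omega> y v)" if "y \<in> B" for y v w
    using bil[OF that] by (auto simp: bilinear_def)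
  have D: "((\<lambda>y. \<Omega> y v w) has_derivative D y v w) (at y)" if "y \<in> B" for y v w
    using smooth_on_has_derivative[OF smooth that] unfolding D_def .
  have Dlin: "linear (D y v w)" if "y \<in> B" for y v w
    using D[OF that] has_derivative_linear by blast
  have Dlin1: "linear (\<lambda>v. D y v w u)" if "y \<in> B" for y w u
    by (rule derivative_linear_family[OF openB that lin1 D[OF that]])
  have Dcont: "continuous_on B (\<lambda>y. D y v w u)" for v w u
    unfolding D_def by (intro smooth_on_imp_continuous_on smooth_on_frechet_derivative smooth openB)
  have \<Omega>cont: "continuous_on B (\<lambda>y. \<Omega> y v w)" for v w
    by (rule smooth_on_imp_continuous_on[OF smooth])
  have Dskew: "D y w v u = - D y v w u" if y: "y \<in> B" for y v w u
  proof -
    have "\<Omega> y' w v = - \<Omega> y' v w" if "y' \<in> B" for y'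
    proof -
      have "\<Omega> y' (v + w) (v + w) = \<Omega> y' v v + \<Omega> y' v w + \<Omega> y' w v + \<Omega> y' w w"
        using bil[OF that] by (simp add: bilinear_ladd bilinear_radd)
      then show ?thesis using alt[OF that] by simp
    qed
    then have "((\<lambda>y. \<Omega> y w v) has_derivative (\<lambda>u. - D y v w u)) (at y)"
      by (intro has_derivative_transform_within_open[OF has_derivative_minus[OF D[OF y]] openB y]) simp
    then show ?thesis using has_derivative_unique[OF D[OF y]] by metis
  qed
  have gB: "g t y \<in> B" if "y \<in> B" "t \<in> {0..1}" for t y
  proof -
    have "norm (t *\<^sub>R (y - y0)) \<le> 1 * norm (y - y0)"
      using that(2) by (simp add: mult_left_le_one_le)
    also have "\<dots> < r" using that(1) by (simp add: B_def dist_norm norm_minus_commute)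
    finally show ?thesis by (simp add: B_def g_def dist_norm)
  qed
  have g1: "g 1 y = y" for y by (simp add: g_def)
  have gcont: "continuous_on X (\<lambda>z. g (a z) (b z))" if "continuous_on X a" "continuous_on X b"
    for X :: "'z::topological_space set" and a b
    unfolding g_def by (intro continuous_intros that)
  define \<theta> where "\<theta> = (\<lambda>y v. integral {0..1} (\<lambda>t. t * \<Omega> (g t y) (y - y0) v))"
  define k where "k = (\<lambda>y v t u. t * (t * D (g t y) (y - y0) v u + \<Omega> (g t y) u v))"
  define \<Theta> where "\<Theta> = (\<lambda>y v u. integral {0..1} (\<lambda>t. k y v t u))"
  have klin: "linear (k y v t)" if "y \<in> B" "t \<in> {0..1}" for y v t
    unfolding k_def using Dlin[OF gB[OF that]]
    by (intro linearI)
      (simp_all add: linear_add linear_cmul linear_add[OF lin1[OF gB[OF that]]]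
        linear_cmul[OF lin1[OF gB[OF that]]] algebra_simps)
  have kcont: "continuous_on (B \<times> {0..1}) (\<lambda>(y, t). k y v t u)" for v u
  proof -
    have "continuous_on (B \<times> {0..1}) (\<lambda>z. D (g (snd z) (fst z)) (fst z - y0) v u)"
      by (rule continuous_on_linear_family[where D="\<lambda>y w. D y w v u", OF Dlin1 Dcont])
        (auto intro!: gcont continuous_intros gB)
    moreover have "continuous_on (B \<times> {0..1}) (\<lambda>z. \<Omega> (g (snd z) (fst z)) u v)"
      by (rule continuous_on_compose2[OF \<Omega>cont]) (auto intro!: gcont continuous_intros gB)
    ultimately show ?thesis
      unfolding k_def split_beta by (intro continuous_intros)
  qed
  have kint: "(\<lambda>t. k y v t u) integrable_on {0..1}" if "y \<in> B" for y v u
    by (intro integrable_continuous_interval continuous_on_uncurried[OF kcont])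
      (use that in \<open>auto intro!: continuous_intros\<close>)
  have fcont: "continuous_on {0..1} (\<lambda>t. t * \<Omega> (g t y) (y - y0) v)" if "y \<in> B" for y v
    by (intro continuous_intros continuous_on_compose2[OF \<Omega>cont] gcont) (use gB that in auto)
  have fint: "(\<lambda>t. t * \<Omega> (g t y) (y - y0) v) integrable_on {0..1}" if "y \<in> B" for y v
    by (intro integrable_continuous_interval fcont that)
  show ?thesis
  proof (rule that[of \<theta> \<Theta>])
    fix y assume y: "y \<in> B"
    show "linear (\<theta> y)"
    proof (rule linearI)
      fix v w c
      have "\<theta> y (v + w) = integral {0..1} (\<lambda>t. t * \<Omega> (g t y) (y - y0) v + t * \<Omega> (g t y) (y - y0) w)"
        unfolding \<theta>_def
        by (rule integral_cong) (use bil gB y in \<open>simp add: bilinear_radd distrib_left\<close>)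
      then show "\<theta> y (v + w) = \<theta> y v + \<theta> y w"
        by (simp add: \<theta>_def integral_add fint y)
      have "\<theta> y (c *\<^sub>R v) = integral {0..1} (\<lambda>t. c * (t * \<Omega> (g t y) (y - y0) v))"
        unfolding \<theta>_def
        by (rule integral_cong) (use bil gB y in \<open>simp add: bilinear_rmul\<close>)
      then show "\<theta> y (c *\<^sub>R v) = c *\<^sub>R \<theta> y v" by (simp add: \<theta>_def)
    qed
  next
    fix y v assume y: "y \<in> B"
    have ap: "blinfun_apply (Blinfun (k y v t)) = k y v t" if "y \<in> B" "t \<in> {0..1}" for y t
      using klin[OF that] by (intro bounded_linear_Blinfun_apply) (simp add: linear_conv_bounded_linear)
    have cont: "continuous_on (B \<times> {0..1}) (\<lambda>(y, t). Blinfun (k y v t))"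
    proof (rule continuous_on_blinfun_componentwise)
      fix i :: 'f
      show "continuous_on (B \<times> {0..1}) (\<lambda>z. blinfun_apply (case z of (y, t) \<Rightarrow> Blinfun (k y v t)) i)"
        by (rule continuous_on_eq[OF kcont[of v i]]) (auto simp: ap)
    qed
    have der: "((\<lambda>y. t * \<Omega> (g t y) (y - y0) v) has_derivative blinfun_apply (Blinfun (k y v t))) (at y within B)"
      if "y \<in> B" "t \<in> {0..1}" for y t
    proof -
      have "((\<lambda>y. \<Omega> (g t y) (y - y0) v) has_derivative
          (\<lambda>u. D (g t y) (y - y0) v (t *\<^sub>R u) + \<Omega> (g t y) u v)) (at y)"
        by (rule has_derivative_linear_family[where D="\<lambda>y w. \<Omega> y w v" and E="\<lambda>w. D (g t y) w v" and S=B])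
          (use openB gB[OF that] lin1 D in \<open>auto simp: g_def intro!: derivative_eq_intros\<close>)
      then have "((\<lambda>y. t * \<Omega> (g t y) (y - y0) v) has_derivative
          (\<lambda>u. t * (D (g t y) (y - y0) v (t *\<^sub>R u) + \<Omega> (g t y) u v))) (at y)"
        by (intro derivative_intros)
      also have "(\<lambda>u. t * (D (g t y) (y - y0) v (t *\<^sub>R u) + \<Omega> (g t y) u v)) = k y v t"
        using Dlin[OF gB[OF that]] by (simp add: k_def linear_cmul fun_eq_iff)
      finally show ?thesis using ap[OF that] has_derivative_at_withinI by metis
    qed
    have "((\<lambda>y. integral (cbox 0 1) (\<lambda>t. t * \<Omega> (g t y) (y - y0) v)) has_derivative
        blinfun_apply (integral (cbox 0 1) (\<lambda>t. Blinfun (k y v t)))) (at y within B)"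
      by (rule leibniz_rule) (use der fint cont y convB in auto)
    moreover have "blinfun_apply (integral {0..1} (\<lambda>t. Blinfun (k y v t))) = \<Theta> y v"
    proof
      fix u
      have "(\<lambda>t. Blinfun (k y v t)) integrable_on {0..1}"
        by (intro integrable_continuous_interval continuous_on_uncurried[OF cont])
          (use y in \<open>auto intro!: continuous_intros\<close>)
      then have "blinfun_apply (integral {0..1} (\<lambda>t. Blinfun (k y v t))) u
          = integral {0..1} (\<lambda>t. blinfun_apply (Blinfun (k y v t)) u)"
        by (rule blinfun_apply_integral)
      also have "\<dots> = \<Theta> y v u"
        unfolding \<Theta>_def by (rule integral_cong) (simp add: ap y)
      finally show "blinfun_apply (integral {0..1} (\<lambda>t. Blinfun (k y v t))) u = \<Theta> y v u" .
    qed
    ultimately show "((\<lambda>y. \<theta> y v) has_derivative \<Theta> y v) (at y)"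
      using y by (simp add: \<theta>_def at_within_open[OF y openB])
  next
    fix u v
    show "continuous_on B (\<lambda>y. \<Theta> y v u)"
      using integral_continuous_on_param[of B 0 1 "\<lambda>y t. k y v t u"] kcont by (simp add: \<Theta>_def)
  next
    fix y u v assume y: "y \<in> B"
    have "\<Theta> y v u - \<Theta> y u v = integral {0..1} (\<lambda>t. k y v t u - k y u t v)"
      unfolding \<Theta>_def by (rule integral_diff[symmetric]) (auto intro: kint y)
    also have "\<dots> = integral {0..1} (\<lambda>t. t\<^sup>2 * D (g t y) u v (y - y0) + 2 * t * \<Omega> (g t y) u v)"
    proof (rule integral_cong)
      fix t :: real assume t: "t \<in> {0..1}"
      note gy = gB[OF y t]
      have "D (g t y) (y - y0) v u - D (g t y) (y - y0) u v = D (g t y) u v (y - y0)"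
        using closed[OF gy, of u v "y - y0"] Dskew[OF gy, of "y - y0"]
        by (simp add: D_def)
      moreover have "\<Omega> (g t y) v u = - \<Omega> (g t y) u v"
      proof -
        have "\<Omega> (g t y) (v + u) (v + u) = \<Omega> (g t y) v v + \<Omega> (g t y) v u + \<Omega> (g t y) u v + \<Omega> (g t y) u u"
          using bil[OF gy] by (simp add: bilinear_ladd bilinear_radd)
        then show ?thesis using alt[OF gy] by simp
      qed
      moreover have "k y v t u - k y u t v
          = t * (t * (D (g t y) (y - y0) v u - D (g t y) (y - y0) u v) + (\<Omega> (g t y) u v - \<Omega> (g t y) v u))"
        unfolding k_def by (simp add: algebra_simps)
      ultimately have "k y v t u - k y u t v = t * (t * D (g t y) u v (y - y0) + 2 * \<Omega> (g t y) u v)"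
        by simp
      then show "k y v t u - k y u t v = t\<^sup>2 * D (g t y) u v (y - y0) + 2 * t * \<Omega> (g t y) u v"
        by (simp add: power2_eq_square algebra_simps)
    qed
    also have "\<dots> = 1\<^sup>2 * \<Omega> (g 1 y) u v - 0\<^sup>2 * \<Omega> (g 0 y) u v"
    proof (rule integral_unique, rule fundamental_theorem_of_calculus)
      fix t :: real assume t: "t \<in> {0..1}"
      have "((\<lambda>t. g t y) has_vector_derivative (y - y0)) (at t)"
        unfolding g_def by (auto intro!: derivative_eq_intros)
      then have "((\<lambda>t. \<Omega> (g t y) u v) has_vector_derivative D (g t y) u v (y - y0)) (at t)"
        using vector_derivative_diff_chain_within[of _ _ _ UNIV] D[OF gB[OF y t], of u v] has_derivative_at_withinI
        by (fastforce simp: o_def)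
      then have d: "((\<lambda>t. \<Omega> (g t y) u v) has_real_derivative D (g t y) u v (y - y0)) (at t)"
        by (simp add: has_real_derivative_iff_has_vector_derivative)
      have "((\<lambda>t. t\<^sup>2 * \<Omega> (g t y) u v) has_real_derivative
          t\<^sup>2 * D (g t y) u v (y - y0) + 2 * t * \<Omega> (g t y) u v) (at t)"
        by (rule derivative_eq_intros d refl | simp)+
      then show "((\<lambda>t. t\<^sup>2 * \<Omega> (g t y) u v) has_vector_derivative
          t\<^sup>2 * D (g t y) u v (y - y0) + 2 * t * \<Omega> (g t y) u v) (at t within {0..1})"
        by (rule has_vector_derivative_at_within[OF iffD1[OF has_real_derivative_iff_has_vector_derivative]])
    qed simp
    also have "\<dots> = \<Omega> y u v" by (simp add: g1)
    finally show "\<Theta> y v u - \<Theta> y u v = \<Omega> y u v" .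
  qed
qed


text \<open>With \<open>\<Omega> = d\<theta>\<close> and \<open>h = f + \<theta>(W)\<close>, Cartan's formula gives \<open>L\<^sub>W \<theta> = dh\<close>. Integrating \<open>\<theta>\<close> along the
  curves \<open>c t\<close>, which are moved by the flow of the Hamiltonian field \<open>W\<close> with fixed end points, yields a
  bounded function of \<open>t\<close> with constant derivative \<open>h b - h a = f b - f a\<close>.\<close>

lemma Hamiltonian_eq_at_fixed_points:
  fixes \<Omega> :: "'f::euclidean_space \<Rightarrow> 'f \<Rightarrow> 'f \<Rightarrow> real" and c q :: "real \<Rightarrow> real \<Rightarrow> 'f"
  assumes B: "open B"
    and \<theta>: "\<And>y. y \<in> B \<Longrightarrow> linear (\<theta> y)"
    and \<Theta>: "\<And>y v. y \<in> B \<Longrightarrow> ((\<lambda>y. \<theta> y v) has_derivative \<Theta> y v) (at y)"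
    and \<Theta>cont: "\<And>u v. continuous_on B (\<lambda>y. \<Theta> y v u)"
    and d\<theta>: "\<And>y u v. y \<in> B \<Longrightarrow> \<Theta> y v u - \<Theta> y u v = \<Omega> y u v"
    and f: "\<And>y. y \<in> B \<Longrightarrow> (f has_derivative \<Omega> y (W y)) (at y)"
    and W: "\<And>y. y \<in> B \<Longrightarrow> (W has_derivative W' y) (at y)"
    and W': "\<And>v. continuous_on B (\<lambda>y. W' y v)"
    and I: "open I" "convex I" "{0..1} \<subseteq> I"
    and K: "compact K" "K \<subseteq> B" "\<And>t s. s \<in> I \<Longrightarrow> c t s \<in> K"
    and ct: "\<And>t s. s \<in> I \<Longrightarrow> ((\<lambda>t. c t s) has_vector_derivative W (c t s)) (at t)"
    and cs: "\<And>t s. s \<in> I \<Longrightarrow> (c t has_vector_derivative q t s) (at s)"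
    and ccont: "continuous_on (UNIV \<times> I) (\<lambda>(t, s). c t s)"
    and qcont: "continuous_on (UNIV \<times> I) (\<lambda>(t, s). q t s)"
    and C: "\<And>t s. s \<in> {0..1} \<Longrightarrow> norm (q t s) \<le> C"
    and ends: "\<And>t. c t 0 = a" "\<And>t. c t 1 = b"
  shows "f a = f b"
proof -
  have cB: "c t s \<in> B" if "s \<in> I" for t s using K that by blast
  have Wcont: "continuous_on B W"
    using W by (intro continuous_at_imp_continuous_on) (auto intro: has_derivative_continuous)
  have \<theta>cont: "continuous_on B (\<lambda>y. \<theta> y v)" for v
    using \<Theta> by (intro continuous_at_imp_continuous_on) (auto intro: has_derivative_continuous)
  have W'lin: "linear (W' y)" if "y \<in> B" for y using W[OF that] has_derivative_linear by blast
  have \<Theta>lin: "linear (\<Theta> y v)" if "y \<in> B" for y v using \<Theta>[OF that] has_derivative_linear by blast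
  have \<Theta>lin1: "linear (\<lambda>v. \<Theta> y v u)" if "y \<in> B" for y u
    by (rule derivative_linear_family[OF B that \<theta> \<Theta>[OF that]])
  define m where "m = (\<lambda>t s. W' (c t s) (q t s))"
  have Wc: "continuous_on (UNIV \<times> I) (\<lambda>(t, s). W (c t s))"
    unfolding split_beta
    by (rule continuous_on_compose2[OF Wcont ccont[unfolded split_beta]]) (auto intro: cB)
  have mcont: "continuous_on (UNIV \<times> I) (\<lambda>(t, s). m t s)"
    unfolding m_def split_beta
    by (rule continuous_on_linear_family[OF W'lin W' ccont[unfolded split_beta] _ qcont[unfolded split_beta]])
      (auto intro: cB)
  have Ws: "((\<lambda>s. W (c t s)) has_vector_derivative m t s) (at s)" if "s \<in> I" for t s
    using vector_derivative_diff_chain_within[of "c t" "q t s" s UNIV W "W' (c t s)"]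
      cs[OF that] W[OF cB[OF that]] has_derivative_at_withinI
    by (fastforce simp: o_def m_def)
  have qt: "((\<lambda>t. q t s) has_vector_derivative m t s) (at t)" if "s \<in> I" for t s
    by (rule mixed_partial_derivatives[where p="\<lambda>t s. W (c t s)", OF I(1,2) that ct cs Ws Wc mcont])
  define k where "k = (\<lambda>t s. \<Theta> (c t s) (q t s) (W (c t s)) + \<theta> (c t s) (m t s))"
  have kcont: "continuous_on (UNIV \<times> I) (\<lambda>(t, s). k t s)"
  proof -
    have "continuous_on (B \<times> UNIV) (\<lambda>z. \<Theta> (fst z) v (snd z))" for v
      by (rule continuous_on_linear_family[where D="\<lambda>y. \<Theta> y v", OF \<Theta>lin \<Theta>cont])
        (auto intro!: continuous_intros)
    then have "continuous_on (UNIV \<times> I)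
      (\<lambda>z. \<Theta> (fst (c (fst z) (snd z), W (c (fst z) (snd z)))) (q (fst z) (snd z)) (snd (c (fst z) (snd z), W (c (fst z) (snd z)))))"
      by (rule continuous_on_linear_family[where D="\<lambda>z v. \<Theta> (fst z) v (snd z)" and S="B \<times> UNIV", rotated])
        (use \<Theta>lin1 ccont qcont Wc cB in \<open>auto simp: split_beta intro!: continuous_on_Pair\<close>)
    moreover have "continuous_on (UNIV \<times> I) (\<lambda>z. \<theta> (c (fst z) (snd z)) (m (fst z) (snd z)))"
    proof (rule continuous_on_linear_family[OF \<theta>])
      show "continuous_on B (\<lambda>y. \<theta> y v)" for v by (rule \<theta>cont)
    qed (use ccont mcont cB in \<open>auto simp: split_beta\<close>)
    ultimately show ?thesis by (simp add: k_def split_beta continuous_on_add)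
  qed
  define J where "J = (\<lambda>t s. \<theta> (c t s) (q t s))"
  have Jt: "((\<lambda>t. J t s) has_vector_derivative k t s) (at t)" if "s \<in> I" for t s
    unfolding J_def k_def
    by (rule has_vector_derivative_linear_family[OF B cB[OF that] \<theta> \<Theta>[OF cB[OF that]] ct[OF that] qt[OF that]])
  define h where "h = (\<lambda>y. f y + \<theta> y (W y))"
  have hs: "((\<lambda>s. h (c t s)) has_vector_derivative k t s) (at s)" if s: "s \<in> I" for t s
  proof -
    have "((\<lambda>s. f (c t s)) has_vector_derivative \<Omega> (c t s) (W (c t s)) (q t s)) (at s)"
      using vector_derivative_diff_chain_within[of "c t" "q t s" s UNIV f "\<Omega> (c t s) (W (c t s))"]
        cs[OF s] f[OF cB[OF s]] has_derivative_at_withinI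
      by (fastforce simp: o_def)
    moreover have "((\<lambda>s. \<theta> (c t s) (W (c t s))) has_vector_derivative
        \<Theta> (c t s) (W (c t s)) (q t s) + \<theta> (c t s) (m t s)) (at s)"
      by (rule has_vector_derivative_linear_family[OF B cB[OF s] \<theta> \<Theta>[OF cB[OF s]] cs[OF s] Ws[OF s]])
    ultimately have "((\<lambda>s. h (c t s)) has_vector_derivative
        \<Omega> (c t s) (W (c t s)) (q t s) + (\<Theta> (c t s) (W (c t s)) (q t s) + \<theta> (c t s) (m t s))) (at s)"
      unfolding h_def by (rule has_vector_derivative_add)
    then show ?thesis by (simp add: k_def flip: d\<theta>[OF cB[OF s]])
  qed
  have stat: "W a = 0" "W b = 0" "a \<in> B" "b \<in> B"
  proof -
    have "0 \<in> I" "1 \<in> I" using I(3) by auto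
    then show "W a = 0" "W b = 0" "a \<in> B" "b \<in> B"
      using ct[of 0 0] ct[of 1 0] cB[of 0 0] cB[of 1 0] vector_derivative_unique_at[OF has_vector_derivative_const]
      by (auto simp: ends)
  qed
  have hf: "h a = f a" "h b = f b" using stat \<theta> by (auto simp: h_def linear_0)
  obtain M where M: "\<And>t s. s \<in> {0..1} \<Longrightarrow> \<bar>J t s\<bar> \<le> M"
  proof -
    have "continuous_on (K \<times> cball 0 C) (\<lambda>z. \<theta> (fst z) (snd z))"
    proof (rule continuous_on_linear_family[OF \<theta>])
      show "continuous_on B (\<lambda>y. \<theta> y v)" for v by (rule \<theta>cont)
    qed (use K in \<open>auto intro!: continuous_intros\<close>)
    then have "bounded ((\<lambda>z. \<theta> (fst z) (snd z)) ` (K \<times> cball 0 C))"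
      by (intro compact_imp_bounded compact_continuous_image compact_Times K) auto
    then obtain M where "\<And>y v. y \<in> K \<Longrightarrow> v \<in> cball 0 C \<Longrightarrow> \<bar>\<theta> y v\<bar> \<le> M"
      unfolding bounded_iff by fastforce
    then have "\<bar>J t s\<bar> \<le> M" if "s \<in> {0..1}" for t s
      using C[OF that] K(3)[of s t] that I(3) unfolding J_def by auto
    then show ?thesis by (rule that)
  qed
  have bound: "R * \<bar>f b - f a\<bar> \<le> 2 * M" if R: "R \<ge> 0" for R
  proof -
    have I01: "s \<in> I" if "s \<in> {0..1}" for s using I(3) that by blast
    have kR: "continuous_on (cbox (0, 0) (1, R)) (\<lambda>(s, t). k t s)"
      unfolding split_beta
      by (rule continuous_on_uncurried[OF kcont]) (use I01 in \<open>auto simp: cbox_Pair_eq intro!: continuous_intros\<close>)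
    have "integral {0..1} (\<lambda>s. J R s - J 0 s) = integral (cbox 0 1) (\<lambda>s. integral (cbox 0 R) (\<lambda>t. k t s))"
    proof (unfold cbox_interval, rule integral_cong)
      fix s :: real assume "s \<in> {0..1}"
      then show "J R s - J 0 s = integral {0..R} (\<lambda>t. k t s)"
        by (intro integral_unique[symmetric] fundamental_theorem_of_calculus R)
          (auto intro!: has_vector_derivative_at_within Jt I01)
    qed
    also have "\<dots> = integral (cbox 0 R) (\<lambda>t. integral (cbox 0 1) (\<lambda>s. k t s))"
      by (rule integral_swap_continuous[OF kR])
    also have "\<dots> = integral {0..R} (\<lambda>t. f b - f a)"
    proof (unfold cbox_interval, rule integral_cong)
      fix t
      have "integral {0..1} (\<lambda>s. k t s) = h (c t 1) - h (c t 0)"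
        by (intro integral_unique fundamental_theorem_of_calculus)
          (auto intro!: has_vector_derivative_at_within hs I01)
      then show "integral {0..1} (\<lambda>s. k t s) = f b - f a" by (simp add: ends hf)
    qed
    also have "\<dots> = R * (f b - f a)" using R by simp
    finally have "R * \<bar>f b - f a\<bar> = \<bar>integral {0..1} (\<lambda>s. J R s - J 0 s)\<bar>"
      using R by (simp add: abs_mult)
    also have "\<dots> \<le> 2 * M * (1 - 0)"
    proof -
      have "norm (integral {0..1} (\<lambda>s. J R s - J 0 s)) \<le> 2 * M * (1 - 0)"
      proof (rule integral_bound)
        have Jcont: "continuous_on {0..1} (\<lambda>s. J t s)" for t
          unfolding J_def
        proof (rule continuous_on_linear_family[OF \<theta>])
          show "continuous_on B (\<lambda>y. \<theta> y v)" for v by (rule \<theta>cont)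
          show "continuous_on {0..1} (c t)" "continuous_on {0..1} (q t)"
            by (rule continuous_on_uncurried[OF ccont] continuous_on_uncurried[OF qcont];
                use I01 in \<open>auto intro!: continuous_intros\<close>)+
        qed (use cB I01 in auto)
        show "continuous_on {0..1} (\<lambda>s. J R s - J 0 s)" by (intro continuous_intros Jcont)
        show "norm (J R s - J 0 s) \<le> 2 * M" if "s \<in> {0..1}" for s
          using M[OF that, of R] M[OF that, of 0] by simp
      qed simp
      then show ?thesis by simp
    qed
    finally show ?thesis by simp
  qed
  show ?thesis
  proof (rule ccontr)
    assume "f a \<noteq> f b"
    then have pos: "\<bar>f b - f a\<bar> > 0" by simp
    have "0 \<le> M" using M[of 0 0] by simp
    then have "(2 * M + 1) / \<bar>f b - f a\<bar> \<ge> 0" by simp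
    from bound[OF this] pos show False by simp
  qed
qed

section \<open>Ordinary differential equations\<close>

lemma smooth_on_imp_lipschitz:
  fixes f :: "'a::euclidean_space \<Rightarrow> 'b::real_normed_vector"
  assumes "smooth_on S f" "open S" "x \<in> S"
  obtains r L where "r > 0" "cball x r \<subseteq> S" "L > 0"
    "\<And>y z. \<lbrakk>y \<in> cball x r; z \<in> cball x r\<rbrakk> \<Longrightarrow> norm (f y - f z) \<le> L * norm (y - z)"
proof -
  obtain r where r: "r > 0" "cball x r \<subseteq> S" using assms(2,3) open_contains_cball by blast
  define D where "D = (\<lambda>y. frechet_derivative f (at y))"
  have D: "(f has_derivative D y) (at y)" if "y \<in> S" for y
    unfolding D_def by (rule smooth_on_has_derivative[OF assms(1) that])
  have lin: "linear (D y)" if "y \<in> S" for y using D[OF that] has_derivative_linear by blast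
  have Dc: "continuous_on S (\<lambda>y. D y b)" for b
    unfolding D_def by (intro smooth_on_imp_continuous_on smooth_on_frechet_derivative assms)
  have "continuous_on (cball x r \<times> cball 0 1) (\<lambda>z. D (fst z) (snd z))"
    by (rule continuous_on_linear_family[where D=D, OF lin Dc]) (use r in \<open>auto intro!: continuous_intros\<close>)
  then have "bounded ((\<lambda>z. D (fst z) (snd z)) ` (cball x r \<times> cball 0 1))"
    by (intro compact_imp_bounded compact_continuous_image compact_Times compact_cball) auto
  then obtain L where L: "L > 0" "\<And>y v. y \<in> cball x r \<Longrightarrow> v \<in> cball 0 1 \<Longrightarrow> norm (D y v) \<le> L"
    unfolding bounded_pos by fastforce
  have "onorm (D y) \<le> L" if y: "y \<in> cball x r" for y
  proof (rule onorm_bound)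
    fix v
    show "norm (D y v) \<le> L * norm v"
    proof (cases "v = 0")
      case True
      then show ?thesis using lin y r by (auto simp: linear_0)
    next
      case False
      have "norm (D y ((1 / norm v) *\<^sub>R v)) \<le> L" by (rule L(2)[OF y]) (use False in simp)
      then show ?thesis using lin[of y] y r False by (simp add: linear_cmul subset_iff field_simps)
    qed
  qed (use L in simp)
  note bd = this
  have "norm (f y - f z) \<le> L * norm (y - z)" if "y \<in> cball x r" "z \<in> cball x r" for y z
  proof (rule differentiable_bound[OF convex_cball _ _ that])
    show "(f has_derivative D y) (at y within cball x r)" if "y \<in> cball x r" for y
      by (rule has_derivative_at_withinI, rule D) (use that r(2) in blast)
  qed (rule bd)
  with r L(1) show ?thesis using that by blast
qed

lemma Picard_Lindelof:
  fixes Y :: "'a::euclidean_space \<Rightarrow> 'a"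
  assumes r: "r > 0" and L: "L > 0"
    and lip: "\<And>y z. \<lbrakk>y \<in> cball e r; z \<in> cball e r\<rbrakk> \<Longrightarrow> norm (Y y - Y z) \<le> L * norm (y - z)"
  obtains \<delta> y where "\<delta> > 0" "y 0 = e" "\<And>t. y t \<in> cball e r"
    "\<And>t. \<bar>t\<bar> < \<delta> \<Longrightarrow> (y has_vector_derivative Y (y t)) (at t)"
proof -
  define cp where "cp = closest_point (cball e r)"
  define Z where "Z = (\<lambda>y. Y (cp y))"
  have ne: "cball e r \<noteq> {}" using r by simp
  have cp: "cp y \<in> cball e r" for y unfolding cp_def by (rule closest_point_in_set[OF _ ne]) simp
  have Zlip: "norm (Z y - Z z) \<le> L * norm (y - z)" for y z
  proof -
    have "norm (Z y - Z z) \<le> L * norm (cp y - cp z)" unfolding Z_def by (intro lip cp)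
    also have "\<dots> \<le> L * norm (y - z)"
      using closest_point_lipschitz[of "cball e r" y z] ne L by (simp add: cp_def dist_norm)
    finally show ?thesis .
  qed
  define M where "M = norm (Y e) + L * r"
  have M: "M > 0" using r L by (simp add: M_def add_nonneg_pos)
  have ZM: "norm (Z y) \<le> M" for y
  proof -
    have "norm (Y (cp y) - Y e) \<le> L * norm (cp y - e)" using r by (intro lip cp) auto
    also have "\<dots> \<le> L * r" using L cp[of y] by (simp add: dist_norm norm_minus_commute)
    finally show ?thesis using norm_triangle_sub[of "Y (cp y)" "Y e"] by (simp add: Z_def M_def)
  qed
  define \<delta> where "\<delta> = min (1 / (8 * L)) (r / (4 * M))"
  have \<delta>: "\<delta> > 0" "8 * L * \<delta> \<le> 1" "4 * M * \<delta> \<le> r"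
    using r L M by (auto simp: \<delta>_def min_def field_simps)
  define k where "k = (\<lambda>t. max (- \<delta>) (min \<delta> t))"
  have k: "k t \<in> {-\<delta>..\<delta>}" for t using \<delta> by (auto simp: k_def)
  have Zcont: "continuous_on UNIV Z"
  proof -
    have "L-lipschitz_on UNIV Z"
      using L Zlip by (intro lipschitz_onI) (auto simp: dist_norm)
    then show ?thesis by (rule lipschitz_on_continuous_on)
  qed
  define G where "G = (\<lambda>u t. integral {-\<delta>..t} (\<lambda>s. Z (u s)))"
  have int: "(\<lambda>s. Z (u s)) integrable_on {-\<delta>..t}" if "continuous_on UNIV u" for u t
    by (intro integrable_continuous_interval continuous_on_compose2[OF Zcont] continuous_on_subset[OF that]) auto
  have Gbound: "norm (G u t) \<le> 2 * \<delta> * M" if "continuous_on UNIV u" "t \<in> {-\<delta>..\<delta>}" for u t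
  proof -
    have "norm (G u t) \<le> M * (t - (- \<delta>))"
      unfolding G_def
      by (rule integral_bound)
        (use that ZM in \<open>auto intro!: continuous_on_compose2[OF Zcont] intro: continuous_on_subset\<close>)
    also have "\<dots> \<le> M * (2 * \<delta>)" using that M by (intro mult_left_mono) auto
    finally show ?thesis by (simp add: mult_ac)
  qed
  have Gdiff: "norm (G u t - G w t) \<le> 2 * \<delta> * (L * d)"
    if "continuous_on UNIV u" "continuous_on UNIV w" "t \<in> {-\<delta>..\<delta>}" "\<And>s. dist (u s) (w s) \<le> d" for u w t d
  proof -
    have d: "d \<ge> 0" using that(4)[of 0] zero_le_dist order_trans by blast
    have "norm (integral {-\<delta>..t} (\<lambda>s. Z (u s) - Z (w s))) \<le> (L * d) * (t - (- \<delta>))"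
    proof (rule integral_bound)
      show "continuous_on {-\<delta>..t} (\<lambda>s. Z (u s) - Z (w s))"
        by (intro continuous_on_diff continuous_on_compose2[OF Zcont] continuous_on_subset[OF that(1)]
            continuous_on_subset[OF that(2)]) auto
      show "norm (Z (u s) - Z (w s)) \<le> L * d" for s
        using order_trans[OF Zlip[of "u s" "w s"] mult_left_mono[OF that(4)[of s, unfolded dist_norm]]] L by simp
    qed (use that in auto)
    also have "\<dots> \<le> (L * d) * (2 * \<delta>)" using that L d by (intro mult_left_mono) auto
    finally show ?thesis
      unfolding G_def using integral_diff[OF int[OF that(1)] int[OF that(2)]] by (simp add: mult_ac)
  qed
  define P where "P = (\<lambda>u t. e + G u (k t) - G u 0)"
  have Gder: "(G u has_vector_derivative Z (u t)) (at t)" if "continuous_on UNIV u" "\<bar>t\<bar> < \<delta>" for u t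
  proof -
    have "(G u has_vector_derivative Z (u t)) (at t within {-\<delta>..\<delta>})"
      unfolding G_def
      by (rule integral_has_vector_derivative)
        (use that in \<open>auto intro!: continuous_on_compose2[OF Zcont] intro: continuous_on_subset\<close>)
    then show ?thesis using that(2) by (subst (asm) at_within_interior) (auto simp: interior_atLeastAtMost_real)
  qed
  have Pcont: "continuous_on UNIV (P u)" if "continuous_on UNIV u" for u
  proof -
    have "continuous_on {-\<delta>..\<delta>} (G u)"
      unfolding G_def by (rule indefinite_integral_continuous_1[OF int[OF that]])
    then have "continuous_on UNIV (\<lambda>t. G u (k t))"
      by (rule continuous_on_compose2) (auto simp: k_def intro!: continuous_intros k[unfolded k_def])
    then show ?thesis unfolding P_def by (intro continuous_intros)
  qed
  have Pball: "P u t \<in> cball e r" if "continuous_on UNIV u" for u t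
  proof -
    have "norm (G u (k t) - G u 0) \<le> 2 * \<delta> * M + 2 * \<delta> * M"
      by (intro norm_triangle_le_diff add_mono Gbound that k) (use \<delta> in auto)
    also have "\<dots> \<le> r" using \<delta>(3) by (simp add: mult_ac)
    finally show ?thesis by (simp add: P_def dist_norm norm_minus_commute)
  qed
  have Pb: "P u \<in> bcontfun" if "continuous_on UNIV u" for u
    unfolding bcontfun_def using Pcont[OF that] Pball[OF that]
    by (auto intro: bounded_subset[OF bounded_cball[of e r]])
  define F where "F = (\<lambda>u. Bcontfun (P (apply_bcontfun u)))"
  have uc: "continuous_on UNIV (apply_bcontfun u)" for u :: "real \<Rightarrow>\<^sub>C 'a"
    using apply_bcontfun[of u] by (simp add: bcontfun_def)
  have F: "apply_bcontfun (F u) = P (apply_bcontfun u)" for u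
    unfolding F_def by (rule Bcontfun_inverse[OF Pb[OF uc]])
  have "\<forall>u w. dist (F u) (F w) \<le> 1 / 2 * dist u w"
  proof (intro allI dist_bound)
    fix u w :: "real \<Rightarrow>\<^sub>C 'a" and t
    let ?d = "dist u w"
    have "dist (F u t) (F w t) = norm ((G u (k t) - G w (k t)) - (G u 0 - G w 0))"
      by (simp add: F P_def dist_norm algebra_simps)
    also have "\<dots> \<le> 2 * \<delta> * (L * ?d) + 2 * \<delta> * (L * ?d)"
      by (intro norm_triangle_le_diff add_mono Gdiff uc k dist_bounded) (use \<delta> in auto)
    also have "\<dots> = (8 * L * \<delta>) * ?d / 2" by simp
    also have "\<dots> \<le> 1 * ?d / 2" using \<delta>(2) by (intro divide_right_mono mult_right_mono) auto
    finally show "dist (F u t) (F w t) \<le> 1 / 2 * ?d" by simp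
  qed
  then have "\<exists>!u. F u = u" by (intro banach_fix_type[of "1/2"]) auto
  then obtain u where u: "F u = u" by blast
  define y where "y = apply_bcontfun u"
  have y: "y = P y" and yc: "continuous_on UNIV y" using F[of u] uc[of u] u by (simp_all add: y_def)
  have yb: "y t \<in> cball e r" for t using Pball[OF yc] y by metis
  show ?thesis
  proof (rule that[OF \<delta>(1)])
    have "k 0 = 0" using \<delta> by (simp add: k_def)
    then have "P y 0 = e" by (simp add: P_def)
    then show "y 0 = e" using y by metis
    show "y t \<in> cball e r" for t by (rule yb)
    fix t assume t: "\<bar>t\<bar> < \<delta>"
    have "((\<lambda>t. e + G y t - G y 0) has_vector_derivative Z (y t)) (at t)"
      using Gder[OF yc t] by (auto intro!: derivative_eq_intros)
    then have "(P y has_vector_derivative Z (y t)) (at t)"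
      by (rule has_vector_derivative_transform_within_open[where S="{-\<delta><..<\<delta>}"])
        (use t in \<open>auto simp: P_def k_def\<close>)
    moreover have "Z (y t) = Y (y t)" unfolding Z_def cp_def using yb by (simp add: closest_point_self)
    ultimately show "(y has_vector_derivative Y (y t)) (at t)" using y by simp
  qed
qed

section \<open>Charts and velocities\<close>

lemma is_chartD:
  assumes "is_chart c"
  shows "open (cdom c)" "open (coord c ` cdom c)"
    "continuous_on (cdom c) (coord c)" "continuous_on (coord c ` cdom c) (cinv c)"
    "p \<in> cdom c \<Longrightarrow> cinv c (coord c p) = p"
    "y \<in> coord c ` cdom c \<Longrightarrow> cinv c y \<in> cdom c"
    "y \<in> coord c ` cdom c \<Longrightarrow> coord c (cinv c y) = y"
  using assms unfolding is_chart_def homeomorphism_def by auto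

lemma open_coord_image:
  assumes "is_chart c" "open T" "T \<subseteq> cdom c"
  shows "open (coord c ` T)"
proof -
  have "openin (top_of_set (coord c ` cdom c)) (coord c ` T)"
    using assms is_chartD(1)[OF assms(1)]
    by (intro homeomorphism_imp_open_map[of "cdom c" _ "coord c" "cinv c"])
      (auto simp: is_chart_def open_subset)
  then show ?thesis using is_chartD(2)[OF assms(1)] openin_open_eq by blast
qed

definition prod_chart :: "('m, 'e) chart \<Rightarrow> ('n, 'f) chart \<Rightarrow> ('m \<times> 'n, 'e \<times> 'f) chart" where
  "prod_chart c d = Chart (cdom c \<times> cdom d) (map_prod (coord c) (coord d))"

lemma prod_chart_sel [simp]:
  "cdom (prod_chart c d) = cdom c \<times> cdom d"
  "coord (prod_chart c d) = map_prod (coord c) (coord d)"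
  by (simp_all add: prod_chart_def)

lemma prod_chart_in_atlas: "\<lbrakk>c \<in> \<A>; d \<in> \<B>\<rbrakk> \<Longrightarrow> prod_chart c d \<in> prod_atlas \<A> \<B>"
  by (force simp: prod_atlas_def prod_chart_def)

lemma cinv_prod_chart:
  assumes "is_chart c" "is_chart d" "y \<in> coord c ` cdom c" "z \<in> coord d ` cdom d"
  shows "cinv (prod_chart c d) (y, z) = (cinv c y, cinv d z)"
proof -
  have "inj_on (map_prod (coord c) (coord d)) (cdom c \<times> cdom d)"
    using is_chartD(5)[OF assms(1)] is_chartD(5)[OF assms(2)]
    by (auto simp: inj_on_def) (metis+)
  moreover have "(y, z) = map_prod (coord c) (coord d) (cinv c y, cinv d z)"
    using is_chartD(7)[OF assms(1,3)] is_chartD(7)[OF assms(2,4)] by simp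
  moreover have "(cinv c y, cinv d z) \<in> cdom c \<times> cdom d" using is_chartD(6)[OF assms(1,3)] is_chartD(6)[OF assms(2,4)] by simp
  ultimately show ?thesis unfolding cinv_def[of "prod_chart _ _"] prod_chart_sel by (metis inv_into_f_f)
qed

lemma is_chart_prod:
  assumes c: "is_chart c" and d: "is_chart d"
  shows "is_chart (prod_chart c d)"
proof -
  have img: "map_prod (coord c) (coord d) ` (cdom c \<times> cdom d) = coord c ` cdom c \<times> coord d ` cdom d"
    by (rule map_prod_surj_on) auto
  have "homeomorphism (cdom c \<times> cdom d) (coord c ` cdom c \<times> coord d ` cdom d)
      (map_prod (coord c) (coord d)) (cinv (prod_chart c d))"
  proof (rule homeomorphismI)
    show "continuous_on (cdom c \<times> cdom d) (map_prod (coord c) (coord d))"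
      unfolding map_prod_def split_beta
      by (intro continuous_on_Pair continuous_on_compose2[OF is_chartD(3)[OF c]]
          continuous_on_compose2[OF is_chartD(3)[OF d]] continuous_intros) auto
    have "continuous_on (coord c ` cdom c \<times> coord d ` cdom d) (\<lambda>z. (cinv c (fst z), cinv d (snd z)))"
      by (intro continuous_on_Pair continuous_on_compose2[OF is_chartD(4)[OF c]]
          continuous_on_compose2[OF is_chartD(4)[OF d]] continuous_intros) auto
    then show "continuous_on (coord c ` cdom c \<times> coord d ` cdom d) (cinv (prod_chart c d))"
      by (rule continuous_on_eq) (auto simp: cinv_prod_chart[OF c d])
  qed (auto simp: cinv_prod_chart[OF c d] img is_chartD[OF c] is_chartD[OF d])
  then show ?thesis
    using is_chartD(1,2)[OF c] is_chartD(1,2)[OF d] by (simp add: is_chart_def img open_Times)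
qed

definition has_velocity ::
  "('m::topological_space, 'e::euclidean_space) chart \<Rightarrow> (real \<Rightarrow> 'm) \<Rightarrow> 'e \<Rightarrow> real \<Rightarrow> bool" where
  "has_velocity c \<gamma> v t \<longleftrightarrow> \<gamma> t \<in> cdom c \<and> isCont \<gamma> t \<and>
     ((\<lambda>s. coord c (\<gamma> s)) has_vector_derivative v) (at t)"

lemma has_velocity_unique: "has_velocity c \<gamma> v t \<Longrightarrow> has_velocity c \<gamma> w t \<Longrightarrow> v = w"
  unfolding has_velocity_def using vector_derivative_unique_at by blast

lemma has_velocity_const: "p \<in> cdom c \<Longrightarrow> has_velocity c (\<lambda>_. p) 0 t"
  by (simp add: has_velocity_def has_vector_derivative_const)

lemma has_velocity_cong:
  assumes "has_velocity c \<gamma> v t" "eventually (\<lambda>s. \<gamma> s = \<delta> s) (nhds t)"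
  shows "has_velocity c \<delta> v t"
proof -
  have eq: "\<gamma> t = \<delta> t" using assms(2) by (rule eventually_nhds_x_imp_x)
  have ev: "eventually (\<lambda>s. \<gamma> s = \<delta> s) (at t)" using assms(2) by (simp add: eventually_nhds_conv_at)
  show ?thesis
    using assms(1) eq isCont_cong[OF assms(2)]
      has_vector_derivative_cong_ev[where S=UNIV and x=t and f="\<lambda>s. coord c (\<gamma> s)" and g="\<lambda>s. coord c (\<delta> s)"]
      eventually_mono[OF assms(2), of "\<lambda>s. s \<in> UNIV \<longrightarrow> coord c (\<gamma> s) = coord c (\<delta> s)"]
    by (auto simp: has_velocity_def)
qed

lemma has_velocity_shift: "has_velocity c (\<lambda>s. \<gamma> (a + s)) v t \<longleftrightarrow> has_velocity c \<gamma> v (a + t)"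
proof -
  have 1: "has_velocity c (\<lambda>s. \<gamma> (a + s)) v t" if "has_velocity c \<gamma> v (a + t)" for \<gamma> a t
  proof -
    have sh: "((\<lambda>s. a + s) has_vector_derivative 1) (at t)" by (auto intro!: derivative_eq_intros)
    have "((\<lambda>s. coord c (\<gamma> (a + s))) has_vector_derivative 1 *\<^sub>R v) (at t)"
      using vector_diff_chain_at[OF sh, of "\<lambda>s. coord c (\<gamma> s)" v] that
      by (simp add: has_velocity_def o_def)
    moreover have "isCont (\<lambda>s. \<gamma> (a + s)) t"
      using that isCont_o2[where f="\<lambda>s. a + s" and a=t and g=\<gamma>] by (auto simp: has_velocity_def)
    ultimately show ?thesis using that by (simp add: has_velocity_def)
  qed
  show ?thesis
  proof
    assume "has_velocity c (\<lambda>s. \<gamma> (a + s)) v t"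
    then show "has_velocity c \<gamma> v (a + t)"
      using 1[of "\<lambda>s. \<gamma> (a + s)" "- a" "a + t"] by simp
  qed (rule 1)
qed

lemma has_velocity_scale:
  assumes "has_velocity c \<gamma> v (a * t)"
  shows "has_velocity c (\<lambda>s. \<gamma> (a * s)) (a *\<^sub>R v) t"
proof -
  have sh: "((\<lambda>s. a * s) has_vector_derivative a) (at t)" by (auto intro!: derivative_eq_intros)
  have "((\<lambda>s. coord c (\<gamma> (a * s))) has_vector_derivative a *\<^sub>R v) (at t)"
    using vector_diff_chain_at[OF sh, of "\<lambda>s. coord c (\<gamma> s)" v] assms
    by (simp add: has_velocity_def o_def)
  moreover have "isCont (\<lambda>s. \<gamma> (a * s)) t"
    using assms isCont_o2[where f="\<lambda>s. a * s" and a=t and g=\<gamma>] by (auto simp: has_velocity_def)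
  ultimately show ?thesis using assms by (simp add: has_velocity_def)
qed

lemma has_velocity_Pair:
  assumes "has_velocity c \<gamma> v t" "has_velocity d \<delta> w t"
  shows "has_velocity (prod_chart c d) (\<lambda>s. (\<gamma> s, \<delta> s)) (v, w) t"
  using assms by (auto simp: has_velocity_def intro!: isCont_Pair has_vector_derivative_Pair)

lemma has_velocity_line:
  assumes "is_chart c" "y \<in> coord c ` cdom c"
  shows "has_velocity c (\<lambda>s. cinv c (y + s *\<^sub>R v)) v 0"
proof -
  have der: "((\<lambda>s. y + s *\<^sub>R v) has_vector_derivative v) (at 0)" by (auto intro!: derivative_eq_intros)
  have "isCont (\<lambda>s. y + s *\<^sub>R v) 0" by (intro continuous_intros)
  then have "eventually (\<lambda>s. y + s *\<^sub>R v \<in> coord c ` cdom c) (at 0)"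
    using assms(2) is_chartD(2)[OF assms(1)] by (simp add: isCont_def topological_tendstoD)
  then have ev: "eventually (\<lambda>s. y + s *\<^sub>R v \<in> coord c ` cdom c) (nhds 0)"
    using assms(2) by (simp add: eventually_nhds_conv_at)
  have "((\<lambda>s. coord c (cinv c (y + s *\<^sub>R v))) has_vector_derivative v) (at 0)"
    using der has_vector_derivative_cong_ev[where S=UNIV and x=0 and g="\<lambda>s. coord c (cinv c (y + s *\<^sub>R v))"
        and f="\<lambda>s. y + s *\<^sub>R v" and f'=v]
      eventually_mono[OF ev, of "\<lambda>s. s \<in> UNIV \<longrightarrow> y + s *\<^sub>R v = coord c (cinv c (y + s *\<^sub>R v))"]
      is_chartD(7)[OF assms(1)] assms(2) by auto
  moreover have "isCont (\<lambda>s. cinv c (y + s *\<^sub>R v)) 0"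
  proof (rule isCont_o2)
    show "isCont (cinv c) (y + 0 *\<^sub>R v)"
      using is_chartD(2,4)[OF assms(1)] assms(2) continuous_on_eq_continuous_at by auto
  qed (intro continuous_intros)
  ultimately show ?thesis using is_chartD(6)[OF assms] by (simp add: has_velocity_def)
qed

definition local_rep :: "('m, 'e) chart \<Rightarrow> ('n, 'f) chart \<Rightarrow> ('m \<Rightarrow> 'n) \<Rightarrow> 'e \<Rightarrow> 'f" where
  "local_rep c d f = coord d \<circ> f \<circ> cinv c"

definition tangent_map ::
  "('m, 'e::euclidean_space) chart \<Rightarrow> ('n, 'f::euclidean_space) chart \<Rightarrow> ('m \<Rightarrow> 'n) \<Rightarrow> 'm \<Rightarrow> 'e \<Rightarrow> 'f" where
  "tangent_map c d f p = frechet_derivative (local_rep c d f) (at (coord c p))"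

locale holo_maps =
  fixes \<A> :: "('m::t2_space, 'e::euclidean_space) chart set" and J :: "'e \<Rightarrow> 'e"
    and \<B> :: "('n::t2_space, 'f::euclidean_space) chart set" and J' :: "'f \<Rightarrow> 'f"
    and f :: "'m \<Rightarrow> 'n"
  assumes holo: "holo_map \<A> J \<B> J' f"
    and charts: "\<And>c. c \<in> \<A> \<Longrightarrow> is_chart c" "\<And>d. d \<in> \<B> \<Longrightarrow> is_chart d"
begin

lemma continuous_f: "continuous_on S f"
  using holo continuous_on_subset by (auto simp: holo_map_def)

lemma open_domain: "c \<in> \<A> \<Longrightarrow> d \<in> \<B> \<Longrightarrow> open (coord c ` (cdom c \<inter> f -` cdom d))"
  using continuous_f[of UNIV] is_chartD(1)[OF charts(1)] is_chartD(1)[OF charts(2)]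
  by (intro open_coord_image open_Int open_vimage charts) auto

lemma smooth_local_rep:
  "c \<in> \<A> \<Longrightarrow> d \<in> \<B> \<Longrightarrow> smooth_on (coord c ` (cdom c \<inter> f -` cdom d)) (local_rep c d f)"
  using holo by (auto simp: holo_map_def holo_on_def local_rep_def)

lemma derivative_local_rep:
  assumes "c \<in> \<A>" "d \<in> \<B>" "p \<in> cdom c" "f p \<in> cdom d"
  shows "(local_rep c d f has_derivative tangent_map c d f p) (at (coord c p))"
  unfolding tangent_map_def
  by (rule smooth_on_has_derivative[OF smooth_local_rep[OF assms(1,2)]]) (use assms in auto)

lemma linear_tangent_map:
  "\<lbrakk>c \<in> \<A>; d \<in> \<B>; p \<in> cdom c; f p \<in> cdom d\<rbrakk> \<Longrightarrow> linear (tangent_map c d f p)"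
  using derivative_local_rep has_derivative_linear by blast

lemma tangent_map_J:
  "\<lbrakk>c \<in> \<A>; d \<in> \<B>; p \<in> cdom c; f p \<in> cdom d\<rbrakk>
    \<Longrightarrow> tangent_map c d f p (J v) = J' (tangent_map c d f p v)"
  using holo by (auto simp: holo_map_def holo_on_def local_rep_def tangent_map_def)

lemma has_velocity_compose:
  assumes "c \<in> \<A>" "d \<in> \<B>" "has_velocity c \<gamma> v t" "f (\<gamma> t) \<in> cdom d"
  shows "has_velocity d (\<lambda>s. f (\<gamma> s)) (tangent_map c d f (\<gamma> t) v) t"
proof -
  have \<gamma>: "\<gamma> t \<in> cdom c" "isCont \<gamma> t" "((\<lambda>s. coord c (\<gamma> s)) has_vector_derivative v) (at t)"
    using assms(3) by (auto simp: has_velocity_def)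
  have "((local_rep c d f \<circ> (\<lambda>s. coord c (\<gamma> s))) has_vector_derivative tangent_map c d f (\<gamma> t) v) (at t)"
    using vector_derivative_diff_chain_within[of "\<lambda>s. coord c (\<gamma> s)" v t UNIV "local_rep c d f"]
      derivative_local_rep[OF assms(1,2) \<gamma>(1) assms(4)] \<gamma>(3) has_derivative_at_withinI by blast
  moreover have "eventually (\<lambda>s. \<gamma> s \<in> cdom c) (nhds t)"
    using \<gamma>(1,2) is_chartD(1)[OF charts(1)[OF assms(1)]]
    by (simp add: eventually_nhds_conv_at isCont_def topological_tendstoD)
  then have "eventually (\<lambda>s. s \<in> UNIV \<longrightarrow> (local_rep c d f \<circ> (\<lambda>s. coord c (\<gamma> s))) s = coord d (f (\<gamma> s))) (nhds t)"
    by eventually_elim (simp add: local_rep_def is_chartD(5)[OF charts(1)[OF assms(1)]])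
  ultimately have "((\<lambda>s. coord d (f (\<gamma> s))) has_vector_derivative tangent_map c d f (\<gamma> t) v) (at t)"
    using has_vector_derivative_cong_ev[where S=UNIV and x=t
        and f="local_rep c d f \<circ> (\<lambda>s. coord c (\<gamma> s))" and g="\<lambda>s. coord d (f (\<gamma> s))"] \<gamma>(1)
      is_chartD(5)[OF charts(1)[OF assms(1)]]
    by (simp add: local_rep_def)
  moreover have "isCont (\<lambda>s. f (\<gamma> s)) t"
    using continuous_f[of UNIV] \<gamma>(2) by (intro isCont_o2[where f=\<gamma> and g=f]) (auto simp: continuous_on_eq_continuous_at)
  ultimately show ?thesis using assms(4) by (simp add: has_velocity_def)
qed

lemma has_velocity_zero_compose:
  assumes "c \<in> \<A>" "d \<in> \<B>" "has_velocity c \<gamma> 0 t" "f (\<gamma> t) \<in> cdom d"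
  shows "has_velocity d (\<lambda>s. f (\<gamma> s)) 0 t"
proof -
  have "tangent_map c d f (\<gamma> t) 0 = 0"
    using linear_tangent_map[OF assms(1,2) _ assms(4)] assms(3)
    by (intro linear_0) (simp add: has_velocity_def)
  then show ?thesis using has_velocity_compose[OF assms] by simp
qed

end

lemma complex_manifoldD:
  assumes "complex_manifold \<A> J"
  shows "c \<in> \<A> \<Longrightarrow> is_chart c" "\<exists>c\<in>\<A>. p \<in> cdom c" "holo_maps \<A> J \<A> J (\<lambda>p. p)"
    "linear J" "J (J v) = - v"
proof -
  show "c \<in> \<A> \<Longrightarrow> is_chart c" "\<exists>c\<in>\<A>. p \<in> cdom c" "linear J" "J (J v) = - v"
    using assms by (auto simp: complex_manifold_def complex_structure_def)
  have "coord d \<circ> (\<lambda>p. p) \<circ> cinv c = coord d \<circ> cinv c" for c d :: "('a, 'b) chart"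
    by (simp add: fun_eq_iff)
  then show "holo_maps \<A> J \<A> J (\<lambda>p. p)"
    using assms by (unfold_locales) (auto simp: holo_map_def complex_manifold_def)
qed

lemma zero_velocity_imp_constant:
  fixes \<gamma> :: "real \<Rightarrow> 'm::{t2_space,second_countable_topology}"
    and \<A> :: "('m, 'e::euclidean_space) chart set"
  assumes mf: "complex_manifold \<A> J" and I: "open I" "connected I"
    and vel: "\<And>t. t \<in> I \<Longrightarrow> \<exists>c\<in>\<A>. has_velocity c \<gamma> 0 t"
    and st: "s \<in> I" "t \<in> I"
  shows "\<gamma> s = \<gamma> t"
proof (rule connected_local_const[OF I(2) st], rule ballI)
  interpret id: holo_maps \<A> J \<A> J "\<lambda>p. p" by (rule complex_manifoldD[OF mf])
  fix t assume t: "t \<in> I"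
  then obtain c where c: "c \<in> \<A>" "has_velocity c \<gamma> 0 t" using vel by blast
  have "isCont \<gamma> t" "\<gamma> t \<in> cdom c" using c(2) by (auto simp: has_velocity_def)
  then have "eventually (\<lambda>s. \<gamma> s \<in> cdom c) (nhds t)"
    using is_chartD(1)[OF complex_manifoldD(1)[OF mf c(1)]]
    by (auto simp: eventually_nhds_conv_at isCont_def topological_tendstoD)
  then have "eventually (\<lambda>s. \<gamma> s \<in> cdom c \<and> s \<in> I) (nhds t)"
    using eventually_nhds_in_open[OF I(1) t] by (rule eventually_conj)
  then obtain r where r: "r > 0" "\<And>s. s \<in> ball t r \<Longrightarrow> \<gamma> s \<in> cdom c \<and> s \<in> I"
    unfolding eventually_nhds_metric by (auto simp: dist_commute)
  have v: "has_velocity c \<gamma> 0 s" if s: "s \<in> ball t r" for s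
  proof -
    obtain d where "d \<in> \<A>" "has_velocity d \<gamma> 0 s" using vel r(2)[OF s] by blast
    then show ?thesis using id.has_velocity_zero_compose c(1) r(2)[OF s] by blast
  qed
  have const: "coord c (\<gamma> s) = coord c (\<gamma> t)" if s: "s \<in> ball t r" for s
  proof (rule has_derivative_zero_unique[of "ball t r"])
    show "((\<lambda>s. coord c (\<gamma> s)) has_derivative (\<lambda>h. 0)) (at s within ball t r)" if "s \<in> ball t r" for s
      using v[OF that] has_derivative_at_withinI
      by (auto simp: has_velocity_def has_vector_derivative_def)
  qed (use s r in auto)
  have "\<gamma> t = \<gamma> s" if s: "s \<in> ball t r" for s
    using is_chartD(5)[OF complex_manifoldD(1)[OF mf c(1)]] r const s by (metis centre_in_ball)
  then have "eventually (\<lambda>s. \<gamma> t = \<gamma> s) (nhds t)"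
    unfolding eventually_nhds_metric using r(1) by (auto simp: dist_commute)
  then show "eventually (\<lambda>s. \<gamma> t = \<gamma> s) (at t within I)"
    unfolding eventually_at_filter by eventually_elim simp
qed

section \<open>The exponential map\<close>

locale lie_group =
  fixes H :: "('h::{t2_space,second_countable_topology}) monoid" (structure)
    and \<A> :: "('h, 'e::euclidean_space) chart set" and J :: "'e \<Rightarrow> 'e" and \<kappa> :: "('h, 'e) chart"
  assumes lie: "complex_Lie_group H \<A> J" and \<kappa>: "\<kappa> \<in> \<A>" and one_\<kappa>: "\<one> \<in> cdom \<kappa>"
begin

sublocale group H
  using lie by (simp add: complex_Lie_group_def)

lemma carrier_UNIV [simp]: "carrier H = UNIV"
  using lie by (simp add: complex_Lie_group_def)

lemma manifold: "complex_manifold \<A> J"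
  using lie by (simp add: complex_Lie_group_def)

lemmas chart_\<A> = complex_manifoldD(1)[OF manifold]
  and chart_at = complex_manifoldD(2)[OF manifold]

sublocale mult: holo_maps "prod_atlas \<A> \<A>" "map_prod J J" \<A> J "\<lambda>(g, h). g \<otimes> h"
proof
  show "holo_map (prod_atlas \<A> \<A>) (map_prod J J) \<A> J (\<lambda>(g, h). g \<otimes> h)"
    using lie by (simp add: complex_Lie_group_def)
  show "is_chart c" if "c \<in> prod_atlas \<A> \<A>" for c
    using that is_chart_prod chart_\<A> by (auto simp: prod_atlas_def prod_chart_def)
qed (rule chart_\<A>)

sublocale inverse: holo_maps \<A> J \<A> J "\<lambda>g. inv g"
  using lie by unfold_locales (auto simp: complex_Lie_group_def intro: chart_\<A>)

abbreviation "Exp \<equiv> Lie_exp H \<kappa>"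
abbreviation "Adj \<equiv> Ad H \<kappa>"
abbreviation "bracket \<equiv> Lie_bracket H \<kappa>"
abbreviation "Lie \<equiv> Lie_alg H \<kappa>"
abbreviation "Dmult c d e \<equiv> tangent_map (prod_chart c d) e (\<lambda>(g, h). g \<otimes> h)"

lemma continuous_on_mult:
  "continuous_on S f \<Longrightarrow> continuous_on S g \<Longrightarrow> continuous_on S (\<lambda>x. f x \<otimes> g x)"
  using continuous_on_compose2[OF mult.continuous_f[of UNIV] continuous_on_Pair, of S f g] by simp

lemma has_velocity_mult:
  assumes "c \<in> \<A>" "d \<in> \<A>" "e \<in> \<A>" "has_velocity c \<alpha> v t" "has_velocity d \<beta> w t" "\<alpha> t \<otimes> \<beta> t \<in> cdom e"
  shows "has_velocity e (\<lambda>s. \<alpha> s \<otimes> \<beta> s)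
    (Dmult c d e (\<alpha> t, \<beta> t) (v, w)) t"
  using mult.has_velocity_compose[OF prod_chart_in_atlas[OF assms(1,2)] assms(3) has_velocity_Pair[OF assms(4,5)]]
    assms(6) by simp

lemma has_velocity_zero_mult:
  assumes "c \<in> \<A>" "d \<in> \<A>" "e \<in> \<A>" "has_velocity c \<alpha> 0 t" "has_velocity d \<beta> 0 t" "\<alpha> t \<otimes> \<beta> t \<in> cdom e"
  shows "has_velocity e (\<lambda>s. \<alpha> s \<otimes> \<beta> s) 0 t"
  using mult.has_velocity_zero_compose[OF prod_chart_in_atlas[OF assms(1,2)] assms(3), of "\<lambda>s. (\<alpha> s, \<beta> s)" t]
    has_velocity_Pair[OF assms(4,5)] assms(6) by (simp add: zero_prod_def)

lemma mult_inv_cancel [simp]: "a \<otimes> (inv a \<otimes> b) = b" "inv a \<otimes> (a \<otimes> b) = b" "a \<otimes> b \<otimes> inv b = a" "a \<otimes> inv b \<otimes> b = a"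
  by (simp_all add: m_assoc flip: m_assoc[of a "inv a" b] m_assoc[of "inv a" a b])

definition log_velocity :: "(real \<Rightarrow> 'h) \<Rightarrow> 'e \<Rightarrow> real \<Rightarrow> bool" where
  "log_velocity \<gamma> v t \<longleftrightarrow> has_velocity \<kappa> (\<lambda>s. inv (\<gamma> t) \<otimes> \<gamma> (t + s)) v 0"

text \<open>The curve \<open>\<alpha> inv \<beta>\<close> has velocity zero, so curves with equal logarithmic velocity differ by a left
  translation. This replaces the uniqueness theorem for ordinary differential equations.\<close>

lemma equal_log_velocity:
  assumes I: "open I" "connected I" and vel: "\<And>t. t \<in> I \<Longrightarrow> log_velocity \<alpha> (v t) t" "\<And>t. t \<in> I \<Longrightarrow> log_velocity \<beta> (v t) t"
    and st: "s \<in> I" "t \<in> I"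
  shows "\<alpha> s \<otimes> inv (\<beta> s) = \<alpha> t \<otimes> inv (\<beta> t)"
proof (rule zero_velocity_imp_constant[OF manifold I _ st, of "\<lambda>t. \<alpha> t \<otimes> inv (\<beta> t)"])
  fix t assume t: "t \<in> I"
  define a b where "a = (\<lambda>s. inv (\<alpha> t) \<otimes> \<alpha> (t + s))" and "b = (\<lambda>s. inv (\<beta> t) \<otimes> \<beta> (t + s))"
  have ab: "has_velocity \<kappa> a (v t) 0" "has_velocity \<kappa> b (v t) 0"
    using vel[OF t] by (simp_all add: log_velocity_def a_def b_def)
  have ab0: "a 0 = \<one>" "b 0 = \<one>" by (simp_all add: a_def b_def)
  obtain w where w: "has_velocity \<kappa> (\<lambda>s. inv (b s)) w 0"
    using inverse.has_velocity_compose[OF \<kappa> \<kappa> ab(2)] ab0 one_\<kappa> by auto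
  have "has_velocity \<kappa> (\<lambda>s. a s \<otimes> inv (b s))
      (Dmult \<kappa> \<kappa> \<kappa> (\<one>, \<one>) (v t, w)) 0"
    using has_velocity_mult[OF \<kappa> \<kappa> \<kappa> ab(1) w] ab0 one_\<kappa> by simp
  moreover have "has_velocity \<kappa> (\<lambda>s. b s \<otimes> inv (b s))
      (Dmult \<kappa> \<kappa> \<kappa> (\<one>, \<one>) (v t, w)) 0"
    using has_velocity_mult[OF \<kappa> \<kappa> \<kappa> ab(2) w] ab0 one_\<kappa> by simp
  then have "Dmult \<kappa> \<kappa> \<kappa> (\<one>, \<one>) (v t, w) = 0"
    by (intro has_velocity_unique[OF _ has_velocity_const[OF one_\<kappa>, of 0]]) (simp add: r_inv)
  ultimately have z: "has_velocity \<kappa> (\<lambda>s. a s \<otimes> inv (b s)) 0 0" by simp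
  obtain c d e where c: "c \<in> \<A>" "\<alpha> t \<in> cdom c" and d: "d \<in> \<A>" "inv (\<beta> t) \<in> cdom d"
    and e: "e \<in> \<A>" "\<alpha> t \<otimes> inv (\<beta> t) \<in> cdom e"
    using chart_at by metis
  have "has_velocity c (\<lambda>s. \<alpha> t \<otimes> (a s \<otimes> inv (b s))) 0 0"
    by (rule has_velocity_zero_mult[OF c(1) \<kappa> c(1) has_velocity_const[OF c(2)] z]) (simp add: ab0 c)
  then have "has_velocity e (\<lambda>s. \<alpha> t \<otimes> (a s \<otimes> inv (b s)) \<otimes> inv (\<beta> t)) 0 0"
    by (rule has_velocity_zero_mult[OF c(1) d(1) e(1) _ has_velocity_const[OF d(2)]]) (simp add: ab0 e)
  moreover have "\<alpha> t \<otimes> (a s \<otimes> inv (b s)) \<otimes> inv (\<beta> t) = \<alpha> (t + s) \<otimes> inv (\<beta> (t + s))" for s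
    by (simp add: a_def b_def inv_mult_group m_assoc)
  ultimately have "has_velocity e (\<lambda>s. \<alpha> (t + s) \<otimes> inv (\<beta> (t + s))) 0 0" by simp
  then have "has_velocity e (\<lambda>s. \<alpha> s \<otimes> inv (\<beta> s)) 0 t"
    using has_velocity_shift[of e "\<lambda>s. \<alpha> s \<otimes> inv (\<beta> s)" t 0 0] by simp
  then show "\<exists>c\<in>\<A>. has_velocity c (\<lambda>t. \<alpha> t \<otimes> inv (\<beta> t)) 0 t" using e(1) by blast
qed

lemma one_parameter_subgroup_0: "one_parameter_subgroup H \<gamma> \<Longrightarrow> \<gamma> 0 = \<one>"
  unfolding one_parameter_subgroup_def using l_cancel_one[of "\<gamma> 0" "\<gamma> 0"] by (metis UNIV_I add_0 carrier_UNIV)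

lemma one_parameter_subgroup_log_velocity:
  assumes "one_parameter_subgroup H \<gamma>" "has_velocity \<kappa> \<gamma> v 0"
  shows "log_velocity \<gamma> v t"
  using assms by (simp add: log_velocity_def one_parameter_subgroup_def)

lemma one_parameter_subgroup_unique:
  assumes "one_parameter_subgroup H \<alpha>" "has_velocity \<kappa> \<alpha> v 0"
    and "one_parameter_subgroup H \<beta>" "has_velocity \<kappa> \<beta> v 0"
  shows "\<alpha> = \<beta>"
proof
  fix t
  have "\<alpha> t \<otimes> inv (\<beta> t) = \<alpha> 0 \<otimes> inv (\<beta> 0)"
    by (rule equal_log_velocity[of UNIV _ "\<lambda>_. v"]) (auto intro: one_parameter_subgroup_log_velocity assms)
  then have "\<alpha> t \<otimes> inv (\<beta> t) = \<one>" 
    using one_parameter_subgroup_0[OF assms(1)] one_parameter_subgroup_0[OF assms(3)] by simp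
  then show "\<alpha> t = \<beta> t" by (metis UNIV_I carrier_UNIV inv_equality inv_inv)
qed

lemma local_integral_curve:
  obtains \<delta> \<gamma> where "\<delta> > 0" "\<gamma> 0 = \<one>" "\<And>t. \<bar>t\<bar> < \<delta> \<Longrightarrow> log_velocity \<gamma> v t"
    "\<And>t. \<bar>t\<bar> < \<delta> \<Longrightarrow> isCont \<gamma> t" "has_velocity \<kappa> \<gamma> v 0"
proof -
  define M where "M = local_rep (prod_chart \<kappa> \<kappa>) \<kappa> (\<lambda>(g, h). g \<otimes> h)"
  define S where "S = coord (prod_chart \<kappa> \<kappa>) ` (cdom (prod_chart \<kappa> \<kappa>) \<inter> (\<lambda>(g, h). g \<otimes> h) -` cdom \<kappa>)"
  define e where "e = coord \<kappa> \<one>"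
  define Y where "Y = (\<lambda>p. frechet_derivative M (at p) (0, v))"
  note pc = prod_chart_in_atlas[OF \<kappa> \<kappa>]
  have S: "open S" unfolding S_def by (rule mult.open_domain[OF pc \<kappa>])
  have eS: "(e, e) \<in> S" using one_\<kappa> by (force simp: S_def e_def)
  have "smooth_on S Y"
    unfolding Y_def
    by (rule smooth_on_frechet_derivative[OF _ S]) (use mult.smooth_local_rep[OF pc \<kappa>] in \<open>simp add: M_def S_def\<close>)
  then obtain r L where r: "r > 0" "cball (e, e) r \<subseteq> S" and L: "L > 0"
    and lip: "\<And>p q. \<lbrakk>p \<in> cball (e, e) r; q \<in> cball (e, e) r\<rbrakk> \<Longrightarrow> norm (Y p - Y q) \<le> L * norm (p - q)"
    using smooth_on_imp_lipschitz[OF _ S eS] by metis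
  have sub: "(y, e) \<in> cball (e, e) r" if "y \<in> cball e r" for y
    using that by (simp add: dist_Pair_Pair)
  obtain \<delta> y where \<delta>: "\<delta> > 0" and y0: "y 0 = e" and yb: "\<And>t. y t \<in> cball e r"
    and yd: "\<And>t. \<bar>t\<bar> < \<delta> \<Longrightarrow> (y has_vector_derivative Y (y t, e)) (at t)"
  proof (rule Picard_Lindelof[OF r(1) L, of e "\<lambda>y. Y (y, e)"])
    show "norm (Y (y, e) - Y (z, e)) \<le> L * norm (y - z)" if "y \<in> cball e r" "z \<in> cball e r" for y z
      using lip[OF sub[OF that(1)] sub[OF that(2)]] by (simp add: norm_Pair)
  qed (rule that)
  have yS: "(y t, e) \<in> S" for t using yb sub r(2) by blast
  have ychart: "y t \<in> coord \<kappa> ` cdom \<kappa>" for t using yS[of t] by (auto simp: S_def)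
  note ch = is_chartD[OF chart_\<A>[OF \<kappa>]]
  define \<gamma> where "\<gamma> = (\<lambda>t. cinv \<kappa> (y t))"
  have \<gamma>c: "\<gamma> t \<in> cdom \<kappa>" "coord \<kappa> (\<gamma> t) = y t" for t
    using ch(6,7)[OF ychart] by (auto simp: \<gamma>_def)
  have \<gamma>0: "\<gamma> 0 = \<one>" using ch(5)[OF one_\<kappa>] by (simp add: \<gamma>_def y0 e_def)
  have cont: "isCont \<gamma> t" if "\<bar>t\<bar> < \<delta>" for t
    unfolding \<gamma>_def
  proof (rule isCont_o2[where f=y and g="cinv \<kappa>"])
    show "isCont y t" using yd[OF that] has_vector_derivative_continuous by blast
    show "isCont (cinv \<kappa>) (y t)" using ch(2,4) ychart continuous_on_eq_continuous_at by blast
  qed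
  have vel: "has_velocity \<kappa> \<gamma> (Y (y t, e)) t" if "\<bar>t\<bar> < \<delta>" for t
    using \<gamma>c cont[OF that] yd[OF that] by (simp add: has_velocity_def)
  have "log_velocity \<gamma> v t" if t: "\<bar>t\<bar> < \<delta>" for t
  proof -
    define \<epsilon> where "\<epsilon> = (\<lambda>s. cinv \<kappa> (e + s *\<^sub>R v))"
    have \<epsilon>: "has_velocity \<kappa> \<epsilon> v 0" "\<epsilon> 0 = \<one>"
      unfolding \<epsilon>_def using has_velocity_line[OF chart_\<A>[OF \<kappa>]] one_\<kappa> ch(5)[OF one_\<kappa>] by (auto simp: e_def)
    have "has_velocity \<kappa> (\<lambda>s. \<gamma> t \<otimes> \<epsilon> s) (Dmult \<kappa> \<kappa> \<kappa> (\<gamma> t, \<one>) (0, v)) 0"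
      using has_velocity_mult[OF \<kappa> \<kappa> \<kappa> has_velocity_const[OF \<gamma>c(1)] \<epsilon>(1)] \<epsilon>(2) \<gamma>c by simp
    then have 1: "has_velocity \<kappa> (\<lambda>s. \<gamma> t \<otimes> \<epsilon> s) (Y (y t, e)) 0"
      by (simp add: tangent_map_def Y_def M_def \<gamma>c e_def)
    have 2: "has_velocity \<kappa> (\<lambda>s. \<gamma> (t + s)) (Y (y t, e)) 0"
      using has_velocity_shift[of \<kappa> \<gamma> t _ 0] vel[OF t] by simp
    obtain c where c: "c \<in> \<A>" "inv (\<gamma> t) \<in> cdom c" using chart_at by blast
    obtain u where "has_velocity \<kappa> (\<lambda>s. inv (\<gamma> t) \<otimes> (\<gamma> t \<otimes> \<epsilon> s)) u 0"
      "has_velocity \<kappa> (\<lambda>s. inv (\<gamma> t) \<otimes> \<gamma> (t + s)) u 0"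
      using has_velocity_mult[OF c(1) \<kappa> \<kappa> has_velocity_const[OF c(2)] 1]
        has_velocity_mult[OF c(1) \<kappa> \<kappa> has_velocity_const[OF c(2)] 2] one_\<kappa> \<epsilon>(2) by auto
    then show ?thesis unfolding log_velocity_def using has_velocity_unique[OF \<epsilon>(1)] by simp
  qed
  moreover from this[of 0] \<delta> have "has_velocity \<kappa> \<gamma> v 0" by (simp add: log_velocity_def \<gamma>0)
  ultimately show ?thesis using that[of \<delta> \<gamma>, OF \<delta> \<gamma>0] cont by blast
qed

lemma one_parameter_subgroup_exists:
  obtains \<gamma> where "one_parameter_subgroup H \<gamma>" "has_velocity \<kappa> \<gamma> v 0"
proof -
  obtain \<delta> \<phi> where \<delta>: "\<delta> > 0" and \<phi>0: "\<phi> 0 = \<one>" and lv: "\<And>t. \<bar>t\<bar> < \<delta> \<Longrightarrow> log_velocity \<phi> v t"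
    and cont: "\<And>t. \<bar>t\<bar> < \<delta> \<Longrightarrow> isCont \<phi> t" and vel: "has_velocity \<kappa> \<phi> v 0"
    using local_integral_curve[of v] by metis
  define \<rho> where "\<rho> = \<delta> / 2"
  have \<rho>: "\<rho> > 0" using \<delta> by (simp add: \<rho>_def)
  have hom: "\<phi> (s + t) = \<phi> s \<otimes> \<phi> t" if s: "\<bar>s\<bar> < \<rho>" and t: "\<bar>t\<bar> < \<rho>" for s t
  proof -
    have "\<phi> (s + t) \<otimes> inv (\<phi> s \<otimes> \<phi> t) = \<phi> (s + 0) \<otimes> inv (\<phi> s \<otimes> \<phi> 0)"
    proof (rule equal_log_velocity[of "{-\<rho><..<\<rho>}" "\<lambda>t. \<phi> (s + t)" "\<lambda>_. v" "\<lambda>t. \<phi> s \<otimes> \<phi> t"])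
      fix t assume "t \<in> {-\<rho><..<\<rho>}"
      then have "\<bar>s + t\<bar> < \<delta>" "\<bar>t\<bar> < \<delta>" using s by (auto simp: \<rho>_def)
      then show "log_velocity (\<lambda>t. \<phi> (s + t)) v t" "log_velocity (\<lambda>t. \<phi> s \<otimes> \<phi> t) v t"
        using lv[of "s + t"] lv[of t] by (simp_all add: log_velocity_def add.assoc inv_mult_group m_assoc)
    qed (use t \<rho> in auto)
    then have "\<phi> (s + t) \<otimes> inv (\<phi> s \<otimes> \<phi> t) = \<one>" by (simp add: \<phi>0)
    then show ?thesis by (metis UNIV_I carrier_UNIV inv_equality inv_inv)
  qed
  have pow: "\<phi> (real k * t) = \<phi> t [^] k" if "\<bar>real k * t\<bar> < \<rho>" for k t
    using that
  proof (induction k)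
    case (Suc k)
    have "\<bar>real k * t\<bar> \<le> \<bar>real (Suc k) * t\<bar>" "\<bar>t\<bar> \<le> \<bar>real (Suc k) * t\<bar>"
      by (auto simp: abs_mult mult_right_mono intro: mult_right_mono[of 1 "1 + real k" "\<bar>t\<bar>", simplified])
    then show ?case using Suc hom[of "real k * t" t] by (simp add: algebra_simps)
  qed (simp add: \<phi>0)
  define N where "N = (\<lambda>t. Suc (nat \<lceil>\<bar>t\<bar> / \<rho>\<rceil>))"
  have N: "\<bar>t / real (N t)\<bar> < \<rho>" for t
  proof -
    have "\<bar>t\<bar> / \<rho> < real (N t)" unfolding N_def using \<rho> by (simp add: less_Suc_eq_le) linarith
    then have "\<bar>t\<bar> < \<rho> * real (N t)" using \<rho> by (simp add: pos_divide_less_eq mult.commute)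
    moreover have "real (N t) > 0" by (simp add: N_def)
    ultimately show ?thesis by (simp add: abs_divide pos_divide_less_eq)
  qed
  have indep: "\<phi> (t / real m) [^] m = \<phi> (t / real n) [^] n"
    if "m > 0" "n > 0" "\<bar>t / real m\<bar> < \<rho>" "\<bar>t / real n\<bar> < \<rho>" for m n :: nat and t
  proof -
    have "\<phi> (t / real m) = \<phi> (t / real (m * n)) [^] n" "\<phi> (t / real n) = \<phi> (t / real (m * n)) [^] m"
      using pow[of n "t / real (m * n)"] pow[of m "t / real (m * n)"] that by simp_all
    then show ?thesis by (simp add: nat_pow_pow mult.commute)
  qed
  define \<gamma> where "\<gamma> = (\<lambda>t. \<phi> (t / real (N t)) [^] N t)"
  have \<gamma>: "\<gamma> t = \<phi> (t / real n) [^] n" if "n > 0" "\<bar>t / real n\<bar> < \<rho>" for t n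
    unfolding \<gamma>_def by (rule indep[OF _ that(1) N that(2)]) (simp add: N_def)
  have \<gamma>add: "\<gamma> (s + t) = \<gamma> s \<otimes> \<gamma> t" for s t
  proof -
    define n where "n = N s * N t * N (s + t)"
    have pos: "N u > 0" for u by (simp add: N_def)
    then have n: "n > 0" by (simp add: n_def)
    have small: "\<bar>u / real n\<bar> < \<rho>" if "N u \<le> n" for u
    proof -
      have "\<bar>u / real n\<bar> \<le> \<bar>u / real (N u)\<bar>" using that pos[of u] by (simp add: frac_le)
      then show ?thesis using N[of u] by linarith
    qed
    have le: "N s \<le> n" "N t \<le> n" "N (s + t) \<le> n" using pos[of s] pos[of t] pos[of "s + t"] by (simp_all add: n_def)
    note sm = small[OF le(1)] small[OF le(2)] small[OF le(3)]
    have 1: "\<phi> ((s + t) / real n) = \<phi> (s / real n) \<otimes> \<phi> (t / real n)"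
      using hom[OF sm(1,2)] by (simp add: add_divide_distrib)
    have comm: "\<phi> (s / real n) \<otimes> \<phi> (t / real n) = \<phi> (t / real n) \<otimes> \<phi> (s / real n)"
      using hom[OF sm(1,2)] hom[OF sm(2,1)] by (simp add: add.commute)
    show ?thesis
      unfolding \<gamma>[OF n sm(1)] \<gamma>[OF n sm(2)] \<gamma>[OF n sm(3)] 1
      by (rule pow_mult_distrib[OF comm]) simp_all
  qed
  have local: "\<gamma> t = \<phi> t" if "\<bar>t\<bar> < \<rho>" for t using \<gamma>[of 1 t] that by simp
  have ev: "eventually (\<lambda>t. \<phi> t = \<gamma> t) (nhds 0)"
    using eventually_nhds_in_open[of "{-\<rho><..<\<rho>}" 0] \<rho> by (auto elim!: eventually_mono simp: local)
  have v: "has_velocity \<kappa> \<gamma> v 0" by (rule has_velocity_cong[OF vel ev])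
  have "isCont \<gamma> t" for t
  proof -
    have "isCont \<gamma> 0" using v by (simp add: has_velocity_def)
    then have "isCont (\<lambda>s. \<gamma> (- t + s)) t" using isCont_o2[where f="\<lambda>s. - t + s" and a=t and g=\<gamma>] by simp
    then have "isCont (\<lambda>s. (\<gamma> t, \<gamma> (- t + s))) t" by (intro isCont_Pair) auto
    moreover have "isCont (\<lambda>(g, h). g \<otimes> h) z" for z
      using mult.continuous_f[of UNIV] by (cases z) (simp add: continuous_on_eq_continuous_at)
    ultimately have "isCont (\<lambda>s. (\<lambda>(g, h). g \<otimes> h) (\<gamma> t, \<gamma> (- t + s))) t" by (rule isCont_o2)
    moreover have "(\<lambda>(g, h). g \<otimes> h) (\<gamma> t, \<gamma> (- t + s)) = \<gamma> s" for s
      using \<gamma>add[of t "- t + s"] by simp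
    ultimately show ?thesis by simp
  qed
  then have "one_parameter_subgroup H \<gamma>"
    by (simp add: one_parameter_subgroup_def \<gamma>add continuous_at_imp_continuous_on)
  then show ?thesis using v that by blast
qed

lemma Lie_exp_eqI:
  assumes "one_parameter_subgroup H \<gamma>" "has_velocity \<kappa> \<gamma> v 0"
  shows "Exp (t *\<^sub>R v) = \<gamma> t"
proof -
  define \<beta> where "\<beta> = (\<lambda>s. \<gamma> (t * s))"
  have "continuous_on UNIV \<beta>"
    using assms(1) unfolding \<beta>_def one_parameter_subgroup_def
    by (auto intro!: continuous_on_compose2[of UNIV \<gamma>] continuous_intros)
  then have ops: "one_parameter_subgroup H \<beta>"
    using assms(1) by (simp add: one_parameter_subgroup_def \<beta>_def distrib_left)
  have vel: "has_velocity \<kappa> \<beta> (t *\<^sub>R v) 0"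
    unfolding \<beta>_def using has_velocity_scale[of \<kappa> \<gamma> v t 0] assms(2) by simp
  have "(THE \<gamma>. one_parameter_subgroup H \<gamma> \<and>
     ((\<lambda>s. coord \<kappa> (\<gamma> s)) has_vector_derivative t *\<^sub>R v) (at 0)) = \<beta>"
  proof (rule the_equality)
    fix \<gamma>' assume g: "one_parameter_subgroup H \<gamma>' \<and> ((\<lambda>s. coord \<kappa> (\<gamma>' s)) has_vector_derivative t *\<^sub>R v) (at 0)"
    then have "has_velocity \<kappa> \<gamma>' (t *\<^sub>R v) 0"
      using one_parameter_subgroup_0[of \<gamma>'] one_\<kappa>
      by (auto simp: has_velocity_def one_parameter_subgroup_def continuous_on_eq_continuous_at)
    then show "\<gamma>' = \<beta>" using one_parameter_subgroup_unique g ops vel by blast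
  qed (use ops vel in \<open>simp add: has_velocity_def\<close>)
  then show ?thesis by (simp add: Lie_exp_def \<beta>_def)
qed

lemma
  shows one_parameter_Lie_exp: "one_parameter_subgroup H (\<lambda>t. Exp (t *\<^sub>R v))"
    and has_velocity_Lie_exp: "has_velocity \<kappa> (\<lambda>t. Exp (t *\<^sub>R v)) v 0"
proof -
  obtain \<gamma> where \<gamma>: "one_parameter_subgroup H \<gamma>" "has_velocity \<kappa> \<gamma> v 0"
    using one_parameter_subgroup_exists by blast
  then have "(\<lambda>t. Exp (t *\<^sub>R v)) = \<gamma>" using Lie_exp_eqI by blast
  with \<gamma> show "one_parameter_subgroup H (\<lambda>t. Exp (t *\<^sub>R v))"
    "has_velocity \<kappa> (\<lambda>t. Exp (t *\<^sub>R v)) v 0" by simp_all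
qed

lemma Lie_exp_add: "Exp ((s + t) *\<^sub>R v) = Exp (s *\<^sub>R v) \<otimes> Exp (t *\<^sub>R v)"
  using one_parameter_Lie_exp[of v] by (simp add: one_parameter_subgroup_def)

lemma continuous_Lie_exp_ray: "continuous_on S (\<lambda>t. Exp (t *\<^sub>R v))"
  using one_parameter_Lie_exp[of v] continuous_on_subset by (auto simp: one_parameter_subgroup_def)

lemma Lie_exp_0 [simp]: "Exp 0 = \<one>"
  using one_parameter_subgroup_0[OF one_parameter_Lie_exp[of 0]] by simp

lemma inv_Lie_exp: "inv (Exp v) = Exp (- v)"
proof -
  have "Exp (- v) \<otimes> Exp v = \<one>" using Lie_exp_add[of "-1" 1 v] by simp
  then show ?thesis by (intro inv_equality) auto
qed

lemma
  shows has_velocity_conjugate: "has_velocity \<kappa> (\<lambda>t. g \<otimes> Exp (t *\<^sub>R v) \<otimes> inv g) (Adj g v) 0"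
    and Lie_exp_Ad: "Exp (t *\<^sub>R Adj g v) = g \<otimes> Exp (t *\<^sub>R v) \<otimes> inv g"
proof -
  let ?\<gamma> = "\<lambda>t. g \<otimes> Exp (t *\<^sub>R v) \<otimes> inv g"
  obtain c d where c: "c \<in> \<A>" "g \<in> cdom c" and d: "d \<in> \<A>" "inv g \<in> cdom d" using chart_at by metis
  obtain u where "has_velocity c (\<lambda>t. g \<otimes> Exp (t *\<^sub>R v)) u 0"
    using has_velocity_mult[OF c(1) \<kappa> c(1) has_velocity_const[OF c(2)] has_velocity_Lie_exp] c(2) by auto
  then obtain w where w: "has_velocity \<kappa> ?\<gamma> w 0"
    using has_velocity_mult[OF c(1) d(1) \<kappa> _ has_velocity_const[OF d(2)]] one_\<kappa> by fastforce
  then have "Adj g v = w" by (simp add: Ad_def has_velocity_def vector_derivative_at)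
  with w show vel: "has_velocity \<kappa> ?\<gamma> (Adj g v) 0" by simp
  have "one_parameter_subgroup H ?\<gamma>"
    unfolding one_parameter_subgroup_def
    by (auto intro!: continuous_on_mult continuous_Lie_exp_ray simp: Lie_exp_add m_assoc)
  then show "Exp (t *\<^sub>R Adj g v) = ?\<gamma> t" using Lie_exp_eqI vel by blast
qed

lemma Ad_eqI:
  assumes "has_velocity \<kappa> (\<lambda>t. g \<otimes> Exp (t *\<^sub>R v) \<otimes> inv g) w 0"
  shows "Adj g v = w"
  using has_velocity_unique[OF has_velocity_conjugate assms] .

lemma Ad_mult: "Adj (g \<otimes> h) v = Adj g (Adj h v)"
  by (rule Ad_eqI)
    (use has_velocity_conjugate[of g "Adj h v"] in \<open>simp add: Lie_exp_Ad m_assoc inv_mult_group\<close>)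

lemma Ad_one: "Adj \<one> v = v"
  by (rule Ad_eqI) (use has_velocity_Lie_exp in simp)

lemma Ad_tangent_map:
  assumes "c \<in> \<A>" "g \<in> cdom c" "d \<in> \<A>" "inv g \<in> cdom d"
  shows "Adj g v = Dmult c d \<kappa> (g, inv g)
    (Dmult c \<kappa> c (g, \<one>) (0, v), 0)"
proof (rule Ad_eqI)
  have "has_velocity c (\<lambda>t. g \<otimes> Exp (t *\<^sub>R v))
      (Dmult c \<kappa> c (g, \<one>) (0, v)) 0"
    using has_velocity_mult[OF assms(1) \<kappa> assms(1) has_velocity_const[OF assms(2)] has_velocity_Lie_exp[of v]]
      assms(2) by simp
  from has_velocity_mult[OF assms(1) assms(3) \<kappa> this has_velocity_const[OF assms(4)]] one_\<kappa>
  show "has_velocity \<kappa> (\<lambda>t. g \<otimes> Exp (t *\<^sub>R v) \<otimes> inv g)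
    (Dmult c d \<kappa> (g, inv g)
    (Dmult c \<kappa> c (g, \<one>) (0, v), 0)) 0"
    by simp
qed

lemma linear_Ad: "linear (Adj g)"
proof -
  obtain c d where c: "c \<in> \<A>" "g \<in> cdom c" and d: "d \<in> \<A>" "inv g \<in> cdom d" using chart_at by metis
  have 1: "linear (Dmult c \<kappa> c (g, \<one>))"
    by (rule mult.linear_tangent_map[OF prod_chart_in_atlas[OF c(1) \<kappa>] c(1)]) (use c one_\<kappa> in auto)
  have 2: "linear (Dmult c d \<kappa> (g, inv g))"
    by (rule mult.linear_tangent_map[OF prod_chart_in_atlas[OF c(1) d(1)] \<kappa>]) (use c d one_\<kappa> in auto)
  have "linear (\<lambda>v. Dmult c d \<kappa> (g, inv g)
    (Dmult c \<kappa> c (g, \<one>) (0, v), 0))"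
  proof (rule linearI)
    fix v w :: 'e and r :: real
    have a: "(0, v + w) = (0 :: 'e, v) + (0, w)" "(0, r *\<^sub>R v) = r *\<^sub>R (0 :: 'e, v)"
      and b: "(x + y, 0) = (x, 0 :: 'e) + (y, 0)" "(r *\<^sub>R x, 0) = r *\<^sub>R (x, 0 :: 'e)" for x y :: 'e
      by simp_all
    show "Dmult c d \<kappa> (g, inv g)
        (Dmult c \<kappa> c (g, \<one>) (0, v + w), 0)
      = Dmult c d \<kappa> (g, inv g)
        (Dmult c \<kappa> c (g, \<one>) (0, v), 0)
      + Dmult c d \<kappa> (g, inv g)
        (Dmult c \<kappa> c (g, \<one>) (0, w), 0)"
      unfolding a(1) linear_add[OF 1] b(1) linear_add[OF 2] ..
    show "Dmult c d \<kappa> (g, inv g)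
        (Dmult c \<kappa> c (g, \<one>) (0, r *\<^sub>R v), 0)
      = r *\<^sub>R Dmult c d \<kappa> (g, inv g)
        (Dmult c \<kappa> c (g, \<one>) (0, v), 0)"
      unfolding a(2) linear_cmul[OF 1] b(2) linear_cmul[OF 2] ..
  qed
  then show ?thesis using Ad_tangent_map[OF c d] by presburger
qed

lemma has_vector_derivative_Ad_Lie_exp:
  "((\<lambda>s. Adj (Exp (s *\<^sub>R v)) w) has_vector_derivative bracket v w) (at 0)"
proof -
  define M where "M = local_rep (prod_chart \<kappa> \<kappa>) \<kappa> (\<lambda>(g, h). g \<otimes> h)"
  define S where "S = coord (prod_chart \<kappa> \<kappa>) ` (cdom (prod_chart \<kappa> \<kappa>) \<inter> (\<lambda>(g, h). g \<otimes> h) -` cdom \<kappa>)"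
  define e where "e = coord \<kappa> \<one>"
  define D where "D = (\<lambda>p. frechet_derivative M (at p))"
  define k where "k = (\<lambda>s. coord \<kappa> (Exp (s *\<^sub>R v)))"
  define k' where "k' = (\<lambda>s. coord \<kappa> (inv (Exp (s *\<^sub>R v))))"
  note pc = prod_chart_in_atlas[OF \<kappa> \<kappa>]
  have S: "open S" unfolding S_def by (rule mult.open_domain[OF pc \<kappa>])
  have M: "smooth_on S M" using mult.smooth_local_rep[OF pc \<kappa>] by (simp add: M_def S_def)
  have eS: "(e, e) \<in> S" using one_\<kappa> by (force simp: S_def e_def)
  have lin: "linear (D p)" if "p \<in> S" for p unfolding D_def by (rule linear_frechet[OF M that])
  have der: "((\<lambda>p. D p u) has_derivative frechet_derivative (\<lambda>p. D p u) (at p)) (at p)" if "p \<in> S" for p u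
    unfolding D_def by (rule smooth_on_has_derivative[OF smooth_on_frechet_derivative[OF M S] that])
  obtain k1 where k: "(k has_vector_derivative k1) (at 0)"
    using has_velocity_Lie_exp[of v] by (auto simp: k_def has_velocity_def)
  have "\<exists>u. has_velocity \<kappa> (\<lambda>s. inv (Exp (s *\<^sub>R v))) u 0"
    using inverse.has_velocity_compose[OF \<kappa> \<kappa> has_velocity_Lie_exp[of v]] one_\<kappa> by auto
  then obtain k2 where k': "(k' has_vector_derivative k2) (at 0)" and
    inv\<kappa>: "isCont (\<lambda>s. inv (Exp (s *\<^sub>R v))) 0"
    by (auto simp: k'_def has_velocity_def)
  have k0: "k 0 = e" "k' 0 = e" by (simp_all add: k_def k'_def e_def)
  obtain T' where T': "((\<lambda>s. D (k s, e) (0, w)) has_vector_derivative T') (at 0)"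
  proof -
    have "((\<lambda>s. D (k s, e) (0, w)) has_vector_derivative
        frechet_derivative (\<lambda>p. D p (0, w)) (at (e, e)) (k1, 0) + D (k 0, e) (0, 0)) (at 0)"
      by (rule has_vector_derivative_linear_family[where S=S and D=D and \<gamma>="\<lambda>s. (k s, e)" and \<delta>="\<lambda>s. (0, w)" and t=0
            and E="\<lambda>u. frechet_derivative (\<lambda>p. D p u) (at (e, e))"])
        (use S eS lin der k0 in \<open>auto intro!: has_vector_derivative_Pair k\<close>)
    then show ?thesis using that by blast
  qed
  obtain R where R: "((\<lambda>s. D (k s, k' s) (D (k s, e) (0, w), 0)) has_vector_derivative R) (at 0)"
  proof -
    have "((\<lambda>s. D (k s, k' s) (D (k s, e) (0, w), 0)) has_vector_derivative
        frechet_derivative (\<lambda>p. D p (D (k 0, e) (0, w), 0)) (at (e, e)) (k1, k2) + D (k 0, k' 0) (T', 0)) (at 0)"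
      by (rule has_vector_derivative_linear_family[where S=S and D=D and \<gamma>="\<lambda>s. (k s, k' s)"
            and \<delta>="\<lambda>s. (D (k s, e) (0, w), 0)" and t=0 and E="\<lambda>u. frechet_derivative (\<lambda>p. D p u) (at (e, e))"])
        (use S eS lin der k0 T' in \<open>auto intro!: has_vector_derivative_Pair k k'\<close>)
    then show ?thesis using that by blast
  qed
  have "isCont (\<lambda>s. Exp (s *\<^sub>R v)) 0" using has_velocity_Lie_exp[of v] by (simp add: has_velocity_def)
  then have "eventually (\<lambda>s. Exp (s *\<^sub>R v) \<in> cdom \<kappa>) (at 0)"
    "eventually (\<lambda>s. inv (Exp (s *\<^sub>R v)) \<in> cdom \<kappa>) (at 0)"
    using inv\<kappa> one_\<kappa> is_chartD(1)[OF chart_\<A>[OF \<kappa>]] by (auto simp: isCont_def topological_tendstoD)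
  then have "eventually (\<lambda>s. Exp (s *\<^sub>R v) \<in> cdom \<kappa> \<and> inv (Exp (s *\<^sub>R v)) \<in> cdom \<kappa>) (nhds 0)"
    using one_\<kappa> by (simp add: eventually_nhds_conv_at eventually_conj)
  then have ev: "eventually (\<lambda>s. s \<in> UNIV \<longrightarrow>
      D (k s, k' s) (D (k s, e) (0, w), 0) = Adj (Exp (s *\<^sub>R v)) w) (nhds 0)"
    by eventually_elim (simp add: Ad_tangent_map[OF \<kappa> _ \<kappa>] tangent_map_def D_def M_def k_def k'_def e_def)
  have "((\<lambda>s. Adj (Exp (s *\<^sub>R v)) w) has_vector_derivative R) (at 0)"
    using has_vector_derivative_cong_ev[OF ev] R eventually_nhds_x_imp_x[OF ev] by simp
  then show ?thesis by (simp add: Lie_bracket_def vector_derivative_at)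
qed

lemma Ad_Lie_exp_eq:
  assumes "bracket v w = 0"
  shows "Adj (Exp (s *\<^sub>R v)) w = w"
proof -
  let ?A = "\<lambda>s. Adj (Exp (s *\<^sub>R v))"
  have "((\<lambda>s. ?A s w) has_vector_derivative 0) (at s)" for s
  proof -
    have sh: "((\<lambda>t. t - s) has_vector_derivative 1) (at s)" by (auto intro!: derivative_eq_intros)
    have "((\<lambda>t. ?A (t - s) w) has_vector_derivative 0) (at s)"
      using vector_diff_chain_at[OF sh, of "\<lambda>s. ?A s w" 0] has_vector_derivative_Ad_Lie_exp[of v w] assms
      by (simp add: o_def)
    then have "((\<lambda>t. ?A s (?A (t - s) w)) has_vector_derivative ?A s 0) (at s)"
      by (rule bounded_linear.has_vector_derivative[OF linear_Ad[unfolded linear_conv_bounded_linear]])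
    moreover have "?A s (?A (t - s) w) = ?A t w" for t
      using Lie_exp_add[of s "t - s" v] by (simp flip: Ad_mult)
    ultimately show ?thesis using linear_0[OF linear_Ad] by simp
  qed
  then have "((\<lambda>s. ?A s w) has_derivative (\<lambda>h. 0)) (at s within UNIV)" for s
    by (simp add: has_vector_derivative_def)
  then have "?A s w = ?A 0 w"
    using has_derivative_zero_unique[of UNIV "\<lambda>s. ?A s w" s 0] by auto
  then show ?thesis by (simp add: Ad_one)
qed

lemma Lie_exp_commute:
  assumes "bracket v w = 0"
  shows "Exp (s *\<^sub>R v) \<otimes> Exp (t *\<^sub>R w) = Exp (t *\<^sub>R w) \<otimes> Exp (s *\<^sub>R v)"
proof -
  have "Exp (t *\<^sub>R w) = Exp (s *\<^sub>R v) \<otimes> Exp (t *\<^sub>R w) \<otimes> inv (Exp (s *\<^sub>R v))"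
    using Lie_exp_Ad[of t "Exp (s *\<^sub>R v)" w] Ad_Lie_exp_eq[OF assms, of s] by simp
  then show ?thesis by (metis mult_inv_cancel(4))
qed

lemma Lie_exp_add_commuting:
  assumes "bracket v w = 0"
  shows "Exp (v + w) = Exp v \<otimes> Exp w"
proof -
  let ?\<gamma> = "\<lambda>t. Exp (t *\<^sub>R v) \<otimes> Exp (t *\<^sub>R w)"
  let ?T = "Dmult \<kappa> \<kappa> \<kappa> (\<one>, \<one>)"
  have add: "?\<gamma> (s + t) = ?\<gamma> s \<otimes> ?\<gamma> t" for s t
  proof -
    have "?\<gamma> s \<otimes> ?\<gamma> t = Exp (s *\<^sub>R v) \<otimes> (Exp (s *\<^sub>R w) \<otimes> Exp (t *\<^sub>R v)) \<otimes> Exp (t *\<^sub>R w)"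
      by (simp add: m_assoc)
    also have "\<dots> = Exp (s *\<^sub>R v) \<otimes> (Exp (t *\<^sub>R v) \<otimes> Exp (s *\<^sub>R w)) \<otimes> Exp (t *\<^sub>R w)"
      by (simp add: Lie_exp_commute[OF assms])
    finally show ?thesis by (simp add: Lie_exp_add m_assoc)
  qed
  have "one_parameter_subgroup H ?\<gamma>"
    unfolding one_parameter_subgroup_def
    by (intro conjI allI add) (auto intro!: continuous_on_mult continuous_Lie_exp_ray)
  moreover have "has_velocity \<kappa> ?\<gamma> (v + w) 0"
  proof -
    have T: "linear ?T"
      by (rule mult.linear_tangent_map[OF prod_chart_in_atlas[OF \<kappa> \<kappa>] \<kappa>]) (use one_\<kappa> in auto)
    have "has_velocity \<kappa> (\<lambda>t. Exp (t *\<^sub>R v) \<otimes> \<one>) (?T (v, 0)) 0"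
      using has_velocity_mult[OF \<kappa> \<kappa> \<kappa> has_velocity_Lie_exp[of v] has_velocity_const[OF one_\<kappa>]] one_\<kappa> by simp
    then have 1: "?T (v, 0) = v"
      by (intro has_velocity_unique[OF _ has_velocity_Lie_exp[of v]]) simp
    have "has_velocity \<kappa> (\<lambda>t. \<one> \<otimes> Exp (t *\<^sub>R w)) (?T (0, w)) 0"
      using has_velocity_mult[OF \<kappa> \<kappa> \<kappa> has_velocity_const[OF one_\<kappa>] has_velocity_Lie_exp[of w]] one_\<kappa> by simp
    then have 2: "?T (0, w) = w"
      by (intro has_velocity_unique[OF _ has_velocity_Lie_exp[of w]]) simp
    have "?T (v, w) = v + w" using linear_add[OF T, of "(v, 0)" "(0, w)"] 1 2 by simp
    then show ?thesis
      using has_velocity_mult[OF \<kappa> \<kappa> \<kappa> has_velocity_Lie_exp[of v] has_velocity_Lie_exp[of w]] one_\<kappa> by simp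
  qed
  ultimately show ?thesis using Lie_exp_eqI[of ?\<gamma> "v + w" 1] by simp
qed

end

section \<open>Hamiltonian actions\<close>

locale lie_group_action = lie_group H \<A> J \<kappa>
  for H :: "('h::{t2_space,second_countable_topology}) monoid" (structure)
    and \<A> :: "('h, 'e::euclidean_space) chart set" and J :: "'e \<Rightarrow> 'e" and \<kappa> :: "('h, 'e) chart" +
  fixes \<B> :: "('z::{t2_space,second_countable_topology}, 'f::euclidean_space) chart set"
    and J' :: "'f \<Rightarrow> 'f" and act :: "'h \<Rightarrow> 'z \<Rightarrow> 'z"
  assumes manifold_\<B>: "complex_manifold \<B> J'"
    and action: "holomorphic_action H \<A> J \<B> J' act"
begin

lemmas chart_\<B> = complex_manifoldD(1)[OF manifold_\<B>]
  and chart_\<B>_at = complex_manifoldD(2)[OF manifold_\<B>]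

lemma act_mult: "act (g \<otimes> h) z = act g (act h z)"
  using action group_action.composition_rule[of H UNIV act z g h]
  by (simp add: holomorphic_action_def)

lemma act_one [simp]: "act \<one> z = z"
  using action group_action.id_eq_one[of H UNIV act]
  by (auto simp: holomorphic_action_def fun_eq_iff)

sublocale act: holo_maps "prod_atlas \<A> \<B>" "map_prod J J'" \<B> J' "\<lambda>(h, z). act h z"
proof
  show "holo_map (prod_atlas \<A> \<B>) (map_prod J J') \<B> J' (\<lambda>(h, z). act h z)"
    using action by (simp add: holomorphic_action_def)
  show "is_chart c" if "c \<in> prod_atlas \<A> \<B>" for c
    using that is_chart_prod chart_\<A> chart_\<B> by (auto simp: prod_atlas_def prod_chart_def)
qed (rule chart_\<B>)

abbreviation "Dact a c d \<equiv> tangent_map (prod_chart a c) d (\<lambda>(h, z). act h z)"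

lemma continuous_on_act:
  "continuous_on S f \<Longrightarrow> continuous_on S g \<Longrightarrow> continuous_on S (\<lambda>x. act (f x) (g x))"
  using continuous_on_compose2[OF act.continuous_f[of UNIV] continuous_on_Pair, of S f g] by simp

lemma has_velocity_act:
  assumes "c \<in> \<A>" "d \<in> \<B>" "e \<in> \<B>" "has_velocity c \<alpha> v t" "has_velocity d \<gamma> w t" "act (\<alpha> t) (\<gamma> t) \<in> cdom e"
  shows "has_velocity e (\<lambda>s. act (\<alpha> s) (\<gamma> s))
    (Dact c d e (\<alpha> t, \<gamma> t) (v, w)) t"
  using act.has_velocity_compose[OF prod_chart_in_atlas[OF assms(1,2)] assms(3) has_velocity_Pair[OF assms(4,5)]]
    assms(6) by simp

lemma has_velocity_zero_act:
  assumes "c \<in> \<A>" "d \<in> \<B>" "e \<in> \<B>" "has_velocity c \<alpha> 0 t" "has_velocity d \<gamma> 0 t" "act (\<alpha> t) (\<gamma> t) \<in> cdom e"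
  shows "has_velocity e (\<lambda>s. act (\<alpha> s) (\<gamma> s)) 0 t"
  using act.has_velocity_zero_compose[OF prod_chart_in_atlas[OF assms(1,2)] assms(3), of "\<lambda>s. (\<alpha> s, \<gamma> s)" t]
    has_velocity_Pair[OF assms(4,5)] assms(6) by (simp add: zero_prod_def)

abbreviation "flow \<beta> t z \<equiv> act (Exp (t *\<^sub>R \<beta>)) z"
abbreviation "field \<beta> c z \<equiv> fundamental_field H \<kappa> act \<beta> c z"

lemma flow_add: "flow \<beta> (s + t) z = flow \<beta> s (flow \<beta> t z)"
  by (simp add: Lie_exp_add act_mult)

lemma has_velocity_flow_0:
  assumes "c \<in> \<B>" "z \<in> cdom c"
  shows "has_velocity c (\<lambda>t. flow \<beta> t z) (field \<beta> c z) 0"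
    and fundamental_field_eq: "field \<beta> c z = Dact \<kappa> c c (\<one>, z) (\<beta>, 0)"
proof -
  have 1: "has_velocity c (\<lambda>t. flow \<beta> t z) (Dact \<kappa> c c (\<one>, z) (\<beta>, 0)) 0"
    using has_velocity_act[OF \<kappa> assms(1,1) has_velocity_Lie_exp[of \<beta>] has_velocity_const[OF assms(2)]] assms(2) by simp
  then show "field \<beta> c z = Dact \<kappa> c c (\<one>, z) (\<beta>, 0)"
    by (simp add: fundamental_field_def has_velocity_def vector_derivative_at)
  with 1 show "has_velocity c (\<lambda>t. flow \<beta> t z) (field \<beta> c z) 0" by simp
qed

lemma has_velocity_flow:
  assumes "c \<in> \<B>" "flow \<beta> t z \<in> cdom c"
  shows "has_velocity c (\<lambda>t. flow \<beta> t z) (field \<beta> c (flow \<beta> t z)) t"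
  using has_velocity_flow_0[OF assms, of \<beta>] has_velocity_shift[of c "\<lambda>t. flow \<beta> t z" t _ 0]
  by (simp add: flow_add[symmetric] add.commute)

lemma fundamental_field_J:
  assumes "c \<in> \<B>" "z \<in> cdom c"
  shows "field (J \<beta>) c z = J' (field \<beta> c z)"
proof -
  have "J' 0 = 0" using complex_manifoldD(4)[OF manifold_\<B>] by (rule linear_0)
  then have "map_prod J J' (\<beta>, 0) = (J \<beta>, 0)" by simp
  then show ?thesis
    using act.tangent_map_J[OF prod_chart_in_atlas[OF \<kappa> assms(1)] assms(1), of "(\<one>, z)" "(\<beta>, 0)"] assms one_\<kappa>
    by (simp add: fundamental_field_eq)
qed

lemma linear_fundamental_field:
  assumes "c \<in> \<B>" "z \<in> cdom c"
  shows "linear (\<lambda>\<beta>. field \<beta> c z)"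
proof -
  let ?T = "Dact \<kappa> c c (\<one>, z)"
  have T: "linear ?T"
    by (rule act.linear_tangent_map[OF prod_chart_in_atlas[OF \<kappa> assms(1)] assms(1)]) (use assms one_\<kappa> in auto)
  have "?T (v + w, 0) = ?T (v, 0) + ?T (w, 0)" "?T (r *\<^sub>R v, 0) = r *\<^sub>R ?T (v, 0)" for v w r
    using linear_add[OF T, of "(v, 0)" "(w, 0)"] linear_cmul[OF T, of r "(v, 0)"] by simp_all
  then show ?thesis unfolding fundamental_field_eq[OF assms] by (intro linearI)
qed

lemma flow_fixed:
  assumes "c \<in> \<B>" "z \<in> cdom c" "field \<beta> c z = 0"
  shows "flow \<beta> t z = z"
proof -
  have "flow \<beta> t z = flow \<beta> 0 z"
  proof (rule zero_velocity_imp_constant[OF manifold_\<B>, of UNIV])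
    fix t
    obtain a where a: "a \<in> \<A>" "Exp (t *\<^sub>R \<beta>) \<in> cdom a" using chart_at by blast
    obtain d where d: "d \<in> \<B>" "flow \<beta> t z \<in> cdom d" using chart_\<B>_at by blast
    have "has_velocity c (\<lambda>t. flow \<beta> t z) 0 0" using has_velocity_flow_0[OF assms(1,2), of \<beta>] assms(3) by simp
    then have "has_velocity d (\<lambda>s. flow \<beta> t (flow \<beta> s z)) 0 0"
      by (rule has_velocity_zero_act[OF a(1) assms(1) d(1) has_velocity_const[OF a(2)]]) (simp add: d)
    then have "has_velocity d (\<lambda>t. flow \<beta> t z) 0 t"
      using has_velocity_shift[of d "\<lambda>t. flow \<beta> t z" t 0 0] by (simp add: flow_add)
    then show "\<exists>d\<in>\<B>. has_velocity d (\<lambda>t. flow \<beta> t z) 0 t" using d(1) by blast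
  qed auto
  then show ?thesis by simp
qed

lemma field_eq_0_iff:
  assumes "c \<in> \<B>" "z \<in> cdom c"
  shows "field \<beta> c z = 0 \<longleftrightarrow> (\<forall>t. flow \<beta> t z = z)"
proof
  assume "\<forall>t. flow \<beta> t z = z"
  then have "has_velocity c (\<lambda>t. z) (field \<beta> c z) 0" using has_velocity_flow_0[OF assms, of \<beta>] by simp
  then show "field \<beta> c z = 0" using has_velocity_unique has_velocity_const[OF assms(2)] by blast
qed (use flow_fixed[OF assms] in blast)

lemma has_derivative_act:
  assumes "a \<in> \<A>" "g \<in> cdom a" "c \<in> \<B>" "z \<in> cdom c" "act g z \<in> cdom c"
  shows "(coord c \<circ> act g \<circ> cinv c has_derivative
    (\<lambda>v. Dact a c c (g, z) (0, v))) (at (coord c z))"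
proof -
  let ?L = "local_rep (prod_chart a c) c (\<lambda>(h, z). act h z)"
  have "(?L has_derivative Dact a c c (g, z)) (at (coord a g, coord c z))"
    using act.derivative_local_rep[OF prod_chart_in_atlas[OF assms(1,3)] assms(3), of "(g, z)"] assms by simp
  then have "(?L \<circ> (\<lambda>y. (coord a g, y)) has_derivative
      Dact a c c (g, z) \<circ> (\<lambda>v. (0, v))) (at (coord c z))"
    by (intro diff_chain_at) (auto intro!: derivative_eq_intros)
  then have 1: "(?L \<circ> (\<lambda>y. (coord a g, y)) has_derivative
      (\<lambda>v. Dact a c c (g, z) (0, v))) (at (coord c z))"
    by (simp add: o_def)
  show ?thesis
  proof (rule has_derivative_transform_within_open[OF 1])
    show "open (coord c ` cdom c)" "coord c z \<in> coord c ` cdom c"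
      using is_chartD(2)[OF chart_\<B>] assms by auto
    show "(?L \<circ> (\<lambda>y. (coord a g, y))) y = (coord c \<circ> act g \<circ> cinv c) y" if "y \<in> coord c ` cdom c" for y
      using cinv_prod_chart[OF chart_\<A>[OF assms(1)] chart_\<B>[OF assms(3)] imageI[OF assms(2)] that]
        is_chartD(5)[OF chart_\<A>[OF assms(1)] assms(2)]
      by (simp add: local_rep_def)
  qed
qed

lemma frechet_derivative_act_J:
  assumes "c \<in> \<B>" "z \<in> cdom c" "act g z \<in> cdom c"
  shows "frechet_derivative (coord c \<circ> act g \<circ> cinv c) (at (coord c z)) (J' v)
    = J' (frechet_derivative (coord c \<circ> act g \<circ> cinv c) (at (coord c z)) v)"
proof -
  obtain a where a: "a \<in> \<A>" "g \<in> cdom a" using chart_at by blast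
  have "J 0 = 0" using complex_manifoldD(4)[OF manifold] by (rule linear_0)
  then have "map_prod J J' (0, v) = (0, J' v)" by simp
  then show ?thesis
    using act.tangent_map_J[OF prod_chart_in_atlas[OF a(1) assms(1)] assms(1), of "(g, z)" "(0, v)"] a assms
    by (simp flip: frechet_derivative_at[OF has_derivative_act[OF a assms]])
qed

end

locale Hamiltonian_action = lie_group_action H \<A> J \<kappa> \<B> J' act
  for H :: "('h::{t2_space,second_countable_topology}) monoid" (structure)
    and \<A> :: "('h, 'e::euclidean_space) chart set" and J :: "'e \<Rightarrow> 'e" and \<kappa> :: "('h, 'e) chart"
    and \<B> :: "('z::{t2_space,second_countable_topology}, 'f::euclidean_space) chart set"
    and J' :: "'f \<Rightarrow> 'f" and act :: "'h \<Rightarrow> 'z \<Rightarrow> 'z" +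
  fixes \<omega> :: "('z, 'f) two_form" and U :: "'h set" and \<mu> :: "'z \<Rightarrow> 'e \<Rightarrow> real"
  assumes kaehler: "Kaehler_manifold \<B> J' \<omega>"
    and compact_U: "compact U"
    and invariant: "invariant_two_form \<B> \<omega> act U"
    and momentum: "momentum_map H \<kappa> U \<B> \<omega> act \<mu>"
begin

lemma bilinear_\<omega>: "c \<in> \<B> \<Longrightarrow> z \<in> cdom c \<Longrightarrow> bilinear (\<omega> c z)"
  and \<omega>_alternating: "c \<in> \<B> \<Longrightarrow> z \<in> cdom c \<Longrightarrow> \<omega> c z v v = 0"
  and smooth_\<omega>: "c \<in> \<B> \<Longrightarrow> smooth_on (coord c ` cdom c) (\<lambda>y. \<omega> c (cinv c y) v w)"
  and \<omega>_pos: "c \<in> \<B> \<Longrightarrow> z \<in> cdom c \<Longrightarrow> v \<noteq> 0 \<Longrightarrow> \<omega> c z v (J' v) > 0"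
  using kaehler by (auto simp: Kaehler_manifold_def is_two_form_def)

lemma \<omega>_skew: "c \<in> \<B> \<Longrightarrow> z \<in> cdom c \<Longrightarrow> \<omega> c z v w = - \<omega> c z w v"
  using \<omega>_alternating[of c z "v + w"] \<omega>_alternating[of c z v] \<omega>_alternating[of c z w] bilinear_\<omega>[of c z]
  by (simp add: bilinear_ladd bilinear_radd)

lemma momentum_derivative:
  "\<lbrakk>c \<in> \<B>; z \<in> cdom c; w \<in> Lie U\<rbrakk>
    \<Longrightarrow> ((\<lambda>y. \<mu> (cinv c y) w) has_derivative \<omega> c z (field w c z)) (at (coord c z))"
  using momentum by (auto simp: momentum_map_def Let_def)

lemma continuous_momentum:
  assumes w: "w \<in> Lie U"
  shows "continuous_on S (\<lambda>z. \<mu> z w)"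
proof -
  have "isCont (\<lambda>z. \<mu> z w) z" for z
  proof -
    obtain c where c: "c \<in> \<B>" "z \<in> cdom c" using chart_\<B>_at by blast
    note ch = is_chartD[OF chart_\<B>[OF c(1)]]
    have "continuous_on (coord c ` cdom c) (\<lambda>y. \<mu> (cinv c y) w)"
      by (rule smooth_on_imp_continuous_on) (use momentum w c(1) in \<open>auto simp: momentum_map_def Let_def\<close>)
    then have "continuous_on (cdom c) (\<lambda>z. \<mu> (cinv c (coord c z)) w)"
      by (rule continuous_on_compose2[OF _ ch(3)]) auto
    then have "continuous_on (cdom c) (\<lambda>z. \<mu> z w)" by (rule continuous_on_eq) (simp add: ch(5))
    then show ?thesis using c(2) ch(1) continuous_on_eq_continuous_at by blast
  qed
  then show ?thesis by (simp add: continuous_at_imp_continuous_on)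
qed

lemma momentum_along_curve:
  assumes c: "c \<in> \<B>" and vel: "has_velocity c \<gamma> v t" and w: "w \<in> Lie U"
  shows "((\<lambda>s. \<mu> (\<gamma> s) w) has_real_derivative \<omega> c (\<gamma> t) (field w c (\<gamma> t)) v) (at t)"
proof -
  have \<gamma>: "\<gamma> t \<in> cdom c" "isCont \<gamma> t" "((\<lambda>s. coord c (\<gamma> s)) has_vector_derivative v) (at t)"
    using vel by (auto simp: has_velocity_def)
  note ch = is_chartD[OF chart_\<B>[OF c]]
  have 1: "(((\<lambda>y. \<mu> (cinv c y) w) \<circ> (\<lambda>s. coord c (\<gamma> s))) has_vector_derivative \<omega> c (\<gamma> t) (field w c (\<gamma> t)) v) (at t)"
    using vector_derivative_diff_chain_within[of "\<lambda>s. coord c (\<gamma> s)" v t UNIV "\<lambda>y. \<mu> (cinv c y) w"]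
      momentum_derivative[OF c \<gamma>(1) w] \<gamma>(3) has_derivative_at_withinI by blast
  have "eventually (\<lambda>s. \<gamma> s \<in> cdom c) (nhds t)"
    using \<gamma>(1,2) ch(1) by (simp add: eventually_nhds_conv_at isCont_def topological_tendstoD)
  then have ev: "eventually (\<lambda>s. s \<in> UNIV \<longrightarrow> ((\<lambda>y. \<mu> (cinv c y) w) \<circ> (\<lambda>s. coord c (\<gamma> s))) s = \<mu> (\<gamma> s) w) (nhds t)"
    by eventually_elim (simp add: ch(5))
  show ?thesis
    using has_vector_derivative_cong_ev[OF ev] 1 ch(5)[OF \<gamma>(1)]
    by (simp add: has_real_derivative_iff_has_vector_derivative o_def)
qed

lemma continuous_on_\<omega>:
  assumes c: "c \<in> \<B>" and f: "continuous_on X f" "f ` X \<subseteq> coord c ` cdom c"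
    and g: "continuous_on X g" and h: "continuous_on X h"
  shows "continuous_on X (\<lambda>x. \<omega> c (cinv c (f x)) (g x) (h x))"
proof -
  let ?D = "coord c ` cdom c"
  have lin: "linear (\<omega> c (cinv c y) v)" "linear (\<lambda>v. \<omega> c (cinv c y) v w)" if "y \<in> ?D" for y v w
    using bilinear_\<omega>[OF c is_chartD(6)[OF chart_\<B>[OF c] that]] by (auto simp: bilinear_def)
  have 1: "continuous_on X (\<lambda>x. \<omega> c (cinv c (f x)) v (h x))" for v
    by (rule continuous_on_linear_family[where D="\<lambda>y. \<omega> c (cinv c y) v", OF lin(1) _ f h])
      (auto intro: smooth_on_imp_continuous_on[OF smooth_\<omega>[OF c]])
  show ?thesis
    by (rule continuous_on_linear_family[where D="\<lambda>x v. \<omega> c (cinv c (f x)) v (h x)" and S=X, OF lin(2) 1 _ _ g])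
      (use f(2) in \<open>auto intro: continuous_intros\<close>)
qed

lemma \<omega>_lower_bound:
  assumes c: "c \<in> \<B>" and K: "compact K" "K \<subseteq> coord c ` cdom c"
  obtains m where "m > 0" "\<And>y v. y \<in> K \<Longrightarrow> m * (norm v)\<^sup>2 \<le> \<omega> c (cinv c y) v (J' v)"
proof (cases "K = {}")
  case True
  then show ?thesis using that[of 1] by simp
next
  case False
  have J': "linear J'" using complex_manifoldD(4)[OF manifold_\<B>] .
  let ?f = "\<lambda>z. \<omega> c (cinv c (fst z)) (snd z) (J' (snd z))"
  have "continuous_on (K \<times> sphere 0 1) ?f"
    using K(2) by (intro continuous_on_\<omega>[OF c] continuous_intros linear_continuous_on_compose[OF _ J']) auto
  moreover have "compact (K \<times> sphere (0::'f) 1)" using K by (intro compact_Times compact_sphere)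
  moreover have "K \<times> sphere (0::'f) 1 \<noteq> {}"
  proof -
    obtain y where "y \<in> K" using False by blast
    moreover obtain v :: 'f where "norm v = 1" using vector_choose_size zero_le_one by blast
    ultimately have "(y, v) \<in> K \<times> sphere 0 1" by simp
    then show ?thesis by blast
  qed
  ultimately have "\<exists>z\<in>K \<times> sphere 0 1. \<forall>z'\<in>K \<times> sphere 0 1. ?f z \<le> ?f z'"
    by (intro continuous_attains_inf)
  then obtain z where z: "z \<in> K \<times> sphere 0 1" "\<And>z'. z' \<in> K \<times> sphere 0 1 \<Longrightarrow> ?f z \<le> ?f z'"
    by blast
  have cK: "cinv c y \<in> cdom c" if "y \<in> K" for y using is_chartD(6)[OF chart_\<B>[OF c]] that K(2) by blast
  show ?thesis
  proof (rule that[of "?f z"])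
    show "?f z > 0" using z(1) cK by (intro \<omega>_pos[OF c]) auto
    fix y and v :: 'f assume y: "y \<in> K"
    note b = bilinear_\<omega>[OF c cK[OF y]]
    show "?f z * (norm v)\<^sup>2 \<le> \<omega> c (cinv c y) v (J' v)"
    proof (cases "v = 0")
      case True
      then show ?thesis using b by (simp add: bilinear_lzero)
    next
      case False
      have "?f z \<le> ?f (y, inverse (norm v) *\<^sub>R v)" using y False by (intro z(2)) simp
      also have "\<dots> = \<omega> c (cinv c y) v (J' v) / (norm v)\<^sup>2"
        using b J' by (simp add: bilinear_lmul bilinear_rmul linear_cmul field_simps power2_eq_square)
      finally show ?thesis using False by (simp add: field_simps)
    qed
  qed
qed

lemma fundamental_field_derivative:
  assumes c: "c \<in> \<B>"
  obtains W' where
    "\<And>y. y \<in> coord c ` cdom c \<Longrightarrow> ((\<lambda>y. field w c (cinv c y)) has_derivative W' y) (at y)"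
    "\<And>v. continuous_on (coord c ` cdom c) (\<lambda>y. W' y v)"
proof -
  define L where "L = local_rep (prod_chart \<kappa> c) c (\<lambda>(h, z). act h z)"
  define S where "S = coord (prod_chart \<kappa> c) ` (cdom (prod_chart \<kappa> c) \<inter> (\<lambda>(h, z). act h z) -` cdom c)"
  define e where "e = coord \<kappa> \<one>"
  define Y where "Y = (\<lambda>p. frechet_derivative L (at p) (w, 0))"
  note ch = is_chartD[OF chart_\<B>[OF c]] and pc = prod_chart_in_atlas[OF \<kappa> c]
  have S: "open S" unfolding S_def by (rule act.open_domain[OF pc c])
  have Y: "smooth_on S Y"
    unfolding Y_def
    by (rule smooth_on_frechet_derivative[OF _ S]) (use act.smooth_local_rep[OF pc c] in \<open>simp add: L_def S_def\<close>)
  have eS: "(e, y) \<in> S" if "y \<in> coord c ` cdom c" for y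
    using that one_\<kappa> by (force simp: S_def e_def)
  have eq: "Y (e, y) = field w c (cinv c y)" if "y \<in> coord c ` cdom c" for y
    using fundamental_field_eq[OF c ch(6)[OF that], of w] ch(7)[OF that]
    by (simp add: tangent_map_def Y_def L_def e_def)
  define W' where "W' = (\<lambda>y v. frechet_derivative Y (at (e, y)) (0, v))"
  show ?thesis
  proof (rule that[of W'])
    fix y assume y: "y \<in> coord c ` cdom c"
    have "(Y \<circ> (\<lambda>y. (e, y)) has_derivative frechet_derivative Y (at (e, y)) \<circ> (\<lambda>v. (0, v))) (at y)"
      by (rule diff_chain_at[where f="\<lambda>y. (e, y)" and x=y, OF _ smooth_on_has_derivative[OF Y eS[OF y]]]) (auto intro!: derivative_eq_intros)
    then have "((\<lambda>y. Y (e, y)) has_derivative W' y) (at y)" by (simp add: o_def W'_def)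
    then show "((\<lambda>y. field w c (cinv c y)) has_derivative W' y) (at y)"
      by (rule has_derivative_transform_within_open[OF _ ch(2) y eq])
  next
    fix v
    have "continuous_on S (\<lambda>p. frechet_derivative Y (at p) (0, v))"
      by (rule smooth_on_imp_continuous_on[OF smooth_on_frechet_derivative[OF Y S]])
    then show "continuous_on (coord c ` cdom c) (\<lambda>y. W' y v)"
      unfolding W'_def by (rule continuous_on_compose2) (auto intro!: continuous_intros eS)
  qed
qed

lemma flow_in_neighbourhood:
  assumes w: "w \<in> Lie U" and fixed: "\<And>t. flow w t z0 = z0" and N: "open N" "z0 \<in> N"
  obtains X0 where "open X0" "z0 \<in> X0" "\<And>z t. z \<in> X0 \<Longrightarrow> flow w t z \<in> N"
proof -
  define K where "K = {g \<in> U. act g z0 = z0}"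
  have "closed {g. act g z0 = z0}"
    by (intro closed_Collect_eq continuous_on_act continuous_on_id continuous_on_const)
  then have K: "compact K"
    using compact_U by (simp add: K_def Collect_conj_eq compact_Int_closed)
  have W: "open ((\<lambda>(z, g). act g z) -` N)"
    using N(1) unfolding split_beta by (intro open_vimage continuous_on_act continuous_intros)
  have "{z0} \<times> K \<subseteq> (\<lambda>(z, g). act g z) -` N"
    using N(2) by (auto simp: K_def)
  then obtain X0 where X0: "z0 \<in> X0" "open X0" "X0 \<times> K \<subseteq> (\<lambda>(z, g). act g z) -` N"
    using Elementary_Topology.tube_lemma[OF K W] by blast
  have "Exp (t *\<^sub>R w) \<in> K" for t
    using w fixed by (simp add: K_def Lie_alg_def)
  then have "flow w t z \<in> N" if "z \<in> X0" for z t
    using subsetD[OF X0(3), of "(z, Exp (t *\<^sub>R w))"] that by simp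
  then show ?thesis using that X0 by blast
qed

text \<open>\<open>U\<close> acts by isometries of the Kaehler metric.\<close>

lemma derivative_act_bounded:
  assumes c: "c \<in> \<B>" and K: "compact K" "K \<subseteq> coord c ` cdom c"
  obtains C where "\<And>g y v. \<lbrakk>g \<in> U; y \<in> K; act g (cinv c y) \<in> cinv c ` K\<rbrakk>
    \<Longrightarrow> norm (frechet_derivative (coord c \<circ> act g \<circ> cinv c) (at y) v) \<le> C * norm v"
proof -
  obtain m where m: "m > 0" "\<And>y v. y \<in> K \<Longrightarrow> m * (norm v)\<^sup>2 \<le> \<omega> c (cinv c y) v (J' v)"
    using \<omega>_lower_bound[OF c K] by blast
  note ch = is_chartD[OF chart_\<B>[OF c]]
  have J': "linear J'" using complex_manifoldD(4)[OF manifold_\<B>] .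
  let ?f = "\<lambda>z. \<omega> c (cinv c (fst z)) (snd z) (J' (snd z))"
  have cont: "continuous_on (K \<times> sphere 0 1) ?f"
    using K(2) by (intro continuous_on_\<omega>[OF c] continuous_intros linear_continuous_on_compose[OF _ J']) auto
  have "bounded (?f ` (K \<times> sphere 0 1))"
    by (intro compact_imp_bounded compact_continuous_image cont compact_Times K compact_sphere)
  then obtain M where M: "M > 0" "\<And>y v. y \<in> K \<Longrightarrow> norm v = 1 \<Longrightarrow> \<bar>\<omega> c (cinv c y) v (J' v)\<bar> \<le> M"
    unfolding bounded_pos by fastforce
  have M2: "\<omega> c (cinv c y) v (J' v) \<le> M * (norm v)\<^sup>2" if y: "y \<in> K" for y v
  proof (cases "v = 0")
    case True
    then show ?thesis using bilinear_\<omega>[OF c ch(6)] y K(2) by (auto simp: bilinear_lzero subset_iff)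
  next
    case False
    have b: "bilinear (\<omega> c (cinv c y))" using bilinear_\<omega>[OF c ch(6)] y K(2) by blast
    have "\<omega> c (cinv c y) (inverse (norm v) *\<^sub>R v) (J' (inverse (norm v) *\<^sub>R v)) \<le> M"
      using M(2)[OF y, of "inverse (norm v) *\<^sub>R v"] False by simp
    then show ?thesis
      using b J' False by (simp add: bilinear_lmul bilinear_rmul linear_cmul field_simps power2_eq_square)
  qed
  show ?thesis
  proof (rule that)
    fix g y v assume g: "g \<in> U" and y: "y \<in> K" and "act g (cinv c y) \<in> cinv c ` K"
    then obtain y' where y': "y' \<in> K" "act g (cinv c y) = cinv c y'" by blast
    let ?D = "frechet_derivative (coord c \<circ> act g \<circ> cinv c) (at y)"
    have yc: "cinv c y \<in> cdom c" "coord c (cinv c y) = y" "cinv c y' \<in> cdom c"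
      using ch(6,7) y y'(1) K(2) by blast+
    have "m * (norm (?D v))\<^sup>2 \<le> \<omega> c (cinv c y') (?D v) (J' (?D v))" by (rule m(2)[OF y'(1)])
    also have "\<dots> = \<omega> c (cinv c y') (?D v) (?D (J' v))"
      using frechet_derivative_act_J[OF c yc(1), of g v] y' yc by simp
    also have "\<dots> = \<omega> c (cinv c y) v (J' v)"
      using invariant g c yc y'(2) unfolding invariant_two_form_def Let_def by (metis (no_types, lifting))
    also have "\<dots> \<le> M * (norm v)\<^sup>2" by (rule M2[OF y])
    finally have "(norm (?D v))\<^sup>2 \<le> M / m * (norm v)\<^sup>2" using m(1) by (simp add: field_simps)
    also have "\<dots> = (sqrt (M / m) * norm v)\<^sup>2" using M(1) m(1) by (simp add: power_mult_distrib)
    finally show "norm (?D v) \<le> sqrt (M / m) * norm v"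
      by (rule power2_le_imp_le) (use M(1) m(1) in simp)
  qed
qed

lemma momentum_locally_constant:
  assumes w: "w \<in> Lie U" and z0: "\<And>t. flow w t z0 = z0"
  shows "\<exists>N. open N \<and> z0 \<in> N \<and> (\<forall>z\<in>N. (\<forall>t. flow w t z = z) \<longrightarrow> \<mu> z w = \<mu> z0 w)"
proof -
  obtain c where c: "c \<in> \<B>" "z0 \<in> cdom c" using chart_\<B>_at by blast
  note ch = is_chartD[OF chart_\<B>[OF c(1)]]
  define y0 where "y0 = coord c z0"
  define D where "D = coord c ` cdom c"
  have openD: "open D" and y0: "y0 \<in> D" using ch(2) c(2) by (auto simp: D_def y0_def)
  obtain R where R: "R > 0" "ball y0 R \<subseteq> D" using openD y0 open_contains_ball by blast
  define B where "B = ball y0 R"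
  define K where "K = cball y0 (R / 2)"
  have KB: "K \<subseteq> B" using R(1) by (auto simp: K_def B_def)
  have BD: "B \<subseteq> D" using R(2) by (simp add: B_def)
  have preim: "open {z \<in> cdom c. coord c z \<in> T}" if "open T" for T
  proof -
    have "{z \<in> cdom c. coord c z \<in> T} = coord c -` T \<inter> cdom c" by blast
    then show ?thesis using continuous_on_open_vimage[OF ch(1)] ch(3) that by metis
  qed
  define N0 where "N0 = {z \<in> cdom c. coord c z \<in> ball y0 (R / 2)}"
  have N0: "open N0" unfolding N0_def by (rule preim) simp
  have z0N0: "z0 \<in> N0" using c(2) R(1) by (simp add: N0_def y0_def)
  obtain X0 where X0: "open X0" "z0 \<in> X0" "\<And>z t. z \<in> X0 \<Longrightarrow> flow w t z \<in> N0"
    using flow_in_neighbourhood[OF w z0 N0 z0N0] by blast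
  have "open (coord c ` (X0 \<inter> N0))"
    by (rule open_coord_image[OF chart_\<B>[OF c(1)]]) (use X0 N0 in \<open>auto simp: N0_def\<close>)
  moreover have "y0 \<in> coord c ` (X0 \<inter> N0)" using X0 z0N0 by (auto simp: y0_def)
  ultimately obtain r where r: "r > 0" "ball y0 r \<subseteq> coord c ` (X0 \<inter> N0)"
    using open_contains_ball by blast
  have small: "cinv c y \<in> X0 \<inter> N0" "y \<in> K" "y \<in> D" if y: "y \<in> ball y0 r" for y
  proof -
    obtain z where "z \<in> X0 \<inter> N0" "y = coord c z" using r(2) y by blast
    then show "cinv c y \<in> X0 \<inter> N0" "y \<in> K" "y \<in> D"
      using ch(5)[of z] by (auto simp: N0_def K_def D_def)
  qed
  define N where "N = {z \<in> cdom c. coord c z \<in> ball y0 r}"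
  have "\<mu> z w = \<mu> z0 w" if z: "z \<in> N" and zfix: "\<And>t. flow w t z = z" for z
  proof -
    define y1 where "y1 = coord c z"
    define u where "u = y1 - y0"
    define \<sigma> where "\<sigma> = (\<lambda>s. y0 + s *\<^sub>R u)"
    define I where "I = \<sigma> -` ball y0 r"
    have \<sigma>cont: "continuous_on X \<sigma>" for X unfolding \<sigma>_def by (intro continuous_intros)
    have I: "open I" unfolding I_def by (intro open_vimage \<sigma>cont) auto
    have convI: "convex I"
    proof (rule convexI)
      fix a b p q :: real assume a: "a \<in> I" "b \<in> I" "0 \<le> p" "0 \<le> q" "p + q = 1"
      have "\<sigma> (p * a + q * b) = p *\<^sub>R \<sigma> a + q *\<^sub>R \<sigma> b"
        using a(5) unfolding \<sigma>_def by (simp add: algebra_simps) (simp flip: scaleR_left_distrib)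
      then show "p *\<^sub>R a + q *\<^sub>R b \<in> I"
        using a convexD[OF convex_ball, of "\<sigma> a" y0 r "\<sigma> b" p q] by (simp add: I_def)
    qed
    have "0 \<in> I" "1 \<in> I" using r(1) z by (auto simp: I_def \<sigma>_def u_def y1_def N_def)
    then have I01: "{0..1} \<subseteq> I" using convI by (metis atLeastAtMost_iff connected_contains_Icc convex_connected subsetI subset_iff)
    define \<phi> where "\<phi> = (\<lambda>t s. flow w t (cinv c (\<sigma> s)))"
    define C where "C = (\<lambda>t s. coord c (\<phi> t s))"
    have \<sigma>I: "\<sigma> s \<in> ball y0 r" if "s \<in> I" for s using that by (simp add: I_def)
    have \<phi>N0: "\<phi> t s \<in> N0" if "s \<in> I" for t s
      using X0(3) small(1)[OF \<sigma>I[OF that]] by (simp add: \<phi>_def)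
    have \<phi>c: "\<phi> t s \<in> cdom c" if "s \<in> I" for t s using \<phi>N0[OF that] by (simp add: N0_def)
    have CK: "C t s \<in> K" if "s \<in> I" for t s
      using \<phi>N0[OF that, of t] by (simp add: C_def N0_def K_def)
    have cinvC: "cinv c (C t s) = \<phi> t s" if "s \<in> I" for t s using ch(5)[OF \<phi>c[OF that]] by (simp add: C_def)
    have \<sigma>c: "cinv c (\<sigma> s) \<in> cdom c" if "s \<in> I" for s
      using small(1)[OF \<sigma>I[OF that]] by (simp add: N0_def)
    have \<sigma>D: "coord c (cinv c (\<sigma> s)) = \<sigma> s" if "s \<in> I" for s
      using small(3)[OF \<sigma>I[OF that]] ch(7) by (simp add: D_def)
    have Ct: "((\<lambda>t. C t s) has_vector_derivative field w c (cinv c (C t s))) (at t)" if "s \<in> I" for t s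
      using has_velocity_flow[OF c(1), of t w "cinv c (\<sigma> s)"] \<phi>c[OF that, of t]
      by (simp add: has_velocity_def C_def \<phi>_def ch(5))
    define q where "q = (\<lambda>t s. frechet_derivative (coord c \<circ> act (Exp (t *\<^sub>R w)) \<circ> cinv c) (at (\<sigma> s)) u)"
    have dact: "(coord c \<circ> act (Exp (t *\<^sub>R w)) \<circ> cinv c has_derivative
        (\<lambda>v. Dact a c c (Exp (t *\<^sub>R w), cinv c (\<sigma> s)) (0, v))) (at (\<sigma> s))"
      if "s \<in> I" "a \<in> \<A>" "Exp (t *\<^sub>R w) \<in> cdom a" for t s a
      using has_derivative_act[OF that(2,3) c(1) \<sigma>c[OF that(1)]] \<phi>c[OF that(1), of t] \<sigma>D[OF that(1)]
      by (simp add: \<phi>_def)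
    have q: "q t s = Dact a c c (Exp (t *\<^sub>R w), cinv c (\<sigma> s)) (0, u)"
      if "s \<in> I" "a \<in> \<A>" "Exp (t *\<^sub>R w) \<in> cdom a" for t s a
      using frechet_derivative_at[OF dact[OF that]] unfolding q_def by metis
    have Cs: "(C t has_vector_derivative q t s) (at s)" if s: "s \<in> I" for t s
    proof -
      obtain a where a: "a \<in> \<A>" "Exp (t *\<^sub>R w) \<in> cdom a" using chart_at by blast
      have "(\<sigma> has_vector_derivative u) (at s)" unfolding \<sigma>_def by (auto intro!: derivative_eq_intros)
      then have "((coord c \<circ> act (Exp (t *\<^sub>R w)) \<circ> cinv c) \<circ> \<sigma> has_vector_derivative q t s) (at s)"
        using vector_derivative_diff_chain_within[of \<sigma> u s UNIV] has_derivative_at_withinI[OF dact[OF s a]]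
        unfolding q[OF s a] by blast
      then show ?thesis by (simp add: o_def C_def[abs_def] \<phi>_def)
    qed
    have \<phi>cont: "continuous_on (UNIV \<times> I) (\<lambda>(t, s). \<phi> t s)"
    proof -
      have "continuous_on (UNIV \<times> I) (\<lambda>z. cinv c (\<sigma> (snd z)))"
        by (rule continuous_on_compose2[OF ch(4)])
          (auto intro!: continuous_on_compose2[OF \<sigma>cont] continuous_intros simp: small(3)[OF \<sigma>I, unfolded D_def])
      moreover have "continuous_on (UNIV \<times> I) (\<lambda>z. Exp (fst z *\<^sub>R w))"
        by (rule continuous_on_compose2[OF continuous_Lie_exp_ray]) (auto intro!: continuous_intros)
      ultimately show ?thesis unfolding \<phi>_def split_beta by (intro continuous_on_act)
    qed
    have Ccont: "continuous_on (UNIV \<times> I) (\<lambda>(t, s). C t s)"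
      unfolding C_def split_beta
      by (rule continuous_on_compose2[OF ch(3) \<phi>cont[unfolded split_beta]]) (auto intro: \<phi>c)
    have qcont: "continuous_on (UNIV \<times> I) (\<lambda>(t, s). q t s)"
    proof -
      have "isCont (\<lambda>z. q (fst z) (snd z)) (t, s)" if s: "s \<in> I" for t s
      proof -
        obtain a where a: "a \<in> \<A>" "Exp (t *\<^sub>R w) \<in> cdom a" using chart_at by blast
        note ach = is_chartD[OF chart_\<A>[OF a(1)]] and pc = prod_chart_in_atlas[OF a(1) c(1)]
        define L where "L = local_rep (prod_chart a c) c (\<lambda>(h, z). act h z)"
        define S where "S = coord (prod_chart a c) ` (cdom (prod_chart a c) \<inter> (\<lambda>(h, z). act h z) -` cdom c)"
        have S: "open S" unfolding S_def by (rule act.open_domain[OF pc c(1)])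
        have Lc: "continuous_on S (\<lambda>p. frechet_derivative L (at p) (0, u))"
          by (rule smooth_on_imp_continuous_on[OF smooth_on_frechet_derivative[OF _ S]])
            (use act.smooth_local_rep[OF pc c(1)] in \<open>simp add: L_def S_def\<close>)
        define T where "T = (\<lambda>t. Exp (t *\<^sub>R w)) -` cdom a"
        have T: "open T" "t \<in> T" unfolding T_def using a(2) ach(1) by (auto intro: open_vimage continuous_Lie_exp_ray)
        have "continuous_on (T \<times> I) (\<lambda>z. (coord a (Exp (fst z *\<^sub>R w)), \<sigma> (snd z)))"
          by (intro continuous_on_Pair continuous_on_compose2[OF ach(3)] continuous_on_compose2[OF continuous_Lie_exp_ray]
              continuous_on_compose2[OF \<sigma>cont] continuous_intros) (auto simp: T_def)
        moreover have "(coord a (Exp (t *\<^sub>R w)), \<sigma> s) \<in> S" if "t \<in> T" "s \<in> I" for t s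
        proof -
          have "(Exp (t *\<^sub>R w), cinv c (\<sigma> s)) \<in> cdom (prod_chart a c) \<inter> (\<lambda>(h, z). act h z) -` cdom c"
            using that \<sigma>c \<phi>c[of s t] by (simp add: T_def \<phi>_def)
          then show ?thesis unfolding S_def using \<sigma>D[OF that(2)] by (metis image_eqI map_prod_simp prod_chart_sel(2))
        qed
        ultimately have "continuous_on (T \<times> I)
            (\<lambda>z. frechet_derivative L (at (coord a (Exp (fst z *\<^sub>R w)), \<sigma> (snd z))) (0, u))"
          by (intro continuous_on_compose2[OF Lc]) auto
        then have "continuous_on (T \<times> I) (\<lambda>z. q (fst z) (snd z))"
          by (rule continuous_on_eq) (auto simp: q[OF _ a(1)] T_def tangent_map_def L_def \<sigma>D)
        then show ?thesis
          using T I s continuous_on_eq_continuous_at[of "T \<times> I"] by (auto simp: open_Times)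
      qed
      then show ?thesis unfolding split_beta by (intro continuous_at_imp_continuous_on) auto
    qed
    obtain M where M: "\<And>g y v. \<lbrakk>g \<in> U; y \<in> K; act g (cinv c y) \<in> cinv c ` K\<rbrakk>
        \<Longrightarrow> norm (frechet_derivative (coord c \<circ> act g \<circ> cinv c) (at y) v) \<le> M * norm v"
    proof (rule derivative_act_bounded[OF c(1)])
      show "compact K" "K \<subseteq> coord c ` cdom c" using KB BD by (auto simp: K_def D_def)
    qed (rule that)
    have qM: "norm (q t s) \<le> M * norm u" if "s \<in> {0..1}" for t s
    proof -
      have s: "s \<in> I" using that I01 by blast
      have "act (Exp (t *\<^sub>R w)) (cinv c (\<sigma> s)) \<in> cinv c ` K"
        using cinvC[OF s, of t] CK[OF s, of t] unfolding \<phi>_def by (metis imageI)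
      then show ?thesis
        unfolding q_def using w small(2)[OF \<sigma>I[OF s]] by (intro M) (auto simp: Lie_alg_def)
    qed
    obtain W' where W': "\<And>y. y \<in> D \<Longrightarrow> ((\<lambda>y. field w c (cinv c y)) has_derivative W' y) (at y)"
      "\<And>v. continuous_on D (\<lambda>y. W' y v)"
      using fundamental_field_derivative[OF c(1), of w] unfolding D_def by metis
    have BD': "y \<in> coord c ` cdom c" if "y \<in> B" for y using that BD by (auto simp: D_def)
    note Bc = ch(6)[OF BD']
    have closed: "frechet_derivative (\<lambda>y. \<omega> c (cinv c y) v w) (at y) u
      - frechet_derivative (\<lambda>y. \<omega> c (cinv c y) u w) (at y) v
      + frechet_derivative (\<lambda>y. \<omega> c (cinv c y) u v) (at y) w = 0" if "y \<in> B" for y u v w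
      using kaehler c(1) BD'[OF that] by (auto simp: Kaehler_manifold_def closed_two_form_def)
    obtain \<theta> \<Theta> where \<theta>: "\<And>y. y \<in> B \<Longrightarrow> linear (\<theta> y)"
      "\<And>y v. y \<in> B \<Longrightarrow> ((\<lambda>y. \<theta> y v) has_derivative \<Theta> y v) (at y)"
      "\<And>u v. continuous_on B (\<lambda>y. \<Theta> y v u)"
      "\<And>y u v. y \<in> B \<Longrightarrow> \<Theta> y v u - \<Theta> y u v = \<omega> c (cinv c y) u v"
    proof (rule Poincare_two_form[of y0 R "\<lambda>y. \<omega> c (cinv c y)", folded B_def])
      fix y u v w assume y: "y \<in> B"
      show "bilinear (\<omega> c (cinv c y))" "\<omega> c (cinv c y) v v = 0"
        using bilinear_\<omega>[OF c(1) Bc[OF y]] \<omega>_alternating[OF c(1) Bc[OF y]] .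
      show "frechet_derivative (\<lambda>y. \<omega> c (cinv c y) v w) (at y) u
        - frechet_derivative (\<lambda>y. \<omega> c (cinv c y) u w) (at y) v
        + frechet_derivative (\<lambda>y. \<omega> c (cinv c y) u v) (at y) w = 0"
        by (rule closed[OF y])
    next
      fix v w
      show "smooth_on B (\<lambda>y. \<omega> c (cinv c y) v w)"
        by (rule smooth_on_subset[OF smooth_\<omega>[OF c(1)] BD[unfolded D_def]])
    qed (rule that)
    have "\<mu> (cinv c y0) w = \<mu> (cinv c y1) w"
    proof (rule Hamiltonian_eq_at_fixed_points[where B=B and \<theta>=\<theta> and \<Theta>=\<Theta> and K=K and c=C and q=q and I=I
          and W="\<lambda>y. field w c (cinv c y)" and W'=W' and \<Omega>="\<lambda>y. \<omega> c (cinv c y)" and C="M * norm u"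
          and f="\<lambda>y. \<mu> (cinv c y) w"])
      show "((\<lambda>y. \<mu> (cinv c y) w) has_derivative \<omega> c (cinv c y) (field w c (cinv c y))) (at y)" if "y \<in> B" for y
        using momentum_derivative[OF c(1) Bc[OF that] w] ch(7)[OF BD'[OF that]] by simp
      show "((\<lambda>y. field w c (cinv c y)) has_derivative W' y) (at y)" if "y \<in> B" for y
        using W'(1) BD that by blast
      show "continuous_on B (\<lambda>y. W' y v)" for v using W'(2) BD continuous_on_subset by blast
      show "C t 0 = y0" for t
        using z0 ch(5)[OF c(2)] by (simp add: C_def \<phi>_def \<sigma>_def y0_def)
      show "C t 1 = y1" for t
        using zfix ch(5)[of z] z by (simp add: C_def \<phi>_def \<sigma>_def u_def y1_def N_def)
    qed (use \<theta> I convI I01 KB CK Ct Cs Ccont qcont qM in \<open>auto simp: B_def K_def\<close>)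
    then show ?thesis using ch(5)[OF c(2)] ch(5)[of z] z by (simp add: y0_def y1_def N_def)
  qed
  moreover have "open N" unfolding N_def by (rule preim) simp
  moreover have "z0 \<in> N" using c(2) r(1) by (simp add: N_def y0_def)
  ultimately show ?thesis by blast
qed

end

section \<open>The gradient map\<close>

locale gradient_action = Hamiltonian_action H \<A> J \<kappa> \<B> J' act \<omega> U \<mu> + subspace_inner \<aa> Q
  for H :: "('h::{t2_space,second_countable_topology}) monoid" (structure)
    and \<A> :: "('h, 'e::euclidean_space) chart set" and J :: "'e \<Rightarrow> 'e" and \<kappa> :: "('h, 'e) chart"
    and \<B> :: "('z::{t2_space,second_countable_topology}, 'f::euclidean_space) chart set"
    and J' :: "'f \<Rightarrow> 'f" and act :: "'h \<Rightarrow> 'z \<Rightarrow> 'z"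
    and \<omega> :: "('z, 'f) two_form" and U :: "'h set" and \<mu> :: "'z \<Rightarrow> 'e \<Rightarrow> real"
    and \<aa> :: "'e set" and Q :: "'e \<Rightarrow> 'e \<Rightarrow> real" +
  fixes \<mu>a :: "'z \<Rightarrow> 'e" and A :: "'h set" and X :: "'z set"
  assumes minus_J_mem: "\<beta> \<in> \<aa> \<Longrightarrow> - J \<beta> \<in> Lie U"
    and abelian: "\<lbrakk>v \<in> \<aa>; w \<in> \<aa>\<rbrakk> \<Longrightarrow> bracket v w = 0"
    and \<mu>a_mem: "\<mu>a z \<in> \<aa>"
    and \<mu>a: "\<beta> \<in> \<aa> \<Longrightarrow> Q (\<mu>a z) \<beta> = \<mu> z (- J \<beta>)"
    and continuous_exp: "continuous_on \<aa> (Exp)"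
    and inj_exp: "inj_on (Exp) \<aa>"
    and A_def: "A = Exp ` \<aa>"
    and compact_X: "compact X" and A_X: "\<And>h z. \<lbrakk>h \<in> A; z \<in> X\<rbrakk> \<Longrightarrow> act h z \<in> X"
begin

lemmas \<aa>_add = subspace_add[OF subspace_V] and \<aa>_scale = subspace_scale[OF subspace_V]
  and \<aa>_diff = subspace_diff[OF subspace_V] and \<aa>_0 = subspace_0[OF subspace_V]

lemma exp_add: "\<lbrakk>v \<in> \<aa>; w \<in> \<aa>\<rbrakk> \<Longrightarrow> Exp (v + w) = Exp v \<otimes> Exp w"
  by (intro Lie_exp_add_commuting abelian)

lemma act_exp_commute:
  "\<lbrakk>v \<in> \<aa>; w \<in> \<aa>\<rbrakk> \<Longrightarrow> act (Exp v) (act (Exp w) z) = act (Exp w) (act (Exp v) z)"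
  using exp_add[of v w] exp_add[of w v] by (simp add: add.commute flip: act_mult)

lemma act_exp_minus [simp]: "act (Exp (- v)) (act (Exp v) z) = z"
  using act_mult[of "inv (Exp v)" "Exp v" z] by (simp add: inv_Lie_exp[symmetric])

lemma field_minus_J:
  assumes "c \<in> \<B>" "z \<in> cdom c"
  shows "field (- J \<beta>) c z = - J' (field \<beta> c z)"
  using linear_neg[OF linear_fundamental_field[OF assms], of "J \<beta>"] fundamental_field_J[OF assms, of \<beta>] by simp

lemma \<mu>a_along_curve:
  assumes "c \<in> \<B>" "has_velocity c \<gamma> v t" "\<beta> \<in> \<aa>"
  shows "((\<lambda>s. Q (\<mu>a (\<gamma> s)) \<beta>) has_real_derivative \<omega> c (\<gamma> t) v (J' (field \<beta> c (\<gamma> t)))) (at t)"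
proof -
  have p: "\<gamma> t \<in> cdom c" using assms(2) by (simp add: has_velocity_def)
  have "\<omega> c (\<gamma> t) (- J' (field \<beta> c (\<gamma> t))) v = \<omega> c (\<gamma> t) v (J' (field \<beta> c (\<gamma> t)))"
    using \<omega>_skew[OF assms(1) p, of v] bilinear_lneg[OF bilinear_\<omega>[OF assms(1) p]] by simp
  then show ?thesis
    using momentum_along_curve[OF assms(1,2) minus_J_mem[OF assms(3)]]
    by (simp add: \<mu>a[OF assms(3)] field_minus_J[OF assms(1) p])
qed

lemma \<mu>a_increasing:
  assumes \<beta>: "\<beta> \<in> \<aa>" and z: "\<not> (\<forall>t. flow \<beta> t z = z)" and t: "0 < t"
  shows "Q (\<mu>a z) \<beta> < Q (\<mu>a (flow \<beta> t z)) \<beta>"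
proof -
  have "Q (\<mu>a (flow \<beta> 0 z)) \<beta> < Q (\<mu>a (flow \<beta> t z)) \<beta>"
  proof (rule DERIV_pos_imp_increasing[OF t])
    fix s
    let ?p = "flow \<beta> s z"
    obtain c where c: "c \<in> \<B>" "?p \<in> cdom c" using chart_\<B>_at by blast
    have "field \<beta> c ?p \<noteq> 0"
    proof
      assume "field \<beta> c ?p = 0"
      then have fx: "flow \<beta> r ?p = ?p" for r using flow_fixed[OF c] by blast
      have "flow \<beta> r z = z" for r
      proof -
        have "flow \<beta> r z = flow \<beta> (- s + (r + s)) z" by simp
        also have "\<dots> = flow \<beta> (- s) (flow \<beta> r ?p)" by (simp only: flow_add)
        also have "\<dots> = flow \<beta> (- s) ?p" by (simp only: fx)
        also have "\<dots> = z" by (simp flip: flow_add)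
        finally show ?thesis .
      qed
      with z show False by blast
    qed
    then have "\<omega> c ?p (field \<beta> c ?p) (J' (field \<beta> c ?p)) > 0" by (rule \<omega>_pos[OF c])
    with \<mu>a_along_curve[OF c(1) has_velocity_flow[OF c] \<beta>]
    show "\<exists>y. ((\<lambda>t. Q (\<mu>a (flow \<beta> t z)) \<beta>) has_real_derivative y) (at s) \<and> 0 < y" by blast
  qed
  then show ?thesis by simp
qed

definition isotropy :: "'z \<Rightarrow> 'e set" where
  "isotropy z = {\<beta> \<in> \<aa>. \<forall>t. flow \<beta> t z = z}"

lemma isotropy_subset: "isotropy z \<subseteq> \<aa>"
  by (auto simp: isotropy_def)

lemma subspace_isotropy: "subspace (isotropy z)"
proof (rule subspaceI)
  show "0 \<in> isotropy z" using \<aa>_0 by (simp add: isotropy_def)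
next
  fix v w assume "v \<in> isotropy z" "w \<in> isotropy z"
  then show "v + w \<in> isotropy z"
    using exp_add[of "t *\<^sub>R v" "t *\<^sub>R w" for t] by (simp add: isotropy_def \<aa>_add \<aa>_scale scaleR_right_distrib act_mult)
next
  fix r v assume v: "v \<in> isotropy z"
  have "flow (r *\<^sub>R v) t z = flow v (t * r) z" for t by simp
  then show "r *\<^sub>R v \<in> isotropy z" using v by (simp add: isotropy_def \<aa>_scale)
qed

lemma isotropy_orbit:
  assumes \<xi>: "\<xi> \<in> \<aa>" shows "isotropy (act (Exp \<xi>) z) = isotropy z"
proof -
  have 1: "isotropy z \<subseteq> isotropy (act (Exp \<xi>) z)" if "\<xi> \<in> \<aa>" for \<xi> z
    using act_exp_commute[OF \<aa>_scale that] by (auto simp: isotropy_def)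
  from 1[OF \<xi>, of z] 1[of "- \<xi>" "act (Exp \<xi>) z"] show ?thesis
    using \<xi> subspace_neg[OF subspace_V] by auto
qed

lemma continuous_\<mu>a: "continuous_on S \<mu>a"
proof -
  obtain B where B: "B \<subseteq> \<aa>" "independent B" "span B = \<aa>"
    by (rule subspace_basis[OF subspace_V])
  have finB: "finite B" using B(2) by (rule independent_imp_finite)
  have "\<exists>d\<in>\<aa>. \<forall>n\<in>\<aa>. Q d n = representation B n b" if "b \<in> B" for b
  proof -
    obtain l where l: "linear l" "\<And>x. x \<in> B \<Longrightarrow> l x = (if x = b then 1 else 0 :: real)"
      using linear_independent_extend[OF B(2), of "\<lambda>x. if x = b then 1 else 0"] by blast
    obtain d where "d \<in> \<aa>" "\<forall>n\<in>\<aa>. Q d n = l n" using Q_riesz[OF subspace_V subset_refl l(1)] by blast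
    moreover have "l n = representation B n b" if n: "n \<in> \<aa>" for n
    proof -
      have "l n = l (\<Sum>x\<in>B. representation B n x *\<^sub>R x)"
        using sum_representation_eq[OF B(2) _ finB subset_refl, of n] n B(3) by simp
      also have "\<dots> = (\<Sum>x\<in>B. representation B n x * (if x = b then 1 else 0))"
        using l by (simp add: linear_sum linear_cmul)
      also have "\<dots> = representation B n b" using finB \<open>b \<in> B\<close> by (simp add: if_distrib cong: if_cong)
      finally show ?thesis .
    qed
    ultimately show ?thesis by auto
  qed
  then obtain d where d: "\<And>b. b \<in> B \<Longrightarrow> d b \<in> \<aa>" "\<And>b n. b \<in> B \<Longrightarrow> n \<in> \<aa> \<Longrightarrow> Q (d b) n = representation B n b"
    by metis
  have eq: "\<mu>a z = (\<Sum>b\<in>B. \<mu> z (- J b) *\<^sub>R d b)" for z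
  proof -
    let ?s = "\<Sum>b\<in>B. \<mu> z (- J b) *\<^sub>R d b"
    have s: "?s \<in> \<aa>" by (intro subspace_sum[OF subspace_V] \<aa>_scale d)
    have "Q ?s n = Q (\<mu>a z) n" if n: "n \<in> \<aa>" for n
    proof -
      have "Q ?s n = (\<Sum>b\<in>B. \<mu> z (- J b) * representation B n b)"
        using d(2)[OF _ n] by (simp add: Q.sum_left Q.scaleR_left)
      also have "\<dots> = (\<Sum>b\<in>B. representation B n b * Q (\<mu>a z) b)"
        using B(1) by (intro sum.cong) (auto simp: \<mu>a mult.commute)
      also have "\<dots> = Q (\<mu>a z) (\<Sum>b\<in>B. representation B n b *\<^sub>R b)"
        by (simp add: Q.sum_right Q.scaleR_right)
      also have "\<dots> = Q (\<mu>a z) n"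
        using sum_representation_eq[OF B(2) _ finB subset_refl, of n] n B(3) by simp
      finally show ?thesis .
    qed
    then have "Q (\<mu>a z - ?s) (\<mu>a z - ?s) = 0"
      using \<aa>_diff[OF \<mu>a_mem s] by (simp add: Q.diff_left)
    then show ?thesis using Q_pos[OF \<aa>_diff[OF \<mu>a_mem s]] by force
  qed
  have "continuous_on S (\<lambda>z. \<Sum>b\<in>B. \<mu> z (- J b) *\<^sub>R d b)"
    using B(1) by (intro continuous_intros continuous_momentum minus_J_mem) auto
  then show ?thesis by (simp add: eq cong: continuous_on_cong)
qed

lemma orbit_image: "\<mu>a ` action_orbit act A z = (\<lambda>\<xi>. \<mu>a (act (Exp \<xi>) z)) ` \<aa>"
  by (auto simp: action_orbit_def A_def)

lemma orbit_subset_X: "z \<in> X \<Longrightarrow> action_orbit act A z \<subseteq> X"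
  using A_X by (auto simp: action_orbit_def)

lemma \<mu>a_orbit:
  assumes z: "z \<in> X"
  shows "convex (\<mu>a ` action_orbit act A z)"
    and "openin (top_of_set ((+) (\<mu>a z) ` orth_compl_in Q \<aa> (isotropy z))) (\<mu>a ` action_orbit act A z)"
proof -
  let ?F = "\<lambda>\<xi>. \<mu>a (act (Exp \<xi>) z)"
  have "?F \<in> \<aa> \<rightarrow> \<aa>" using \<mu>a_mem by blast
  moreover have "continuous_on \<aa> ?F"
    by (rule continuous_on_compose2[OF continuous_\<mu>a[of UNIV]])
      (auto intro: continuous_on_act continuous_exp continuous_on_const)
  moreover have "bounded (?F ` \<aa>)"
  proof -
    have "compact (\<mu>a ` X)" by (intro compact_continuous_image continuous_\<mu>a compact_X)
    moreover have "?F ` \<aa> \<subseteq> \<mu>a ` X" using orbit_subset_X[OF z] by (metis image_mono orbit_image)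
    ultimately show ?thesis using compact_imp_bounded bounded_subset by blast
  qed
  moreover have "?F (\<xi> + \<theta>) = ?F \<xi>" if "\<xi> \<in> \<aa>" "\<theta> \<in> isotropy z" for \<xi> \<theta>
  proof -
    have "flow \<theta> 1 z = z" "\<theta> \<in> \<aa>" using that(2) by (auto simp: isotropy_def simp del: scaleR_one)
    then show ?thesis using exp_add[OF that(1)] by (simp add: act_mult)
  qed
  moreover have "Q (?F \<xi>) \<theta> = Q (?F 0) \<theta>" if \<xi>: "\<xi> \<in> \<aa>" and \<theta>: "\<theta> \<in> isotropy z" for \<xi> \<theta>
  proof -
    have "((\<lambda>s. Q (\<mu>a (flow \<xi> s z)) \<theta>) has_real_derivative 0) (at s)" for s
    proof -
      obtain c where c: "c \<in> \<B>" "flow \<xi> s z \<in> cdom c" using chart_\<B>_at by blast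
      have "\<theta> \<in> isotropy (flow \<xi> s z)" using isotropy_orbit[OF \<aa>_scale[OF \<xi>]] \<theta> by simp
      then have "\<theta> \<in> \<aa>" "field \<theta> c (flow \<xi> s z) = 0" using field_eq_0_iff[OF c] by (auto simp: isotropy_def)
      then show ?thesis
        using \<mu>a_along_curve[OF c(1) has_velocity_flow[OF c], of \<theta>] bilinear_rzero[OF bilinear_\<omega>[OF c]]
          linear_0[OF complex_manifoldD(4)[OF manifold_\<B>]] by simp
    qed
    then have "Q (\<mu>a (flow \<xi> 1 z)) \<theta> = Q (\<mu>a (flow \<xi> 0 z)) \<theta>"
      by (intro DERIV_isconst_all) auto
    then show ?thesis by simp
  qed
  moreover have "Q (?F \<xi>) \<theta> < Q (?F (\<xi> + t *\<^sub>R \<theta>)) \<theta>"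
    if "\<xi> \<in> \<aa>" "\<theta> \<in> \<aa>" "\<theta> \<notin> isotropy z" "0 < t" for \<xi> \<theta> t
  proof -
    have "\<not> (\<forall>t. flow \<theta> t (act (Exp \<xi>) z) = act (Exp \<xi>) z)"
      using isotropy_orbit[OF that(1), of z] that(2,3) by (auto simp: isotropy_def)
    from \<mu>a_increasing[OF that(2) this that(4)] show ?thesis
      using exp_add[OF \<aa>_scale[OF that(2)] that(1), of t] by (simp add: act_mult add.commute)
  qed
  ultimately have "convex (?F ` \<aa>)" "openin (top_of_set ((+) (?F 0) ` orth_compl_in Q \<aa> (isotropy z))) (?F ` \<aa>)"
    using monotone_image_convex_open[OF subspace_isotropy isotropy_subset, of ?F z] by blast+
  then show "convex (\<mu>a ` action_orbit act A z)"
    "openin (top_of_set ((+) (\<mu>a z) ` orth_compl_in Q \<aa> (isotropy z))) (\<mu>a ` action_orbit act A z)"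
    by (simp_all add: orbit_image)
qed

lemma closed_X: "closed X" using compact_X by (rule compact_imp_closed)

lemma closure_orbit_subset_X: "z \<in> X \<Longrightarrow> closure (action_orbit act A z) \<subseteq> X"
  using orbit_subset_X closed_X by (rule closure_minimal)

lemma closure_\<mu>a_orbit:
  assumes "z \<in> X"
  shows "closure (\<mu>a ` action_orbit act A z) = \<mu>a ` closure (action_orbit act A z)"
proof (rule antisym)
  have "compact (closure (action_orbit act A z))"
    using closure_orbit_subset_X[OF assms] compact_Int_closed[OF compact_X closed_closure] by (metis inf.absorb2)
  then have "closed (\<mu>a ` closure (action_orbit act A z))"
    by (intro compact_imp_closed compact_continuous_image continuous_\<mu>a)
  then show "closure (\<mu>a ` action_orbit act A z) \<subseteq> \<mu>a ` closure (action_orbit act A z)"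
    by (rule closure_minimal[rotated]) (intro image_mono closure_subset)
  show "\<mu>a ` closure (action_orbit act A z) \<subseteq> closure (\<mu>a ` action_orbit act A z)"
    by (rule image_closure_subset[OF continuous_\<mu>a closed_closure closure_subset])
qed

lemma orbit_closure_invariant:
  assumes y: "y \<in> closure (action_orbit act A z)"
  shows "action_orbit act A y \<subseteq> closure (action_orbit act A z)"
proof -
  have "act g ` closure (action_orbit act A z) \<subseteq> closure (action_orbit act A z)" if g: "g \<in> A" for g
  proof (rule image_closure_subset)
    show "continuous_on (closure (action_orbit act A z)) (act g)"
      using continuous_on_act[OF continuous_on_const continuous_on_id] by blast
    have "act g (act h z) \<in> action_orbit act A z" if "h \<in> A" for h
    proof -
      obtain v w where "v \<in> \<aa>" "w \<in> \<aa>" "g = Exp v" "h = Exp w"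
        using g \<open>h \<in> A\<close> by (auto simp: A_def)
      then have "act g (act h z) = act (Exp (v + w)) z" "v + w \<in> \<aa>"
        by (simp_all add: exp_add act_mult \<aa>_add)
      then show ?thesis by (simp add: action_orbit_def A_def)
    qed
    then show "act g ` action_orbit act A z \<subseteq> closure (action_orbit act A z)"
      using closure_subset by (fastforce simp: action_orbit_def)
  qed simp
  then show ?thesis using y by (auto simp: action_orbit_def)
qed

lemma fixed_points_iff:
  "z \<in> fixed_points act A X \<longleftrightarrow> z \<in> X \<and> isotropy z = \<aa>"
proof
  assume z: "z \<in> fixed_points act A X"
  then show "z \<in> X \<and> isotropy z = \<aa>"
    by (auto simp: fixed_points_def isotropy_def A_def \<aa>_scale)
next
  assume z: "z \<in> X \<and> isotropy z = \<aa>"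
  have "act (Exp \<xi>) z = z" if "\<xi> \<in> \<aa>" for \<xi>
  proof -
    have "flow \<xi> 1 z = z" using z that unfolding isotropy_def by blast
    then show ?thesis by simp
  qed
  with z show "z \<in> fixed_points act A X" by (auto simp: fixed_points_def A_def)
qed

lemma extreme_point_fixed:
  assumes z: "z \<in> X" and p: "p extreme_point_of closure (\<mu>a ` action_orbit act A z)"
  shows "p \<in> \<mu>a ` (fixed_points act A X \<inter> closure (action_orbit act A z))"
proof -
  let ?P = "closure (\<mu>a ` action_orbit act A z)"
  have "p \<in> ?P" using p by (simp add: extreme_point_of_def)
  then obtain y where y: "y \<in> closure (action_orbit act A z)" "p = \<mu>a y"
    using closure_\<mu>a_orbit[OF z] by auto
  have yX: "y \<in> X" using y(1) closure_orbit_subset_X[OF z] by blast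
  define M where "M = orth_compl_in Q \<aa> (isotropy y)"
  have M: "subspace M" unfolding M_def by (rule subspace_orth_compl[OF isotropy_subset])
  let ?C = "\<mu>a ` action_orbit act A y"
  have CP: "?C \<subseteq> ?P"
    unfolding closure_\<mu>a_orbit[OF z] by (intro image_mono orbit_closure_invariant y)
  have "y \<in> action_orbit act A y" using \<aa>_0 by (force simp: action_orbit_def A_def)
  then have pC: "p \<in> ?C" using y(2) by blast
  have "openin (top_of_set ((+) p ` M)) ?C"
    using \<mu>a_orbit(2)[OF yX] y(2) by (simp add: M_def)
  then have "\<forall>x\<in>?C. \<exists>e>0. \<forall>x'\<in>(+) p ` M. dist x' x < e \<longrightarrow> x' \<in> ?C"
    unfolding openin_euclidean_subtopology_iff by (rule conjunct2)
  from bspec[OF this pC] obtain e where e: "e > 0" "\<And>p'. p' \<in> (+) p ` M \<Longrightarrow> dist p' p < e \<Longrightarrow> p' \<in> ?C"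
    by blast
  have "v = 0" if v: "v \<in> M" for v
  proof (rule ccontr)
    assume v0: "v \<noteq> 0"
    define d where "d = e / (2 * norm v)"
    have d: "d > 0" "\<bar>d\<bar> * norm v < e" using v0 e(1) by (auto simp: d_def)
    have near: "p + r *\<^sub>R v \<in> ?P" if "\<bar>r\<bar> = d" for r
      using e(2)[of "p + r *\<^sub>R v"] subspace_scale[OF M v, of r] d that CP by (auto simp: dist_norm)
    have "p + d *\<^sub>R v \<in> ?P" "p + (- d) *\<^sub>R v \<in> ?P"
      using near[of d] near[of "- d"] d(1) by simp_all
    moreover have "p = midpoint (p + d *\<^sub>R v) (p + (- d) *\<^sub>R v)"
    proof -
      have "(p + d *\<^sub>R v) + (p + (- d) *\<^sub>R v) = 2 *\<^sub>R p" by (simp add: scaleR_2)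
      then show ?thesis unfolding midpoint_def by (simp only:) simp
    qed
    moreover have "(p + d *\<^sub>R v) - (p + (- d) *\<^sub>R v) = (2 * d) *\<^sub>R v"
      unfolding mult_2 scaleR_left_distrib scaleR_minus_left by (rule add_diff_cancel_left[THEN trans]) (rule diff_minus_eq_add)
    then have "p + d *\<^sub>R v \<noteq> p + (- d) *\<^sub>R v" using d(1) v0 by (metis eq_iff_diff_eq_0 less_irrefl mult_pos_pos scaleR_eq_0_iff zero_less_numeral)
    ultimately show False using p unfolding extreme_point_of_def by (metis midpoint_in_open_segment)
  qed
  then have "v \<in> isotropy y" if "v \<in> \<aa>" for v
    using Q_decomp[OF subspace_isotropy isotropy_subset that] unfolding M_def by (metis right_minus_eq)
  then have "y \<in> fixed_points act A X"
    using yX isotropy_subset fixed_points_iff by blast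
  then show ?thesis using y by blast
qed

lemma compact_fixed_points: "compact (fixed_points act A X)"
proof -
  have "fixed_points act A X = X \<inter> (\<Inter>h\<in>A. {z. act h z = z})"
    by (auto simp: fixed_points_def)
  moreover have "closed {z. act h z = z}" for h
    by (intro closed_Collect_eq continuous_on_act continuous_on_id continuous_on_const)
  ultimately show ?thesis using compact_X by (simp add: compact_Int_closed closed_INT)
qed

lemma \<mu>a_locally_constant_on_fixed_points:
  assumes z0: "z0 \<in> fixed_points act A X"
  shows "\<exists>N. open N \<and> z0 \<in> N \<and> (\<forall>z\<in>N \<inter> fixed_points act A X. \<mu>a z = \<mu>a z0)"
proof -
  obtain B where B: "B \<subseteq> \<aa>" "independent B" "span B = \<aa>"
    by (rule subspace_basis[OF subspace_V])
  have finB: "finite B" using B(2) by (rule independent_imp_finite)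
  have flowJ: "flow (- J b) t z = z" if b: "b \<in> \<aa>" and z: "z \<in> fixed_points act A X" for b t z
  proof -
    obtain c where c: "c \<in> \<B>" "z \<in> cdom c" using chart_\<B>_at by blast
    have "field b c z = 0" using z b field_eq_0_iff[OF c] by (auto simp: fixed_points_iff isotropy_def)
    then have "field (- J b) c z = 0"
      using field_minus_J[OF c, of b] linear_0[OF complex_manifoldD(4)[OF manifold_\<B>]] by simp
    then show ?thesis by (rule flow_fixed[OF c])
  qed
  have "\<exists>N. open N \<and> z0 \<in> N \<and> (\<forall>z\<in>N. (\<forall>t. flow (- J b) t z = z) \<longrightarrow> \<mu> z (- J b) = \<mu> z0 (- J b))"
    if "b \<in> B" for b
    using that B(1) by (intro momentum_locally_constant minus_J_mem flowJ z0) auto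
  then obtain N where N: "\<And>b. b \<in> B \<Longrightarrow> open (N b)" "\<And>b. b \<in> B \<Longrightarrow> z0 \<in> N b"
    "\<And>b z. b \<in> B \<Longrightarrow> z \<in> N b \<Longrightarrow> (\<forall>t. flow (- J b) t z = z) \<Longrightarrow> \<mu> z (- J b) = \<mu> z0 (- J b)"
    by metis
  have "\<mu>a z = \<mu>a z0" if z: "z \<in> (\<Inter>b\<in>B. N b) \<inter> fixed_points act A X" for z
  proof -
    have "Q (\<mu>a z) b = Q (\<mu>a z0) b" if b: "b \<in> B" for b
      using N(3)[OF b, of z] z b B(1) flowJ \<mu>a by auto
    then have "Q (\<mu>a z - \<mu>a z0) n = 0" if "n \<in> \<aa>" for n
      using linear_eq_on[OF linear_Q_right linear_zero, of n B "\<mu>a z - \<mu>a z0"] that B(3)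
      by (simp add: Q.diff_left)
    then show ?thesis using Q_pos[OF \<aa>_diff[OF \<mu>a_mem \<mu>a_mem, of z z0]] \<aa>_diff[OF \<mu>a_mem \<mu>a_mem, of z z0] by force
  qed
  moreover have "open (\<Inter>b\<in>B. N b)" "z0 \<in> (\<Inter>b\<in>B. N b)" using finB N(1,2) by auto
  ultimately show ?thesis by blast
qed

lemma finite_\<mu>a_fixed_points: "finite (\<mu>a ` fixed_points act A X)"
proof -
  let ?F = "fixed_points act A X"
  obtain N where N: "\<And>z. z \<in> ?F \<Longrightarrow> open (N z)" "\<And>z. z \<in> ?F \<Longrightarrow> z \<in> N z"
    "\<And>z z'. z \<in> ?F \<Longrightarrow> z' \<in> N z \<inter> ?F \<Longrightarrow> \<mu>a z' = \<mu>a z"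
    using \<mu>a_locally_constant_on_fixed_points by metis
  have cover: "?F \<subseteq> (\<Union>z\<in>?F. N z)" using N(2) by blast
  obtain D where D: "D \<subseteq> ?F" "finite D" "?F \<subseteq> (\<Union>z\<in>D. N z)"
    by (rule compactE_image[OF compact_fixed_points N(1) cover])
  have "\<mu>a ` ?F \<subseteq> \<mu>a ` D"
  proof
    fix p assume "p \<in> \<mu>a ` ?F"
    then obtain z' z where "z' \<in> ?F" "p = \<mu>a z'" "z \<in> D" "z' \<in> N z" using D(3) by blast
    then show "p \<in> \<mu>a ` D" using N(3)[of z z'] D(1) by blast
  qed
  then show ?thesis using D(2) finite_surj by blast
qed

lemma closure_eq_hull:
  assumes z: "z \<in> X"
  shows "closure (\<mu>a ` action_orbit act A z)
      = convex hull (\<mu>a ` (fixed_points act A X \<inter> closure (action_orbit act A z)))"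
proof -
  let ?P = "closure (\<mu>a ` action_orbit act A z)"
    and ?E = "\<mu>a ` (fixed_points act A X \<inter> closure (action_orbit act A z))"
  have "compact (closure (action_orbit act A z))"
    using closure_orbit_subset_X[OF z] compact_Int_closed[OF compact_X closed_closure] by (metis inf.absorb2)
  then have "compact ?P"
    unfolding closure_\<mu>a_orbit[OF z] by (intro compact_continuous_image continuous_\<mu>a)
  moreover have conv: "convex ?P" by (intro convex_closure \<mu>a_orbit z)
  ultimately have "?P = convex hull {p. p extreme_point_of ?P}" by (rule Krein_Milman_Minkowski)
  also have "\<dots> \<subseteq> convex hull ?E" by (rule hull_mono) (use extreme_point_fixed[OF z] in blast)
  finally have "?P \<subseteq> convex hull ?E" .
  moreover have "?E \<subseteq> ?P" unfolding closure_\<mu>a_orbit[OF z] by blast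
  then have "convex hull ?E \<subseteq> ?P" using conv by (rule hull_minimal)
  ultimately show ?thesis by (rule antisym)
qed

lemma polytope_closure:
  assumes "z \<in> X" shows "polytope (closure (\<mu>a ` action_orbit act A z))"
  unfolding closure_eq_hull[OF assms]
  by (intro polytope_convex_hull finite_subset[OF _ finite_\<mu>a_fixed_points]) blast

lemma ray_in_A_imp_mem:
  assumes v: "\<And>t. Exp (t *\<^sub>R v) \<in> A"
  shows "v \<in> \<aa>"
proof -
  have "\<exists>a\<in>\<aa>. Exp (t *\<^sub>R v) = Exp a" for t using v[of t] by (auto simp: A_def)
  then obtain a where a: "\<And>t. a t \<in> \<aa>" "\<And>t. Exp (t *\<^sub>R v) = Exp (a t)" by metis
  have eqI: "u = w" if "Exp u = Exp w" "u \<in> \<aa>" "w \<in> \<aa>" for u w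
    using inj_exp that by (auto dest: inj_onD)
  have add: "a (s + t) = a s + a t" for s t
    by (rule eqI) (simp_all add: a \<aa>_add exp_add Lie_exp_add flip: a(2))
  have a0: "a 0 = 0" using add[of 0 0] by simp
  have neg: "a (- t) = - a t" for t using add[of t "- t"] a0 by (simp add: add_eq_0_iff)
  have nat: "a (real n * t) = real n *\<^sub>R a t" for n t
    by (induction n) (simp_all add: a0 add distrib_right scaleR_left_distrib)
  have int: "a (of_int n * t) = of_int n *\<^sub>R a t" for n t
    by (cases n rule: int_cases2) (use nat neg in \<open>simp_all add: minus_mult_left[symmetric]\<close>)
  have rat: "a r = r *\<^sub>R a 1" if r: "r \<in> \<rat>" for r
  proof -
    obtain p q :: int where pq: "q > 0" "r = of_int p / of_int q" using Rats_cases'[OF r] by metis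
    have "of_int q *\<^sub>R a r = of_int p *\<^sub>R a 1"
      using int[of q r] int[of p 1] pq by simp
    then have "(1 / of_int q) *\<^sub>R (of_int q *\<^sub>R a r) = (1 / of_int q) *\<^sub>R (of_int p *\<^sub>R a 1)" by simp
    then show ?thesis using pq by simp
  qed
  have "{t. Exp (t *\<^sub>R v) = Exp (t *\<^sub>R a 1)} = UNIV"
  proof -
    have "closed {t. Exp (t *\<^sub>R v) = Exp (t *\<^sub>R a 1)}"
      by (intro closed_Collect_eq continuous_Lie_exp_ray)
    moreover have "\<rat> \<subseteq> {t. Exp (t *\<^sub>R v) = Exp (t *\<^sub>R a 1)}"
    proof
      fix r :: real assume "r \<in> \<rat>"
      then show "r \<in> {t. Exp (t *\<^sub>R v) = Exp (t *\<^sub>R a 1)}"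
        using a(2)[of r] rat[of r] by simp
    qed
    ultimately have "closure \<rat> \<subseteq> {t. Exp (t *\<^sub>R v) = Exp (t *\<^sub>R a 1)}"
      by (intro closure_minimal)
    moreover have "t \<in> closure \<rat>" for t :: real
      unfolding closure_approachable
    proof (intro allI impI)
      fix e :: real assume "e > 0"
      then obtain r where "r \<in> \<rat>" "t < r" "r < t + e" using Rats_dense_in_real[of t "t + e"] by auto
      then show "\<exists>r\<in>\<rat>. dist r t < e" by (intro bexI[of _ r]) (auto simp: dist_real_def)
    qed
    ultimately show ?thesis by blast
  qed
  then have "(\<lambda>t. Exp (t *\<^sub>R v)) = (\<lambda>t. Exp (t *\<^sub>R a 1))" by blast
  then have "v = a 1" using has_velocity_unique has_velocity_Lie_exp[of v] has_velocity_Lie_exp[of "a 1"] by metis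
  then show ?thesis using a(1) by simp
qed

lemma isotropy_eq: "isotropy z = Lie (stabilizer_in act A z)"
proof
  show "isotropy z \<subseteq> Lie (stabilizer_in act A z)"
    by (auto simp: isotropy_def Lie_alg_def stabilizer_in_def A_def \<aa>_scale)
  show "Lie (stabilizer_in act A z) \<subseteq> isotropy z"
    using ray_in_A_imp_mem by (auto simp: isotropy_def Lie_alg_def stabilizer_in_def)
qed

end

lemma subspace_inner_exists:
  fixes V :: "'e::euclidean_space set" and q :: "'e \<Rightarrow> 'e \<Rightarrow> real"
  assumes V: "subspace V"
    and add: "\<And>u v w. \<lbrakk>u \<in> V; v \<in> V; w \<in> V\<rbrakk> \<Longrightarrow> q (u + v) w = q u w + q v w"
    and scale: "\<And>r v w. \<lbrakk>v \<in> V; w \<in> V\<rbrakk> \<Longrightarrow> q (r *\<^sub>R v) w = r * q v w"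
    and sym: "\<And>v w. \<lbrakk>v \<in> V; w \<in> V\<rbrakk> \<Longrightarrow> q v w = q w v"
    and pos: "\<And>v. \<lbrakk>v \<in> V; v \<noteq> 0\<rbrakk> \<Longrightarrow> q v v > 0"
  obtains Q where "subspace_inner V Q" "\<And>v w. \<lbrakk>v \<in> V; w \<in> V\<rbrakk> \<Longrightarrow> Q v w = q v w"
proof -
  obtain \<pi> where \<pi>: "linear \<pi>" and \<pi>V: "\<And>v. \<pi> v \<in> V" and \<pi>id: "\<And>v. v \<in> V \<Longrightarrow> \<pi> v = v"
    by (rule linear_projection[OF V]) (rule that)
  define Q where "Q = (\<lambda>v w. q (\<pi> v) (\<pi> w))"
  have Q: "Q v w = q v w" if "v \<in> V" "w \<in> V" for v w using that by (simp add: Q_def \<pi>id)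
  have "linear (\<lambda>v. Q v w)" for w
    unfolding Q_def using \<pi>V by (intro linearI) (simp_all add: linear_add[OF \<pi>] linear_cmul[OF \<pi>] add scale)
  moreover have "linear (\<lambda>w. Q v w)" for v
    unfolding Q_def using \<pi>V V
    by (intro linearI) (simp_all add: linear_add[OF \<pi>] linear_cmul[OF \<pi>] add scale sym[of "\<pi> v"] subspace_add subspace_scale)
  ultimately have "bilinear Q" by (simp add: bilinear_def)
  then have "subspace_inner V Q" using V by unfold_locales (auto simp: Q sym pos)
  then show ?thesis using Q by (rule that)
qed

theorem theorem3p1:
  fixes H :: "('h::{t2_space,second_countable_topology}) monoid"
    and \<A> :: "('h, 'e::euclidean_space) chart set" and JH :: "'e \<Rightarrow> 'e"
    and \<kappa> :: "('h, 'e) chart"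
    and U G A :: "'h set" and \<aa> :: "'e set" and ip :: "'e \<Rightarrow> 'e \<Rightarrow> real"
    and \<B> :: "('z::{t2_space,second_countable_topology}, 'f::euclidean_space) chart set"
    and JZ :: "'f \<Rightarrow> 'f" and \<omega> :: "('z, 'f) two_form"
    and act :: "'h \<Rightarrow> 'z \<Rightarrow> 'z" and \<mu> :: "'z \<Rightarrow> 'e \<Rightarrow> real"
    and X :: "'z set" and x :: 'z
  assumes "complex_Lie_group H \<A> JH" and "\<kappa> \<in> \<A>" and "\<one>\<^bsub>H\<^esub> \<in> cdom \<kappa>"
    and "subgroup U H" and "compact U" and "connected U" and "complexification_of H \<kappa> JH U"
    and "Kaehler_manifold \<B> JZ \<omega>"
    and "holomorphic_action H \<A> JH \<B> JZ act"
    and "invariant_two_form \<B> \<omega> act U"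
    and "momentum_map H \<kappa> U \<B> \<omega> act \<mu>"
    and "invariant_scalar_product H \<kappa> U ip"
    and "compatible_subgroup H \<kappa> JH U G" and "closed G" and "connected G"
    and "abelian_subalgebra H \<kappa> \<aa>" and "\<aa> \<subseteq> p_part H \<kappa> JH U G"
    and "A = Lie_exp H \<kappa> ` \<aa>"
    and "submanifold \<B> X" and "compact X" and "\<forall>h\<in>A. act h ` X \<subseteq> X"
    and "x \<in> X"
  shows "let \<mu>a = gradient_map JH ip \<mu> \<aa>;
             Ax = action_orbit act A x;
             \<aa>x = Lie_alg H \<kappa> (stabilizer_in act A x);
             L = (+) (\<mu>a x) ` orth_compl_in (scalar_product_i JH ip) \<aa> \<aa>x
         in convex (\<mu>a ` Ax) \<and> openin (top_of_set L) (\<mu>a ` Ax) \<and>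
            closure (\<mu>a ` Ax) = \<mu>a ` closure Ax \<and>
            polytope (closure (\<mu>a ` Ax)) \<and>
            closure (\<mu>a ` Ax) = convex hull (\<mu>a ` (fixed_points act A X \<inter> closure Ax))"
proof -
  define \<uu> where "\<uu> = Lie_alg H \<kappa> U"
  define q where "q = scalar_product_i JH ip"
  interpret lie_group_action H \<A> JH \<kappa> \<B> JZ act
    using assms(1,2,3,8,9) by unfold_locales (auto simp: Kaehler_manifold_def)
  interpret Hamiltonian_action H \<A> JH \<kappa> \<B> JZ act \<omega> U \<mu>
    using assms(5,8,10,11) by unfold_locales
  have J: "linear JH" "\<And>v. JH (JH v) = - v" using complex_manifoldD(4,5)[OF manifold] by auto
  have \<aa>: "subspace \<aa>" "\<And>v w. \<lbrakk>v \<in> \<aa>; w \<in> \<aa>\<rbrakk> \<Longrightarrow> Lie_bracket H \<kappa> v w = 0"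
    using assms(16) by (auto simp: abelian_subalgebra_def)
  have \<aa>\<uu>: "- JH v \<in> \<uu>" if v: "v \<in> \<aa>" for v
  proof -
    obtain u where "u \<in> \<uu>" "v = JH u" using assms(17) v by (auto simp: p_part_def \<uu>_def)
    then show ?thesis using J(2) by simp
  qed
  have ip: "\<And>u v w. \<lbrakk>u \<in> \<uu>; v \<in> \<uu>; w \<in> \<uu>\<rbrakk> \<Longrightarrow> ip (u + v) w = ip u w + ip v w"
    "\<And>r v w. \<lbrakk>v \<in> \<uu>; w \<in> \<uu>\<rbrakk> \<Longrightarrow> ip (r *\<^sub>R v) w = r * ip v w"
    "\<And>v w. \<lbrakk>v \<in> \<uu>; w \<in> \<uu>\<rbrakk> \<Longrightarrow> ip v w = ip w v"
    "\<And>v. \<lbrakk>v \<in> \<uu>; v \<noteq> 0\<rbrakk> \<Longrightarrow> ip v v > 0"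
    using assms(12) unfolding invariant_scalar_product_def Let_def \<uu>_def[symmetric] by blast+
  have \<mu>: "\<And>z v w. \<lbrakk>v \<in> \<uu>; w \<in> \<uu>\<rbrakk> \<Longrightarrow> \<mu> z (v + w) = \<mu> z v + \<mu> z w"
    "\<And>z r v. v \<in> \<uu> \<Longrightarrow> \<mu> z (r *\<^sub>R v) = r * \<mu> z v"
    using assms(11) unfolding momentum_map_def Let_def \<uu>_def[symmetric] by blast+
  obtain Q where Q: "subspace_inner \<aa> Q" "\<And>v w. \<lbrakk>v \<in> \<aa>; w \<in> \<aa>\<rbrakk> \<Longrightarrow> Q v w = q v w"
  proof (rule subspace_inner_exists[OF \<aa>(1), of q])
    fix u v w :: 'e and r :: real
    assume v: "v \<in> \<aa>" and w: "w \<in> \<aa>"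
    show "q (u + v) w = q u w + q v w" if u: "u \<in> \<aa>"
    proof -
      have "- JH (u + v) = - JH u + - JH v" using J(1) by (simp add: linear_add)
      then show ?thesis using ip(1)[OF \<aa>\<uu>[OF u] \<aa>\<uu>[OF v] \<aa>\<uu>[OF w]] by (simp add: q_def scalar_product_i_def)
    qed
    have "- JH (r *\<^sub>R v) = r *\<^sub>R (- JH v)" using J(1) by (simp add: linear_cmul)
    then show "q (r *\<^sub>R v) w = r * q v w"
      using ip(2)[OF \<aa>\<uu>[OF v] \<aa>\<uu>[OF w]] by (simp add: q_def scalar_product_i_def)
    show "q v w = q w v"
      using ip(3)[OF \<aa>\<uu>[OF v] \<aa>\<uu>[OF w]] by (simp add: q_def scalar_product_i_def)
    have "JH v \<noteq> 0" if "v \<noteq> 0" using J(2)[of v] that linear_0[OF J(1)] by auto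
    then show "q v v > 0" if "v \<noteq> 0"
      using ip(4)[OF \<aa>\<uu>[OF v]] that by (simp add: q_def scalar_product_i_def)
  qed (rule that)
  interpret Q: subspace_inner \<aa> Q by (rule Q(1))
  define \<mu>a where "\<mu>a = gradient_map JH ip \<mu> \<aa>"
  have \<mu>a: "\<mu>a z \<in> \<aa> \<and> (\<forall>\<beta>\<in>\<aa>. Q (\<mu>a z) \<beta> = \<mu> z (- JH \<beta>))" for z
  proof -
    have "\<exists>l. linear l \<and> (\<forall>\<beta>\<in>\<aa>. l \<beta> = \<mu> z (- JH \<beta>))"
    proof -
      obtain \<pi> where \<pi>: "linear \<pi>" "\<And>v. \<pi> v \<in> \<aa>" "\<And>v. v \<in> \<aa> \<Longrightarrow> \<pi> v = v"
        by (rule linear_projection[OF \<aa>(1)]) (rule that)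
      have \<pi>\<uu>: "- JH (\<pi> v) \<in> \<uu>" for v by (intro \<aa>\<uu> \<pi>)
      have "\<mu> z (- JH (\<pi> (v + w))) = \<mu> z (- JH (\<pi> v)) + \<mu> z (- JH (\<pi> w))" for v w
        using \<mu>(1)[OF \<pi>\<uu>[of v] \<pi>\<uu>[of w]] by (simp add: linear_add[OF \<pi>(1)] linear_add[OF J(1)])
      moreover have "\<mu> z (- JH (\<pi> (r *\<^sub>R v))) = r *\<^sub>R \<mu> z (- JH (\<pi> v))" for r v
        using \<mu>(2)[OF \<pi>\<uu>[of v], of z r] by (simp add: linear_cmul[OF \<pi>(1)] linear_cmul[OF J(1)])
      ultimately have "linear (\<lambda>v. \<mu> z (- JH (\<pi> v)))" by (rule linearI)
      with \<pi>(3) show ?thesis by (intro exI[of _ "\<lambda>v. \<mu> z (- JH (\<pi> v))"]) auto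
    qed
    then obtain v where v: "v \<in> \<aa>" "\<forall>\<beta>\<in>\<aa>. Q v \<beta> = \<mu> z (- JH \<beta>)"
      using Q.Q_riesz[OF \<aa>(1) subset_refl] by metis
    have minus: "- \<mu> z (JH \<beta>) = \<mu> z (- JH \<beta>)" if "\<beta> \<in> \<aa>" for \<beta>
      using \<mu>(2)[OF \<aa>\<uu>[OF that], of z "- 1"] by simp
    have "\<mu>a z = v"
      unfolding \<mu>a_def gradient_map_def
    proof (rule the_equality)
      show "v \<in> \<aa> \<and> (\<forall>\<beta>\<in>\<aa>. scalar_product_i JH ip v \<beta> = - \<mu> z (JH \<beta>))"
        using v Q(2) by (simp add: minus flip: q_def)
      fix u assume u: "u \<in> \<aa> \<and> (\<forall>\<beta>\<in>\<aa>. scalar_product_i JH ip u \<beta> = - \<mu> z (JH \<beta>))"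
      have "u - v \<in> \<aa>" using u v(1) \<aa>(1) subspace_diff by blast
      moreover from this have "Q u (u - v) = Q v (u - v)"
        using u v Q(2) minus by (simp flip: q_def)
      ultimately show "u = v" using Q.Q_pos[of "u - v"] by (force simp: Q.Q.diff_left)
    qed
    with v show ?thesis by simp
  qed
  obtain p where p: "homeomorphism (U \<times> \<uu>) UNIV (\<lambda>(k, v). k \<otimes>\<^bsub>H\<^esub> Lie_exp H \<kappa> (JH v)) p"
    using assms(7) by (auto simp: complexification_of_def Let_def \<uu>_def)
  have oneU: "\<one>\<^bsub>H\<^esub> \<in> U" using assms(4) by (rule subgroup.one_closed)
  have exp_eq: "Lie_exp H \<kappa> v = (\<lambda>(k, v). k \<otimes>\<^bsub>H\<^esub> Lie_exp H \<kappa> (JH v)) (\<one>\<^bsub>H\<^esub>, - JH v)" for v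
    using J by (simp add: linear_neg)
  have cont_exp: "continuous_on \<aa> (Lie_exp H \<kappa>)"
  proof -
    have "continuous_on \<aa> (\<lambda>v. (\<lambda>(k, v). k \<otimes>\<^bsub>H\<^esub> Lie_exp H \<kappa> (JH v)) (\<one>\<^bsub>H\<^esub>, - JH v))"
    proof (rule continuous_on_compose2[OF homeomorphism_cont1[OF p]])
      show "continuous_on \<aa> (\<lambda>v. (\<one>\<^bsub>H\<^esub>, - JH v))"
        by (intro continuous_on_Pair continuous_on_minus linear_continuous_on_compose[OF _ J(1)] continuous_intros)
    qed (use oneU \<aa>\<uu> in auto)
    then show ?thesis by (rule continuous_on_eq) (rule exp_eq[symmetric])
  qed
  have inj_exp: "inj_on (Lie_exp H \<kappa>) \<aa>"
  proof (rule inj_onI)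
    fix v w assume v: "v \<in> \<aa>" "w \<in> \<aa>" "Lie_exp H \<kappa> v = Lie_exp H \<kappa> w"
    have "(\<one>\<^bsub>H\<^esub>, - JH v) = (\<one>\<^bsub>H\<^esub>, - JH w)"
      using homeomorphism_apply1[OF p] v exp_eq oneU \<aa>\<uu> by (metis SigmaI)
    then have "JH (JH v) = JH (JH w)" by simp
    then show "v = w" using J(2) by simp
  qed
  interpret gradient_action H \<A> JH \<kappa> \<B> JZ act \<omega> U \<mu> \<aa> Q \<mu>a A X
  proof
    show "act h z \<in> X" if "h \<in> A" "z \<in> X" for h z using assms(21) that by blast
  qed (use \<aa>\<uu> \<aa>(2) \<mu>a cont_exp inj_exp assms(18,20) in \<open>auto simp: \<uu>_def\<close>)
  have "orth_compl_in Q \<aa> (isotropy x) = orth_compl_in q \<aa> (isotropy x)"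
    using isotropy_subset Q(2) by (auto simp: orth_compl_in_def subset_iff)
  then show ?thesis
    using \<mu>a_orbit[OF assms(22)] closure_\<mu>a_orbit[OF assms(22)] polytope_closure[OF assms(22)]
      closure_eq_hull[OF assms(22)]
    unfolding Let_def \<mu>a_def[symmetric] isotropy_eq[symmetric] q_def by simp
qed

end
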